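(* Let $N\ge 1$ be an integer, $\tau>0$, $\gamma>0$, and let $\varphi$ be convex-concave and $M$-Lipschitz with respect to $\|\cdot\|_2$ on the neighbourhood $U$ of $\mathcal Z$ described in the context. Let $z_0\in\mathcal Z$ and let $z_{k+1}=\mathrm{prox}_{z_k}\big(\gamma\, g(z_k,\mathbf e_k,\tau,\xi_k^{\pm})\big)$ for $k=0,\dots,N$ (constant step size $\gamma_k=\gamma$), and let $\bar z_N=(\bar x_N,\bar y_N)=\frac1{N+1}\sum_{k=0}^N z_k$. Then $$\mathbb E\left[\varepsilon_{sad}(\bar z_N)\right]\le \frac{3\Omega^2}{2\gamma(N+1)}+\frac{3\gamma M_{all}^2}{2}+\frac{\Delta\,\Omega\, n\, a_q}{\tau}+2\tau M,$$ where $$M_{all}^2=3\left(3nM^2+\frac{n^2(\sigma^2+\Delta^2)}{\tau^2}\right)a_q^2,\qquad \varepsilon_{sad}(\bar z_N)=\max_{y'\in\mathcal Y}\varphi(\bar x_N,y')-\min_{x'\in\mathcal X}\varphi(x',\bar y_N).$$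
   Context: Problem: $\min_{x\in\mathcal X}\max_{y\in\mathcal Y}\varphi(x,y)$, where $\mathcal X\subset\mathbb R^{n_x}$, $\mathcal Y\subset\mathbb R^{n_y}$ are nonempty compact convex sets, $\mathcal Z=\mathcal X\times\mathcal Y$, $n=n_x+n_y\ge 3$, $z=(x,y)$, $\varphi(z)=\varphi(x,y)$. The function $\varphi$ is defined on a set $U=U_X\times U_Y$, with $U_X\subset\mathbb R^{n_x}$, $U_Y\subset\mathbb R^{n_y}$ open convex, such that $U$ contains all points $z+\tau e$ with $z\in\mathcal Z$, $\|e\|_2\le 1$. Convex-concave means $\varphi(\cdot,y)$ is convex for each $y$ and $\varphi(x,\cdot)$ is concave for each $x$. $M$-Lipschitz ($M>0$): $|\varphi(z)-\varphi(z')|\le M\|z-z'\|_2$ for all $z,z'\in U$. Geometry: $p\in[1,2]$, $q\in[2,\infty]$, $\frac1p+\frac1q=1$. A prox-function $d:\mathcal Z\to\mathbb R$ is a differentiable function that is $1$-strongly convex with respect to $\|\cdot\|_p$. The Bregman divergence is $V_z(w)=d(w)-d(z)-\langle\nabla d(z),w-z\rangle$, the Bregman diameter is $\Omega=\max\{\sqrt{2V_{z_1}(z_2)}: z_1,z_2\in\mathcal Z\}<\infty$, and $\mathrm{prox}_z(w)=\arg\min_{u\in\mathcal Z}\left(V_z(u)+\langle w,u\rangle\right)$. The constant $a_q>0$ is given by $a_q^2=\min\{2q-1,\,32\log n-8\}\,n^{\frac2q-1}$ (for $q=\infty$, $2/q=0$ and the minimum is $32\log n-8$). Oracle: only noisy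 values $\tilde\varphi(z,\xi)=\varphi(z)+\xi+\delta(z)$ are available, where $\delta$ is a deterministic measurable function on $U$ with $|\delta|\le\Delta$, and $\xi$ is a real random variable with $\mathbb E\xi=0$, $\mathbb E[\xi^2]\le\sigma^2$ ($\Delta,\sigma>0$), generated independently of the query point. Gradient estimator (one-point feedback): for $\mathbf e=(\mathbf e_x,\mathbf e_y)$ uniformly distributed on the Euclidean unit sphere of $\mathbb R^n$ (with $\mathbf e_x\in\mathbb R^{n_x}$, $\mathbf e_y\in\mathbb R^{n_y}$), $$g(z,\mathbf e,\tau,\xi^{\pm})=\frac{n\left(\tilde\varphi(z+\tau\mathbf e,\xi^+)-\tilde\varphi(z-\tau\mathbf e,\xi^-)\right)}{2\tau}\begin{pmatrix}\mathbf e_x\\-\mathbf e_y\end{pmatrix}.$$ At each iteration $k$, $\mathbf e_k$ and the noises $\xi_k^+,\xi_k^-$ are generated independently of each other and of the previous iterations. *)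

theory Defs
  imports "HOL-Probability.Probability"
begin

definition p_norm :: "real \<Rightarrow> 'a::euclidean_space \<Rightarrow> real" where
  "p_norm p v = (\<Sum>b\<in>Basis. \<bar>v \<bullet> b\<bar> powr p) powr (1 / p)"

definition strongly_convex_on :: "('a::real_vector \<Rightarrow> real) \<Rightarrow> real \<Rightarrow> 'a set \<Rightarrow> ('a \<Rightarrow> real) \<Rightarrow> bool" where
  "strongly_convex_on nrm \<mu> S f \<longleftrightarrow> convex S \<and>
     (\<forall>u\<in>S. \<forall>v\<in>S. \<forall>t\<in>{0..1}.
        f ((1 - t) *\<^sub>R u + t *\<^sub>R v)
          \<le> (1 - t) * f u + t * f v - \<mu> / 2 * t * (1 - t) * (nrm (u - v))\<^sup>2)"

text \<open>The domain \<open>Z\<close> of the prox-function may have empty interior or \<open>z\<close> may be a boundary point,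
  so \<open>\<langle>\<nabla>d(z), w - z\<rangle>\<close> is the derivative of \<open>d\<close> at \<open>z\<close> relative to \<open>Z\<close>, applied to \<open>w - z\<close>.
  The derivative need not be unique, but for convex \<open>Z\<close> and \<open>w \<in> Z\<close> this value is:
  it is the one-sided directional derivative along the segment from \<open>z\<close> to \<open>w\<close>.\<close>

definition bregman :: "('a::euclidean_space \<Rightarrow> real) \<Rightarrow> 'a set \<Rightarrow> 'a \<Rightarrow> 'a \<Rightarrow> real" where
  "bregman d Z z w = d w - d z - frechet_derivative d (at z within Z) (w - z)"

definition bregman_distances :: "('a::euclidean_space \<Rightarrow> real) \<Rightarrow> 'a set \<Rightarrow> real set" where
  "bregman_distances d Z = {sqrt (2 * bregman d Z z w) | z w. z \<in> Z \<and> w \<in> Z}"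

text \<open>Meaningful only if \<open>bregman_distances d Z\<close> is bounded above.\<close>

definition bregman_diameter :: "('a::euclidean_space \<Rightarrow> real) \<Rightarrow> 'a set \<Rightarrow> real" where
  "bregman_diameter d Z = Sup (bregman_distances d Z)"

definition prox :: "('a::euclidean_space \<Rightarrow> real) \<Rightarrow> 'a set \<Rightarrow> 'a \<Rightarrow> 'a \<Rightarrow> 'a" where
  "prox d Z z w = arg_min_on (\<lambda>u. bregman d Z z u + w \<bullet> u) Z"

text \<open>In \<^typ>\<open>ereal\<close>, \<open>2 / \<infinity> = 0\<close> and \<open>2 * \<infinity> - 1 = \<infinity>\<close>, so \<open>q = \<infinity>\<close> needs no separate case.\<close>

definition a_const :: "nat \<Rightarrow> ereal \<Rightarrow> real" where
  "a_const n q =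
     sqrt (real_of_ereal (min (2 * q - 1) (ereal (32 * ln (real n) - 8)))
             * real n powr (real_of_ereal (2 / q) - 1))"

definition noisy_value :: "('a \<Rightarrow> real) \<Rightarrow> ('a \<Rightarrow> real) \<Rightarrow> 'a \<Rightarrow> real \<Rightarrow> real" where
  "noisy_value \<phi> \<delta> z \<xi> = \<phi> z + \<xi> + \<delta> z"

definition grad_est ::
  "('a::euclidean_space \<times> 'b::euclidean_space \<Rightarrow> real) \<Rightarrow> ('a \<times> 'b \<Rightarrow> real)
     \<Rightarrow> 'a \<times> 'b \<Rightarrow> 'a \<times> 'b \<Rightarrow> real \<Rightarrow> real \<Rightarrow> real \<Rightarrow> 'a \<times> 'b" where
  "grad_est \<phi> \<delta> z e \<tau> \<xi>p \<xi>m =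
     (real DIM('a \<times> 'b)
        * (noisy_value \<phi> \<delta> (z + \<tau> *\<^sub>R e) \<xi>p - noisy_value \<phi> \<delta> (z - \<tau> *\<^sub>R e) \<xi>m) / (2 * \<tau>))
       *\<^sub>R (fst e, - snd e)"

text \<open>The uniform distribution on the Euclidean unit sphere, as the radial projection of the uniform
  distribution on the unit ball; equivalently, the measure of a Borel set \<open>A\<close> of the sphere is the
  normalised volume of the cone \<open>{t *\<^sub>R a | t a. 0 < t \<and> t \<le> 1 \<and> a \<in> A}\<close>.\<close>

definition uniform_sphere :: "'a::euclidean_space measure" where
  "uniform_sphere = distr (uniform_measure lborel (cball 0 1)) borel (\<lambda>v. v /\<^sub>R norm v)"

text \<open>\<^const>\<open>prob_space.indep_var\<close> requires both random variables to have the same type; this is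
  the same notion for variables of different types.\<close>

definition indep_rv ::
  "'w measure \<Rightarrow> ('w \<Rightarrow> 'a::topological_space) \<Rightarrow> ('w \<Rightarrow> 'b::topological_space) \<Rightarrow> bool" where
  "indep_rv P A B \<longleftrightarrow> A \<in> borel_measurable P \<and> B \<in> borel_measurable P \<and>
     prob_space.indep_set P {A -` S \<inter> space P | S. S \<in> sets borel} {B -` S \<inter> space P | S. S \<in> sets borel}"

definition saddle_gap :: "('a \<times> 'b \<Rightarrow> real) \<Rightarrow> 'a set \<Rightarrow> 'b set \<Rightarrow> 'a \<times> 'b \<Rightarrow> real" where
  "saddle_gap \<phi> X Y z = (SUP y\<in>Y. \<phi> (fst z, y)) - (INF x\<in>X. \<phi> (x, snd z))"

definition M_all_sq :: "nat \<Rightarrow> real \<Rightarrow> real \<Rightarrow> real \<Rightarrow> real \<Rightarrow> ereal \<Rightarrow> real" where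
  "M_all_sq n M \<sigma> \<Delta> \<tau> q =
     3 * (3 * real n * M\<^sup>2 + (real n)\<^sup>2 * (\<sigma>\<^sup>2 + \<Delta>\<^sup>2) / \<tau>\<^sup>2) * (a_const n q)\<^sup>2"

end

theory Submission
  imports Defs "HOL-Real_Asymp.Real_Asymp"
begin

text \<open>Up to the bias caused by \<open>\<delta>\<close>, the mean of the gradient estimator is the gradient (with flipped
  \<open>y\<close>-part) of the average of \<open>\<phi>\<close> over a ball of radius \<open>\<tau>\<close>. This average is within \<open>\<tau> * M\<close> of \<open>\<phi>\<close>
  and again convex-concave, so the duality gap is controlled by the regret of the mirror descent
  iterates against the mean estimators. The martingale differences are absorbed by a shadow sequence
  of prox steps.

  The second moment of the estimator needs \<open>E G ^ 4 \<le> 9 * K ^ 4 / n\<^sup>2\<close> for an odd \<open>K\<close>-Lipschitz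
  function \<open>G\<close> on the sphere, here \<open>G e = \<phi> (z + \<tau> *\<^sub>R e) - \<phi> (z - \<tau> *\<^sub>R e)\<close>. It comes from a Poincare
  inequality for odd functions, which passes to the sphere from the Gaussian measure: if \<open>h\<close> is odd
  and \<open>X\<close>, \<open>Y\<close> are independent Gaussians, then \<open>c(a) = E (h X * h (cos a *\<^sub>R X + sin a *\<^sub>R Y))\<close> vanishes at
  \<open>a = pi / 2\<close>, and \<open>c(2 * a) \<le> cos (2 * a) * c(0)\<close> implies \<open>c(a) \<le> cos a * c(0)\<close> by expanding the square of
  \<open>h X + h (cos (2 * a) *\<^sub>R X + sin (2 * a) *\<^sub>R Y) - 2 * cos a * h (cos a *\<^sub>R X + sin a *\<^sub>R Y)\<close>.
  Letting \<open>a\<close> tend to \<open>0\<close> along \<open>pi / 2 ^ k\<close> gives \<open>E (h X)\<^sup>2 \<le> E (D h X Y)\<^sup>2\<close>.\<close>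

subsection \<open>Polar coordinates\<close>

text \<open>The direction \<open>e\<close> enters both the difference of the values of
  \<open>\<phi>\<close> and the dual norm of the estimator, so these factors of the second moment
  are not independent; AM-GM separates them into two fourth moments. With
  \<open>K = 2 * \<tau> * M\<close> the bound \<open>9 * K ^ 4 / n\<^sup>2\<close> yields exactly
  the term \<open>3 * n * M\<^sup>2\<close> of \<open>M_all_sq\<close>, so a concentration
  inequality with an unspecified constant would not do. The Poincare inequality on the sphere has
  the constant \<open>n - 1\<close>; using it twice gives
  \<open>4 * K ^ 4 / (n - 1)\<^sup>2\<close>, and \<open>n \<ge> 3\<close> turns this into the bound
  above. The shadow sequence is there because the comparison point that realises the gap depends on
  the noise. No conditional expectations occur: the state before step \<open>k\<close> and the
  randomness of step \<open>k\<close> have a product law, and Fubini does the rest. This needs a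
  measurable prox-mapping, which is not evident because the derivative of \<open>d\<close> relative
  to \<open>Z\<close> is only a choice. \<open>\<phi>\<close> and \<open>\<delta>\<close> are given
  on \<open>U\<close> only and are first extended to the whole space.\<close>

lemma nn_integral_lborel_affine:
  fixes f :: "'a::euclidean_space \<Rightarrow> ennreal"
  assumes [measurable]: "f \<in> borel_measurable borel" and "c \<noteq> 0"
  shows "(\<integral>\<^sup>+x. f x \<partial>lborel) = ennreal (\<bar>c\<bar> ^ DIM('a)) * (\<integral>\<^sup>+x. f (t + c *\<^sub>R x) \<partial>lborel)"
  by (subst lborel_affine[OF assms(2), of t])
     (simp add: nn_integral_density nn_integral_distr nn_integral_cmult)

lemma space_uniform_sphere [simp]: "space uniform_sphere = UNIV"
  and sets_uniform_sphere [simp, measurable_cong]: "sets uniform_sphere = sets borel"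
  by (simp_all add: uniform_sphere_def)

lemma emeasure_unit_ball:
  "emeasure lborel (cball 0 1 :: 'a::euclidean_space set) = ennreal (unit_ball_vol (real DIM('a)))"
  by (simp add: emeasure_cball)

lemma prob_space_uniform_sphere: "prob_space (uniform_sphere :: 'a::euclidean_space measure)"
  unfolding uniform_sphere_def
proof (rule prob_space.prob_space_distr)
  show "prob_space (uniform_measure lborel (cball 0 1 :: 'a set))"
    using unit_ball_vol_pos[of "real DIM('a)"]
    by (intro prob_space_uniform_measure) (auto simp: emeasure_unit_ball simp del: unit_ball_vol_pos)
qed simp

interpretation uniform_sphere: prob_space uniform_sphere
  by (rule prob_space_uniform_sphere)

lemma nn_integral_uniform_sphere:
  fixes f :: "'a::euclidean_space \<Rightarrow> ennreal"
  assumes [measurable]: "f \<in> borel_measurable borel"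
  shows "(\<integral>\<^sup>+e. f e \<partial>uniform_sphere)
    = (\<integral>\<^sup>+x. f (x /\<^sub>R norm x) * indicator (cball 0 1) x \<partial>lborel) / ennreal (unit_ball_vol (real DIM('a)))"
  unfolding uniform_sphere_def
  by (subst nn_integral_distr) (simp_all add: nn_integral_uniform_measure emeasure_unit_ball)

lemma AE_lborel_neq_0: "AE x in lborel. (x::'a::euclidean_space) \<noteq> 0"
  using AE_lborel_singleton[of "0::'a"] by simp

lemma AE_uniform_sphere: "AE e in uniform_sphere. norm (e::'a::euclidean_space) = 1"
proof -
  have "AE x in uniform_measure lborel (cball 0 1). norm ((x::'a) /\<^sub>R norm x) = 1"
    by (rule AE_uniform_measureI) (use AE_lborel_neq_0 in \<open>auto elim: eventually_mono\<close>)
  then show ?thesis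
    unfolding uniform_sphere_def by (subst AE_distr_iff) auto
qed

text \<open>Supplies the total weight \<open>1\<close> when the scale \<open>t\<close> is integrated
  out in polar coordinates: a point \<open>y\<close> is of the form \<open>t *\<^sub>R x\<close>
  with \<open>x\<close> in the unit ball and \<open>t > 0\<close> exactly when \<open>t\<close> is
  at least \<open>norm y\<close>.\<close>

lemma nn_integral_power_tail:
  assumes "a > 0" "n > 0"
  shows "(\<integral>\<^sup>+t. ennreal (real n * a ^ n / t ^ (n + 1)) * indicator {a..} t \<partial>lborel) = 1"
proof -
  have D: "DERIV (\<lambda>t. - (a ^ n) / t ^ n) t :> real n * a ^ n / t ^ (n + 1)" if "a \<le> t" for t
    using that assms by (auto intro!: derivative_eq_intros simp: field_simps power_add[symmetric]
      power_Suc[symmetric] mult_2[symmetric] simp del: power_Suc)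
  have L: "((\<lambda>t. - (a ^ n) / t ^ n) \<longlongrightarrow> 0) at_top"
    using assms by (intro tendsto_divide_0[OF tendsto_const] filterlim_at_top_imp_at_infinity
      filterlim_pow_at_top filterlim_ident) auto
  have "(\<integral>\<^sup>+t. ennreal (real n * a ^ n / t ^ (n + 1)) * indicator {a..} t \<partial>lborel)
      = ennreal (0 - (- (a ^ n) / a ^ n))"
    by (rule nn_integral_FTC_atLeast[OF _ D _ L]) (use assms in auto)
  also have "\<dots> = 1"
    using assms by simp
  finally show ?thesis .
qed

text \<open>Averaging over the directions \<open>x /\<^sub>R norm x\<close>, \<open>x\<close> in the unit ball, and substituting
  \<open>r = t * norm x\<close> reduces polar coordinates to Fubini and scaling in \<open>x\<close>.\<close>

lemma nn_integral_polar:
  fixes f :: "'a::euclidean_space \<Rightarrow> ennreal"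
  assumes [measurable]: "f \<in> borel_measurable borel"
  shows "(\<integral>\<^sup>+x. f x \<partial>lborel) = (\<integral>\<^sup>+e. (\<integral>\<^sup>+r. f (r *\<^sub>R e)
      * (ennreal (real DIM('a) * unit_ball_vol (real DIM('a)) * r ^ (DIM('a) - 1)) * indicator {0<..} r) \<partial>lborel) \<partial>uniform_sphere)"
    (is "_ = ?R")
proof -
  define n where "n = DIM('a)"
  define V where "V = unit_ball_vol (real DIM('a))"
  have n: "n > 0" and V: "V > 0"
    by (auto simp: n_def V_def unit_ball_vol_pos)
  have n1: "a * a ^ (n - 1) = a ^ n" for a :: real
    using n by (metis Suc_diff_1 power_Suc)
  \<comment> \<open>The common double integrand. Integrated over \<open>t\<close> it gives the
    radial integral in the direction of \<open>x\<close> (claim 1). Integrated over \<open>x\<close>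
    at fixed \<open>t\<close>, with \<open>y = t *\<^sub>R x\<close> substituted, it gives claim 2,
    and integrating that over \<open>t\<close> leaves \<open>f y\<close> times the volume of the
    ball (claim 3).\<close>
  define g :: "'a \<Rightarrow> real \<Rightarrow> ennreal" where
    "g x t = f (t *\<^sub>R x) * (ennreal (real n * V * norm x ^ n * t ^ (n - 1)) * indicator {0<..} t
       * indicator {..1} (norm x))" for x t
  have g[measurable]: "(\<lambda>(x, t). g x t) \<in> borel_measurable (lborel \<Otimes>\<^sub>M lborel)"
    unfolding g_def by measurable
  have g'[measurable]: "(\<lambda>(t, x). g x t) \<in> borel_measurable (lborel \<Otimes>\<^sub>M lborel)"
    unfolding g_def by measurable
  have 1: "(\<integral>\<^sup>+r. f (r *\<^sub>R (x /\<^sub>R norm x)) * (ennreal (real n * V * r ^ (n - 1)) * indicator {0<..} r) \<partial>lborel)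
      * indicator (cball 0 1) x = (\<integral>\<^sup>+t. g x t \<partial>lborel)" if "x \<noteq> 0" for x
  proof -
    have "(\<integral>\<^sup>+r. f (r *\<^sub>R (x /\<^sub>R norm x)) * (ennreal (real n * V * r ^ (n - 1)) * indicator {0<..} r) \<partial>lborel)
        = ennreal (norm x) * (\<integral>\<^sup>+t. f ((norm x * t) *\<^sub>R (x /\<^sub>R norm x))
            * (ennreal (real n * V * (norm x * t) ^ (n - 1)) * indicator {0<..} (norm x * t)) \<partial>lborel)"
      using nn_integral_real_affine[of "\<lambda>r. f (r *\<^sub>R (x /\<^sub>R norm x)) * (ennreal (real n * V * r ^ (n - 1)) * indicator {0<..} r)"
        "norm x" 0] that by simp
    also have "\<dots> = (\<integral>\<^sup>+t. ennreal (norm x) * (f ((norm x * t) *\<^sub>R (x /\<^sub>R norm x))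
            * (ennreal (real n * V * (norm x * t) ^ (n - 1)) * indicator {0<..} (norm x * t))) \<partial>lborel)"
      by (rule nn_integral_cmult[symmetric]) measurable
    also have "\<dots> = (\<integral>\<^sup>+t. f (t *\<^sub>R x) * (ennreal (real n * V * norm x ^ n * t ^ (n - 1)) * indicator {0<..} t) \<partial>lborel)"
    proof (rule nn_integral_cong)
      fix t :: real
      have "ennreal (norm x) * ennreal (real n * V * (norm x * t) ^ (n - 1))
          = ennreal (real n * V * norm x ^ n * t ^ (n - 1))" if "t > 0"
        using that V by (subst ennreal_mult[symmetric]) (auto simp: n1[symmetric] power_mult_distrib mult_ac)
      moreover have "(norm x * t) *\<^sub>R (x /\<^sub>R norm x) = t *\<^sub>R x"
        using \<open>x \<noteq> 0\<close> by simp
      ultimately show "ennreal (norm x) * (f ((norm x * t) *\<^sub>R (x /\<^sub>R norm x))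
            * (ennreal (real n * V * (norm x * t) ^ (n - 1)) * indicator {0<..} (norm x * t)))
          = f (t *\<^sub>R x) * (ennreal (real n * V * norm x ^ n * t ^ (n - 1)) * indicator {0<..} t)"
        using \<open>x \<noteq> 0\<close> by (cases "t > 0") (simp_all add: zero_less_mult_iff mult.left_commute[of "ennreal (norm x)"]
          del: scaleR_scaleR)
    qed
    finally show ?thesis
      unfolding g_def by (cases "norm x \<le> 1") (simp_all add: mult.assoc)
  qed
  have 2: "(\<integral>\<^sup>+x. g x t \<partial>lborel)
      = (\<integral>\<^sup>+y. f y * (ennreal V * (ennreal (real n * norm y ^ n / t ^ (n + 1)) * indicator {norm y..} t)) \<partial>lborel)"
    if t: "t > 0" for t
  proof -
    let ?h = "\<lambda>y. f y * (ennreal V * (ennreal (real n * norm y ^ n / t ^ (n + 1)) * indicator {norm y..} t))"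
    have "?h = (\<lambda>y. f y * (ennreal V * (ennreal (real n * norm y ^ n / t ^ (n + 1)) * indicator {..t} (norm y))))"
      by (auto simp: indicator_def fun_eq_iff)
    moreover have "\<dots> \<in> borel_measurable borel"
      by measurable
    ultimately have h [measurable]: "?h \<in> borel_measurable borel"
      by (simp only:)
    have "(\<integral>\<^sup>+y. ?h y \<partial>lborel) = ennreal (\<bar>t\<bar> ^ n) * (\<integral>\<^sup>+x. ?h (0 + t *\<^sub>R x) \<partial>lborel)"
      using t unfolding n_def by (intro nn_integral_lborel_affine h[unfolded n_def]) auto
    also have "\<dots> = (\<integral>\<^sup>+x. ennreal (\<bar>t\<bar> ^ n) * ?h (0 + t *\<^sub>R x) \<partial>lborel)"
      by (rule nn_integral_cmult[symmetric]) measurable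
    also have "\<dots> = (\<integral>\<^sup>+x. g x t \<partial>lborel)"
    proof (rule nn_integral_cong)
      fix x :: 'a
      have "t ^ n * (V * (real n * (t * norm x) ^ n / t ^ (n + 1))) = real n * V * norm x ^ n * t ^ (n - 1)"
        using t n1[of t] by (simp add: field_simps power_mult_distrib)
      then have E: "ennreal (\<bar>t\<bar> ^ n) * (ennreal V * ennreal (real n * (t * norm x) ^ n / t ^ (n + 1)))
          = ennreal (real n * V * norm x ^ n * t ^ (n - 1))"
        using t V by (simp add: ennreal_mult[symmetric])
      have "ennreal (\<bar>t\<bar> ^ n) * ?h (0 + t *\<^sub>R x)
          = f (t *\<^sub>R x) * (ennreal (\<bar>t\<bar> ^ n) * (ennreal V * ennreal (real n * (t * norm x) ^ n / t ^ (n + 1))))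
            * indicator {..1} (norm x)"
        using t by (auto simp: indicator_def mult_ac)
      also have "\<dots> = g x t"
        unfolding E using t by (auto simp: g_def mult_ac)
      finally show "ennreal (\<bar>t\<bar> ^ n) * ?h (0 + t *\<^sub>R x) = g x t" .
    qed
    finally show ?thesis
      by simp
  qed
  have 3: "(\<integral>\<^sup>+t. f y * (ennreal V * (ennreal (real n * norm y ^ n / t ^ (n + 1)) * indicator {norm y..} t)) \<partial>lborel)
      = f y * ennreal V" if "y \<noteq> 0" for y
    using that nn_integral_power_tail[of "norm y" n] n
    by (simp add: nn_integral_cmult)
  have "?R = (\<integral>\<^sup>+x. (\<integral>\<^sup>+r. f (r *\<^sub>R (x /\<^sub>R norm x)) * (ennreal (real n * V * r ^ (n - 1)) * indicator {0<..} r) \<partial>lborel)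
      * indicator (cball 0 1) x \<partial>lborel) / ennreal V"
    unfolding V_def n_def by (rule nn_integral_uniform_sphere) measurable
  also have "(\<integral>\<^sup>+x. (\<integral>\<^sup>+r. f (r *\<^sub>R (x /\<^sub>R norm x)) * (ennreal (real n * V * r ^ (n - 1)) * indicator {0<..} r) \<partial>lborel)
      * indicator (cball 0 1) x \<partial>lborel) = (\<integral>\<^sup>+x. (\<integral>\<^sup>+t. g x t \<partial>lborel) \<partial>lborel)"
    by (rule nn_integral_cong_AE) (use AE_lborel_neq_0 1 in \<open>auto elim!: eventually_mono\<close>)
  also have "\<dots> = (\<integral>\<^sup>+t. (\<integral>\<^sup>+x. g x t \<partial>lborel) \<partial>lborel)"
    by (rule lborel_pair.Fubini'[symmetric]) measurable
  also have "\<dots> = (\<integral>\<^sup>+t. (\<integral>\<^sup>+y. f y * (ennreal V * (ennreal (real n * norm y ^ n / t ^ (n + 1)) * indicator {norm y..} t)) \<partial>lborel) \<partial>lborel)"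
  proof (rule nn_integral_cong_AE, use AE_lborel_neq_0 in eventually_elim)
    fix t :: real assume "t \<noteq> 0"
    show "(\<integral>\<^sup>+x. g x t \<partial>lborel) = (\<integral>\<^sup>+y. f y * (ennreal V * (ennreal (real n * norm y ^ n / t ^ (n + 1)) * indicator {norm y..} t)) \<partial>lborel)"
    proof (cases "t > 0")
      case False
      with \<open>t \<noteq> 0\<close> have "t < 0" by simp
      then have "indicator {norm y..} t = (0::ennreal)" for y :: 'a
        by (auto simp: indicator_def) (smt (verit) norm_ge_zero)
      with False show ?thesis by (simp add: g_def)
    qed (rule 2)
  qed
  also have "\<dots> = (\<integral>\<^sup>+y. (\<integral>\<^sup>+t. f y * (ennreal V * (ennreal (real n * norm y ^ n / t ^ (n + 1)) * indicator {norm y..} t)) \<partial>lborel) \<partial>lborel)"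
    by (rule lborel_pair.Fubini') (measurable, simp, measurable)
  also have "\<dots> = (\<integral>\<^sup>+y. f y * ennreal V \<partial>lborel)"
    by (rule nn_integral_cong_AE) (use AE_lborel_neq_0 3 in \<open>auto elim!: eventually_mono\<close>)
  also have "\<dots> = (\<integral>\<^sup>+y. f y \<partial>lborel) * ennreal V"
    by (rule nn_integral_multc) measurable
  finally show ?thesis
    using V by (simp add: ennreal_mult_divide_eq)
qed

text \<open>The factor in front of the power of \<open>r\<close> is the surface area of the unit
  sphere. The \<open>itself\<close> argument carries the dimension, since the measure lives on the
  real line.\<close>

definition radial_measure :: "'a::euclidean_space itself \<Rightarrow> real measure" where
  "radial_measure _ = density lborel
     (\<lambda>r. ennreal (real DIM('a) * unit_ball_vol (real DIM('a)) * r ^ (DIM('a) - 1)) * indicator {0<..} r)"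

lemma space_radial_measure [simp]: "space (radial_measure T) = UNIV"
  and sets_radial_measure [simp, measurable_cong]: "sets (radial_measure T) = sets borel"
  by (simp_all add: radial_measure_def)

lemma sigma_finite_radial_measure: "sigma_finite_measure (radial_measure TYPE('a::euclidean_space))"
  unfolding radial_measure_def
  by (subst sigma_finite_measure.sigma_finite_iff_density_finite[OF sigma_finite_lborel]) (auto simp: indicator_def ennreal_mult_eq_top_iff)

text \<open>The formula for nonnegative integrands does not cover signed ones; an identity of
  measures transfers Bochner integrals as well.\<close>

lemma lborel_polar:
  "(lborel :: 'a::euclidean_space measure)
     = distr (uniform_sphere \<Otimes>\<^sub>M radial_measure TYPE('a)) borel (\<lambda>(e, r). r *\<^sub>R e)"
proof (rule measure_eqI)
  interpret R: sigma_finite_measure "radial_measure TYPE('a)"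
    by (rule sigma_finite_radial_measure)
  interpret P: pair_sigma_finite "uniform_sphere :: 'a measure" "radial_measure TYPE('a)"
    by standard
  fix A :: "'a set" assume "A \<in> sets lborel"
  then have [measurable]: "A \<in> sets borel" by simp
  define w where "w r = ennreal (real DIM('a) * unit_ball_vol (real DIM('a)) * r ^ (DIM('a) - 1)) * indicator {0<..} r" for r
  have w [measurable]: "w \<in> borel_measurable borel"
    unfolding w_def by measurable
  have rm: "radial_measure TYPE('a) = density lborel w"
    by (simp add: radial_measure_def w_def[abs_def])
  have "emeasure (distr (uniform_sphere \<Otimes>\<^sub>M radial_measure TYPE('a)) borel (\<lambda>(e, r). r *\<^sub>R e)) A
      = (\<integral>\<^sup>+x. indicator A x \<partial>distr (uniform_sphere \<Otimes>\<^sub>M radial_measure TYPE('a)) borel (\<lambda>(e, r). r *\<^sub>R e))"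
    by simp
  also have "\<dots> = (\<integral>\<^sup>+e. (\<integral>\<^sup>+r. indicator A (r *\<^sub>R e) \<partial>radial_measure TYPE('a)) \<partial>uniform_sphere)"
    by (subst nn_integral_distr) (auto simp: R.nn_integral_fst[symmetric] case_prod_beta)
  also have "\<dots> = (\<integral>\<^sup>+e. (\<integral>\<^sup>+r. indicator A (r *\<^sub>R e) * w r \<partial>lborel) \<partial>uniform_sphere)"
    unfolding rm by (subst nn_integral_density) (auto simp: mult.commute)
  also have "\<dots> = (\<integral>\<^sup>+x. indicator A x \<partial>lborel)"
    unfolding w_def by (rule nn_integral_polar[symmetric]) simp
  finally show "emeasure lborel A = emeasure (distr (uniform_sphere \<Otimes>\<^sub>M radial_measure TYPE('a)) borel (\<lambda>(e, r). r *\<^sub>R e)) A"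
    by simp
qed simp

subsection \<open>The standard Gaussian measure\<close>

lemma
  fixes g :: "'a::euclidean_space \<Rightarrow> real \<Rightarrow> real"
  assumes "\<And>b. b \<in> Basis \<Longrightarrow> integrable lborel (g b)"
  shows integrable_lborel_prod: "integrable lborel (\<lambda>x::'a. \<Prod>b\<in>Basis. g b (x \<bullet> b))"
    and integral_lborel_prod: "(\<integral>x. (\<Prod>b\<in>Basis. g b (x \<bullet> b)) \<partial>lborel) = (\<Prod>b\<in>Basis. (\<integral>t. g b t \<partial>lborel))"
proof -
  interpret product_sigma_finite "\<lambda>_::'a. lborel :: real measure"
    by standard
  have g [measurable]: "g b \<in> borel_measurable borel" if "b \<in> Basis" for b
    using borel_measurable_integrable[OF assms[OF that]] by simp
  have eq: "(\<Prod>b\<in>Basis. g b ((\<Sum>c\<in>Basis. f c *\<^sub>R c) \<bullet> b)) = (\<Prod>b\<in>Basis. g b (f b))" for f :: "'a \<Rightarrow> real"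
    by (intro prod.cong) (auto simp: inner_sum_left_Basis)
  have [measurable]: "(\<lambda>x::'a. \<Prod>b\<in>Basis. g b (x \<bullet> b)) \<in> borel_measurable borel"
    by measurable
  show "integrable lborel (\<lambda>x::'a. \<Prod>b\<in>Basis. g b (x \<bullet> b))"
    by (subst lborel_eq, subst integrable_distr_eq)
       (auto simp: eq intro!: product_integrable_prod assms)
  show "(\<integral>x. (\<Prod>b\<in>Basis. g b (x \<bullet> b)) \<partial>lborel) = (\<Prod>b\<in>Basis. (\<integral>t. g b t \<partial>lborel))"
    by (subst lborel_eq, subst integral_distr)
       (auto simp: eq intro!: product_integral_prod assms)
qed

text \<open>In product form moments factor over the coordinates; the equivalent form
  \<open>gauss_density_eq\<close>, in terms of the norm, is the one that shows rotation
  invariance.\<close>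

definition gauss_density :: "'a::euclidean_space \<Rightarrow> real" where
  "gauss_density x = (\<Prod>b\<in>Basis. std_normal_density (x \<bullet> b))"

definition std_gauss :: "'a::euclidean_space measure" where
  "std_gauss = density lborel (\<lambda>x. ennreal (gauss_density x))"

lemma gauss_density_nonneg [simp]: "0 \<le> gauss_density x"
  by (simp add: gauss_density_def prod_nonneg)

lemma gauss_density_measurable [measurable]: "gauss_density \<in> borel_measurable borel"
  unfolding gauss_density_def[abs_def] by measurable

lemma gauss_density_eq:
  "gauss_density (x::'a::euclidean_space) = (1 / sqrt (2 * pi)) ^ DIM('a) * exp (- (norm x)\<^sup>2 / 2)"
proof -
  have "(norm x)\<^sup>2 = (\<Sum>b\<in>Basis. (x \<bullet> b)\<^sup>2)"
    unfolding power2_norm_eq_inner by (subst euclidean_inner) (simp add: power2_eq_square)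
  then show ?thesis
    unfolding gauss_density_def std_normal_density_def prod.distrib
    by (simp add: exp_sum[symmetric] sum_negf sum_divide_distrib)
qed

lemma space_std_gauss [simp]: "space std_gauss = UNIV"
  and sets_std_gauss [simp, measurable_cong]: "sets std_gauss = sets borel"
  by (simp_all add: std_gauss_def)

lemma nn_integral_std_gauss:
  "f \<in> borel_measurable borel \<Longrightarrow> (\<integral>\<^sup>+x. f x \<partial>std_gauss) = (\<integral>\<^sup>+x. f x * ennreal (gauss_density x) \<partial>lborel)"
  by (simp add: std_gauss_def nn_integral_density mult.commute)

lemma
  fixes g :: "'a::euclidean_space \<Rightarrow> real \<Rightarrow> real"
  assumes g: "\<And>b. b \<in> Basis \<Longrightarrow> integrable lborel (\<lambda>t. std_normal_density t * g b t)"
    and [measurable]: "\<And>b. b \<in> Basis \<Longrightarrow> g b \<in> borel_measurable borel"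
  shows integrable_std_gauss_prod: "integrable std_gauss (\<lambda>x::'a. \<Prod>b\<in>Basis. g b (x \<bullet> b))"
    and integral_std_gauss_prod:
      "(\<integral>x. (\<Prod>b\<in>Basis. g b (x \<bullet> b)) \<partial>std_gauss) = (\<Prod>b\<in>Basis. (\<integral>t. std_normal_density t * g b t \<partial>lborel))"
proof -
  have [measurable]: "(\<lambda>x::'a. \<Prod>b\<in>Basis. g b (x \<bullet> b)) \<in> borel_measurable borel"
    by measurable
  have eq: "gauss_density x * (\<Prod>b\<in>Basis. g b (x \<bullet> b))
      = (\<Prod>b\<in>Basis. std_normal_density (x \<bullet> b) * g b (x \<bullet> b))" for x :: 'a
    by (simp only: gauss_density_def prod.distrib)
  show "integrable std_gauss (\<lambda>x::'a. \<Prod>b\<in>Basis. g b (x \<bullet> b))"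
    unfolding std_gauss_def using integrable_lborel_prod[OF g]
    by (subst integrable_density) (auto simp: eq)
  show "(\<integral>x. (\<Prod>b\<in>Basis. g b (x \<bullet> b)) \<partial>std_gauss) = (\<Prod>b\<in>Basis. (\<integral>t. std_normal_density t * g b t \<partial>lborel))"
    unfolding std_gauss_def using integral_lborel_prod[OF g]
    by (subst integral_density) (auto simp: eq)
qed

lemma prob_space_std_gauss: "prob_space (std_gauss :: 'a::euclidean_space measure)"
proof
  have int: "integrable lborel std_normal_density"
    using integrable_std_normal_moment[of 0] by simp
  have [simp]: "(\<integral>t. std_normal_density t \<partial>lborel) = 1"
    using integral_std_normal_moment_even[of 0] by simp
  have "emeasure (std_gauss :: 'a measure) (space std_gauss) = (\<integral>\<^sup>+x. ennreal 1 \<partial>(std_gauss :: 'a measure))"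
    by (simp del: space_std_gauss)
  also have "\<dots> = ennreal (\<integral>x. 1 \<partial>(std_gauss :: 'a measure))"
    using integrable_std_gauss_prod[where 'a='a, of "\<lambda>_ _. 1"] int
    by (intro nn_integral_eq_integral) auto
  also have "\<dots> = 1"
    using integral_std_gauss_prod[where 'a='a, of "\<lambda>_ _. 1"] int by simp
  finally show "emeasure (std_gauss :: 'a measure) (space std_gauss) = 1" .
qed

interpretation std_gauss: prob_space std_gauss
  by (rule prob_space_std_gauss)

interpretation std_gauss_pair: pair_prob_space std_gauss std_gauss
  by standard

text \<open>The value is the double factorial of \<open>2 * m - 1\<close>. All coordinates other
  than \<open>b\<close> contribute the factor \<open>1\<close>.\<close>

lemma std_gauss_moment:
  fixes b :: "'a::euclidean_space"
  assumes b: "b \<in> Basis"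
  shows "has_bochner_integral std_gauss (\<lambda>x. (x \<bullet> b) ^ (2 * m)) (fact (2 * m) / (2 ^ m * fact m))"
proof -
  let ?g = "\<lambda>c t. if c = b then t ^ (2 * m) else (1::real)"
  have eq: "(\<Prod>c\<in>Basis. ?g c (x \<bullet> c)) = (x \<bullet> b) ^ (2 * m)" for x :: 'a
    using b by (subst prod.If_cases) (auto simp: Int_def conj_commute cong: conj_cong)
  have i: "integrable lborel (\<lambda>t. std_normal_density t * ?g c t)" for c
    using integrable_std_normal_moment[of "2 * m"] integrable_std_normal_moment[of 0] by (cases "c = b") simp_all
  have m: "?g c \<in> borel_measurable borel" for c
    by (cases "c = b") auto
  have "(\<Prod>c\<in>Basis. (\<integral>t. std_normal_density t * ?g c t \<partial>lborel))
      = (\<Prod>c\<in>Basis. if c = b then fact (2 * m) / (2 ^ m * fact m) else 1)"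
    using integral_std_normal_moment_even[of m] integral_std_normal_moment_even[of 0]
    by (intro prod.cong) auto
  also have "\<dots> = fact (2 * m) / (2 ^ m * fact m)"
    using b by (subst prod.If_cases) (auto simp: Int_def conj_commute cong: conj_cong)
  finally show ?thesis
    using integrable_std_gauss_prod[of ?g, OF i m] integral_std_gauss_prod[of ?g, OF i m]
    by (simp add: has_bochner_integral_iff eq)
qed

lemma std_gauss_covariance:
  fixes b c :: "'a::euclidean_space"
  assumes b: "b \<in> Basis" and c: "c \<in> Basis"
  shows "has_bochner_integral std_gauss (\<lambda>x. (x \<bullet> b) * (x \<bullet> c)) (if b = c then 1 else 0)"
proof (cases "b = c")
  case True
  then show ?thesis
    using std_gauss_moment[OF b, of 1] by (simp add: power2_eq_square)
next
  case False
  let ?g = "\<lambda>k t. (if k = b then t else 1) * (if k = c then t else (1::real))"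
  have eq: "(\<Prod>k\<in>Basis. ?g k (x \<bullet> k)) = (x \<bullet> b) * (x \<bullet> c)" for x :: 'a
    unfolding prod.distrib using b c
    by (subst (1 2) prod.If_cases) (auto simp: Int_def conj_commute cong: conj_cong)
  have i: "integrable lborel (\<lambda>t. std_normal_density t * ?g k t)" for k
    using False integrable_std_normal_moment[of 1] integrable_std_normal_moment[of 0]
    by (cases "k = b"; cases "k = c") simp_all
  have m: "?g k \<in> borel_measurable borel" for k
    by measurable
  have "(\<Prod>k\<in>Basis. (\<integral>t. std_normal_density t * ?g k t \<partial>lborel)) = 0"
    using b False integral_std_normal_moment_odd[of 0] by (intro prod_zero bexI[of _ b]) auto
  then show ?thesis
    using integrable_std_gauss_prod[of ?g, OF i m] integral_std_gauss_prod[of ?g, OF i m] False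
    by (simp add: has_bochner_integral_iff eq)
qed

lemma std_gauss_linear_second_moment:
  fixes a :: "'a::euclidean_space"
  shows "has_bochner_integral std_gauss (\<lambda>x. (a \<bullet> x)\<^sup>2) ((norm a)\<^sup>2)"
proof -
  have "(a \<bullet> x)\<^sup>2 = (\<Sum>b\<in>Basis. \<Sum>c\<in>Basis. ((a \<bullet> b) * (a \<bullet> c)) * ((x \<bullet> b) * (x \<bullet> c)))" for x
    by (simp add: euclidean_inner[of a x] power2_eq_square sum_product mult_ac)
  moreover have "has_bochner_integral std_gauss
      (\<lambda>x. \<Sum>b\<in>Basis. \<Sum>c\<in>Basis. ((a \<bullet> b) * (a \<bullet> c)) * ((x \<bullet> b) * (x \<bullet> c)))
      (\<Sum>b\<in>Basis. \<Sum>c\<in>Basis. ((a \<bullet> b) * (a \<bullet> c)) * (if b = c then 1 else 0))"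
    by (intro has_bochner_integral_sum has_bochner_integral_mult_right std_gauss_covariance)
  moreover have "(\<Sum>b\<in>Basis. \<Sum>c\<in>Basis. ((a \<bullet> b) * (a \<bullet> c)) * (if b = c then 1 else 0)) = (norm a)\<^sup>2"
    by (simp add: power2_norm_eq_inner euclidean_inner[of a a] if_distrib[of "(*) _"] sum.delta cong: if_cong)
  ultimately show ?thesis
    by simp
qed

lemma std_gauss_norm_second_moment:
  "has_bochner_integral std_gauss (\<lambda>x::'a::euclidean_space. (norm x)\<^sup>2) (real DIM('a))"
proof -
  have "(norm x)\<^sup>2 = (\<Sum>b\<in>Basis. (x \<bullet> b) * (x \<bullet> b))" for x :: 'a
    by (simp add: power2_norm_eq_inner euclidean_inner[of x x])
  moreover have "has_bochner_integral std_gauss (\<lambda>x::'a. \<Sum>b\<in>Basis. (x \<bullet> b) * (x \<bullet> b)) (\<Sum>b\<in>(Basis::'a set). if b = b then 1 else 0)"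
    by (intro has_bochner_integral_sum std_gauss_covariance)
  ultimately show ?thesis
    by simp
qed

text \<open>In polar coordinates a homogeneous integrand splits into a power of the radius and its
  values on the sphere. The radial factor \<open>J\<close> depends only on the degree
  \<open>k\<close>, and applying the same computation to \<open>norm x ^ k\<close> identifies it as
  a Gaussian moment. This is the bridge between the Gaussian measure and the sphere in both
  directions.\<close>

lemma nn_integral_std_gauss_homogeneous:
  fixes f :: "'a::euclidean_space \<Rightarrow> ennreal"
  assumes [measurable]: "f \<in> borel_measurable borel"
    and hom: "\<And>r x. r > 0 \<Longrightarrow> f (r *\<^sub>R x) = ennreal (r ^ k) * f x"
  shows "(\<integral>\<^sup>+x. f x \<partial>std_gauss)
    = (\<integral>\<^sup>+x. ennreal (norm (x::'a) ^ k) \<partial>std_gauss) * (\<integral>\<^sup>+e. f e \<partial>uniform_sphere)"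
proof -
  define w :: "real \<Rightarrow> ennreal" where
    "w r = ennreal (real DIM('a) * unit_ball_vol (real DIM('a)) * r ^ (DIM('a) - 1)) * indicator {0<..} r" for r
  have [measurable]: "w \<in> borel_measurable borel"
    unfolding w_def by measurable
  define \<rho> where "\<rho> r = ennreal ((1 / sqrt (2 * pi)) ^ DIM('a) * exp (- r\<^sup>2 / 2))" for r :: real
  have [measurable]: "\<rho> \<in> borel_measurable borel"
    unfolding \<rho>_def by measurable
  define J where "J = (\<integral>\<^sup>+r. ennreal (r ^ k) * \<rho> r * w r \<partial>lborel)"
  have main: "(\<integral>\<^sup>+x. h x \<partial>std_gauss) = (\<integral>\<^sup>+e. h e \<partial>uniform_sphere) * J"
    if [measurable]: "h \<in> borel_measurable borel"
      and hom: "\<And>r x. r > 0 \<Longrightarrow> h (r *\<^sub>R x) = ennreal (r ^ k) * h x" for h :: "'a \<Rightarrow> ennreal"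
  proof -
    have "(\<integral>\<^sup>+x. h x \<partial>std_gauss) = (\<integral>\<^sup>+x. h x * \<rho> (norm x) \<partial>lborel)"
      by (simp add: nn_integral_std_gauss gauss_density_eq \<rho>_def)
    also have "\<dots> = (\<integral>\<^sup>+e. (\<integral>\<^sup>+r. h (r *\<^sub>R e) * \<rho> (norm (r *\<^sub>R e)) * w r \<partial>lborel) \<partial>uniform_sphere)"
      unfolding w_def by (rule nn_integral_polar) measurable
    also have "\<dots> = (\<integral>\<^sup>+e. h e * J \<partial>uniform_sphere)"
    proof (rule nn_integral_cong_AE, use AE_uniform_sphere in eventually_elim)
      fix e :: 'a assume e: "norm e = 1"
      have "(\<integral>\<^sup>+r. h (r *\<^sub>R e) * \<rho> (norm (r *\<^sub>R e)) * w r \<partial>lborel) = (\<integral>\<^sup>+r. h e * (ennreal (r ^ k) * \<rho> r * w r) \<partial>lborel)"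
        using e by (intro nn_integral_cong) (auto simp: w_def indicator_def hom mult_ac)
      then show "(\<integral>\<^sup>+r. h (r *\<^sub>R e) * \<rho> (norm (r *\<^sub>R e)) * w r \<partial>lborel) = h e * J"
        unfolding J_def by (simp add: nn_integral_cmult)
    qed
    also have "\<dots> = (\<integral>\<^sup>+e. h e \<partial>uniform_sphere) * J"
      by (simp add: nn_integral_multc)
    finally show ?thesis .
  qed
  have "(\<integral>\<^sup>+x. ennreal (norm (x::'a) ^ k) \<partial>std_gauss) = (\<integral>\<^sup>+e. ennreal (norm (e::'a) ^ k) \<partial>uniform_sphere) * J"
    by (rule main) (auto simp: power_mult_distrib ennreal_mult)
  also have "(\<integral>\<^sup>+e. ennreal (norm (e::'a) ^ k) \<partial>uniform_sphere) = (\<integral>\<^sup>+(e::'a). 1 \<partial>uniform_sphere)"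
    by (rule nn_integral_cong_AE) (use AE_uniform_sphere in \<open>auto elim!: eventually_mono\<close>)
  also have "\<dots> = 1"
    using uniform_sphere.emeasure_space_1[where 'a='a] by simp
  finally show ?thesis
    using main[OF assms] by (simp add: mult.commute)
qed

text \<open>Jensen's inequality for \<open>t ^ m\<close> and the variable
  \<open>(norm x)\<^sup>2\<close>, whose mean is the dimension: the tangent at that mean comes from
  Bernoulli's inequality. Its constant term is kept on the larger side, so that every term is
  nonnegative and \<open>ennreal\<close> arithmetic applies.\<close>

lemma std_gauss_norm_moment_ge:
  assumes "m \<ge> 1"
  shows "ennreal (real DIM('a) ^ m) \<le> (\<integral>\<^sup>+x. ennreal (norm (x::'a::euclidean_space) ^ (2 * m)) \<partial>std_gauss)"
    (is "_ \<le> ?I")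
proof -
  define n where "n = real DIM('a)"
  have n: "n > 0" by (simp add: n_def)
  have B: "real m * n ^ (m - 1) * t \<le> t ^ m + (real m - 1) * n ^ m" if "t \<ge> 0" for t
  proof -
    have "1 + real m * (t / n - 1) \<le> (1 + (t / n - 1)) ^ m"
      using that n by (intro Bernoulli_inequality) (auto simp: field_simps)
    then have "n ^ m * (1 + real m * (t / n - 1)) \<le> n ^ m * (t / n) ^ m"
      using n by (intro mult_left_mono) auto
    moreover have "n ^ m = n * n ^ (m - 1)"
      using assms by (cases m) auto
    ultimately show ?thesis
      using n by (simp add: power_divide algebra_simps)
  qed
  have nm: "n ^ (m - 1) * n = n ^ m"
    using assms by (cases m) auto
  have "ennreal (n ^ m) + ennreal ((real m - 1) * n ^ m) = ennreal (n ^ m + (real m - 1) * n ^ m)"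
    using n assms by (intro ennreal_plus[symmetric]) auto
  also have "n ^ m + (real m - 1) * n ^ m = real m * n ^ (m - 1) * n"
    by (simp add: algebra_simps nm[symmetric])
  finally have "ennreal (n ^ m) + ennreal ((real m - 1) * n ^ m) = ennreal (real m * n ^ (m - 1) * n)" .
  also have "\<dots> = ennreal (real m * n ^ (m - 1)) * (\<integral>\<^sup>+x. ennreal ((norm (x::'a))\<^sup>2) \<partial>std_gauss)"
    using std_gauss_norm_second_moment[where 'a='a] n unfolding n_def[symmetric]
    by (subst nn_integral_eq_integral) (auto simp: has_bochner_integral_iff ennreal_mult)
  also have "\<dots> = (\<integral>\<^sup>+x. ennreal (real m * n ^ (m - 1) * (norm (x::'a))\<^sup>2) \<partial>std_gauss)"
    using n by (subst nn_integral_cmult[symmetric]) (simp_all add: ennreal_mult[symmetric])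
  also have "\<dots> \<le> (\<integral>\<^sup>+x. ennreal (norm (x::'a) ^ (2 * m)) + ennreal ((real m - 1) * n ^ m) \<partial>std_gauss)"
  proof (rule nn_integral_mono)
    fix x :: 'a
    have "ennreal (real m * n ^ (m - 1) * (norm x)\<^sup>2) \<le> ennreal (norm x ^ (2 * m) + (real m - 1) * n ^ m)"
      using B[of "(norm x)\<^sup>2"] by (intro ennreal_leI) (simp add: power_mult)
    also have "\<dots> = ennreal (norm x ^ (2 * m)) + ennreal ((real m - 1) * n ^ m)"
      using n assms by (intro ennreal_plus) auto
    finally show "ennreal (real m * n ^ (m - 1) * (norm x)\<^sup>2) \<le> ennreal (norm x ^ (2 * m)) + ennreal ((real m - 1) * n ^ m)" .
  qed
  also have "\<dots> = ?I + ennreal ((real m - 1) * n ^ m)"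
    using std_gauss.emeasure_space_1[where 'a='a] by (subst nn_integral_add) auto
  finally show ?thesis
    unfolding n_def by (simp add: ennreal_add_left_cancel_le add.commute[of _ "ennreal ((_ - 1) * _)"])
qed

text \<open>By homogeneity the sphere moment is the Gaussian moment of one coordinate divided by
  that of the norm. The former is a product of \<open>m\<close> odd numbers, each at most
  \<open>2 * m - 1\<close>; the latter is at least the \<open>m\<close>-th power of the
  dimension.\<close>

lemma uniform_sphere_moment_le:
  fixes b :: "'a::euclidean_space"
  assumes b: "b \<in> Basis" and m: "m \<ge> 1"
  shows "(\<integral>\<^sup>+e. ennreal ((e \<bullet> b) ^ (2 * m)) \<partial>uniform_sphere) \<le> ennreal (((2 * real m - 1) / real DIM('a)) ^ m)"
    (is "?S \<le> _")
proof -
  have fact_le: "fact (2 * k) / (2 ^ k * fact k) \<le> (2 * real m - 1) ^ k" if "k \<le> m" for k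
    using that
  proof (induction k)
    case (Suc k)
    have "fact (2 * Suc k) / (2 ^ Suc k * fact (Suc k)) = (2 * real k + 1) * (fact (2 * k) / (2 ^ k * fact k))"
    proof -
      have "fact (2 * Suc k) = (2 * (real k + 1)) * ((2 * real k + 1) * fact (2 * k))"
        by (simp add: algebra_simps)
      moreover have "2 ^ Suc k * fact (Suc k) = (2 * (real k + 1)) * (2 ^ k * fact k)"
        by (simp add: algebra_simps)
      ultimately show ?thesis
        by (simp only: mult_divide_mult_cancel_left_if) simp
    qed
    also have "\<dots> \<le> (2 * real m - 1) * (2 * real m - 1) ^ k"
      using Suc by (intro mult_mono) auto
    finally show ?case by simp
  qed auto
  have "ennreal (real DIM('a) ^ m) * ?S \<le> (\<integral>\<^sup>+x. ennreal (norm (x::'a) ^ (2 * m)) \<partial>std_gauss) * ?S"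
    by (intro mult_right_mono std_gauss_norm_moment_ge m) auto
  also have "\<dots> = (\<integral>\<^sup>+x. ennreal ((x \<bullet> b) ^ (2 * m)) \<partial>std_gauss)"
    by (rule nn_integral_std_gauss_homogeneous[symmetric]) (auto simp: power_mult_distrib ennreal_mult)
  also have "\<dots> = ennreal (fact (2 * m) / (2 ^ m * fact m))"
    using std_gauss_moment[OF b, of m]
    by (subst nn_integral_eq_integral) (auto simp: has_bochner_integral_iff)
  also have "\<dots> \<le> ennreal (real DIM('a) ^ m * ((2 * real m - 1) / real DIM('a)) ^ m)"
    using fact_le[of m] by (intro ennreal_leI) (simp add: power_divide)
  also have "\<dots> = ennreal (real DIM('a) ^ m) * ennreal (((2 * real m - 1) / real DIM('a)) ^ m)"
    using m by (subst ennreal_mult) auto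
  finally show ?thesis
    by (subst (asm) ennreal_mult_le_mult_iff) auto
qed

subsection \<open>Rotations and a Poincare inequality for odd functions\<close>

text \<open>A composition of two affine substitutions. For fixed \<open>y\<close> put
  \<open>u = c *\<^sub>R x + s *\<^sub>R y\<close>; then \<open>c\<^sup>2 + s\<^sup>2 = 1\<close>
  turns the second argument into \<open>(1 / c) *\<^sub>R y - (s / c) *\<^sub>R u\<close>, which is
  affine in \<open>y\<close> for fixed \<open>u\<close>. The two Jacobians are inverse to each
  other; dividing by \<open>c\<close> is why \<open>c\<close> must not vanish.\<close>

lemma nn_integral_lborel_rotation:
  fixes k :: "'a::euclidean_space \<times> 'a \<Rightarrow> ennreal"
  assumes k [measurable]: "k \<in> borel_measurable (borel \<Otimes>\<^sub>M borel)"
    and c: "c > 0" and cs: "c\<^sup>2 + s\<^sup>2 = (1::real)"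
  shows "(\<integral>\<^sup>+x. (\<integral>\<^sup>+y. k (c *\<^sub>R x + s *\<^sub>R y, c *\<^sub>R y - s *\<^sub>R x) \<partial>lborel) \<partial>lborel)
    = (\<integral>\<^sup>+x. (\<integral>\<^sup>+y. k (x, y) \<partial>lborel) \<partial>lborel)" (is "?L = ?R")
proof -
  define A where "A = ennreal (\<bar>c\<bar> ^ DIM('a))"
  have A: "A \<noteq> 0" "A \<noteq> top"
    using c by (auto simp: A_def)
  have "A * ?L = A * (\<integral>\<^sup>+y. (\<integral>\<^sup>+x. k (c *\<^sub>R x + s *\<^sub>R y, c *\<^sub>R y - s *\<^sub>R x) \<partial>lborel) \<partial>lborel)"
    by (subst lborel_pair.Fubini') (simp_all, measurable)
  also have "\<dots> = (\<integral>\<^sup>+y. A * (\<integral>\<^sup>+x. k (c *\<^sub>R x + s *\<^sub>R y, c *\<^sub>R y - s *\<^sub>R x) \<partial>lborel) \<partial>lborel)"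
    by (rule nn_integral_cmult[symmetric]) measurable
  also have "\<dots> = (\<integral>\<^sup>+y. (\<integral>\<^sup>+u. k (u, (1 / c) *\<^sub>R y - (s / c) *\<^sub>R u) \<partial>lborel) \<partial>lborel)"
  proof (rule nn_integral_cong)
    fix y :: 'a
    have "(\<integral>\<^sup>+u. k (u, (1 / c) *\<^sub>R y - (s / c) *\<^sub>R u) \<partial>lborel)
        = A * (\<integral>\<^sup>+x. k (s *\<^sub>R y + c *\<^sub>R x, (1 / c) *\<^sub>R y - (s / c) *\<^sub>R (s *\<^sub>R y + c *\<^sub>R x)) \<partial>lborel)"
      unfolding A_def by (rule nn_integral_lborel_affine) (use c in \<open>measurable, simp\<close>)
    also have "(\<lambda>x. k (s *\<^sub>R y + c *\<^sub>R x, (1 / c) *\<^sub>R y - (s / c) *\<^sub>R (s *\<^sub>R y + c *\<^sub>R x)))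
        = (\<lambda>x. k (c *\<^sub>R x + s *\<^sub>R y, c *\<^sub>R y - s *\<^sub>R x))"
    proof
      fix x
      have "1 / c - s / c * s = c"
        using cs c by (simp add: field_simps power2_eq_square)
      then have "c *\<^sub>R y = (1 / c - s / c * s) *\<^sub>R y"
        by simp
      then have "(1 / c) *\<^sub>R y - (s / c) *\<^sub>R (s *\<^sub>R y + c *\<^sub>R x) = c *\<^sub>R y - s *\<^sub>R x"
        using c by (simp add: algebra_simps)
      then show "k (s *\<^sub>R y + c *\<^sub>R x, (1 / c) *\<^sub>R y - (s / c) *\<^sub>R (s *\<^sub>R y + c *\<^sub>R x))
          = k (c *\<^sub>R x + s *\<^sub>R y, c *\<^sub>R y - s *\<^sub>R x)"
        by (simp add: add.commute)
    qed
    finally show "A * (\<integral>\<^sup>+x. k (c *\<^sub>R x + s *\<^sub>R y, c *\<^sub>R y - s *\<^sub>R x) \<partial>lborel)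
        = (\<integral>\<^sup>+u. k (u, (1 / c) *\<^sub>R y - (s / c) *\<^sub>R u) \<partial>lborel)" by simp
  qed
  also have "\<dots> = (\<integral>\<^sup>+u. (\<integral>\<^sup>+y. k (u, (1 / c) *\<^sub>R y - (s / c) *\<^sub>R u) \<partial>lborel) \<partial>lborel)"
    by (rule lborel_pair.Fubini') measurable
  also have "\<dots> = (\<integral>\<^sup>+u. A * (\<integral>\<^sup>+v. k (u, v) \<partial>lborel) \<partial>lborel)"
  proof (rule nn_integral_cong)
    fix u :: 'a
    have "ennreal (\<bar>1 / c\<bar> ^ DIM('a)) * A = 1"
      using c unfolding A_def by (subst ennreal_mult[symmetric]) (auto simp: power_mult_distrib[symmetric])
    moreover have "(\<integral>\<^sup>+v. k (u, v) \<partial>lborel) = ennreal (\<bar>1 / c\<bar> ^ DIM('a))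
        * (\<integral>\<^sup>+y. k (u, - ((s / c) *\<^sub>R u) + (1 / c) *\<^sub>R y) \<partial>lborel)"
      by (rule nn_integral_lborel_affine) (use c in \<open>measurable, simp\<close>)
    ultimately show "(\<integral>\<^sup>+y. k (u, (1 / c) *\<^sub>R y - (s / c) *\<^sub>R u) \<partial>lborel) = A * (\<integral>\<^sup>+v. k (u, v) \<partial>lborel)"
      by (simp add: mult.assoc[symmetric] mult.commute[of A] add.commute)
  qed
  also have "\<dots> = A * ?R"
    by (rule nn_integral_cmult) measurable
  finally show ?thesis
    using A by (simp add: ennreal_mult_cancel_left)
qed

text \<open>Acts as one and the same plane rotation on every pair of coordinates
  \<open>fst p \<bullet> b\<close>, \<open>snd p \<bullet> b\<close>.\<close>

definition rot :: "real \<Rightarrow> 'a::real_vector \<times> 'a \<Rightarrow> 'a \<times> 'a" where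
  "rot a p = (cos a *\<^sub>R fst p + sin a *\<^sub>R snd p, cos a *\<^sub>R snd p - sin a *\<^sub>R fst p)"

lemma rot_measurable [measurable]:
  "rot a \<in> measurable (borel \<Otimes>\<^sub>M borel) (borel \<Otimes>\<^sub>M (borel :: 'a::euclidean_space measure))"
  unfolding rot_def[abs_def] by measurable

lemma fst_rot_rot: "fst (rot a (rot b p)) = fst (rot (a + b) p)"
  by (simp add: rot_def cos_add sin_add algebra_simps)

lemma gauss_density_rotation:
  fixes x y :: "'a::euclidean_space"
  assumes "c\<^sup>2 + s\<^sup>2 = 1"
  shows "gauss_density (c *\<^sub>R x + s *\<^sub>R y) * gauss_density (c *\<^sub>R y - s *\<^sub>R x) = gauss_density x * gauss_density y"
proof -
  have "(norm (c *\<^sub>R x + s *\<^sub>R y))\<^sup>2 + (norm (c *\<^sub>R y - s *\<^sub>R x))\<^sup>2 = (c\<^sup>2 + s\<^sup>2) * ((norm x)\<^sup>2 + (norm y)\<^sup>2)"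
    unfolding power2_norm_eq_inner
    by (simp add: algebra_simps inner_add_left inner_add_right inner_diff_left inner_diff_right inner_commute power2_eq_square)
  then have "exp (- (norm (c *\<^sub>R x + s *\<^sub>R y))\<^sup>2 / 2) * exp (- (norm (c *\<^sub>R y - s *\<^sub>R x))\<^sup>2 / 2)
      = exp (- (norm x)\<^sup>2 / 2) * exp (- (norm y)\<^sup>2 / 2)"
    using assms by (simp add: exp_add[symmetric] add_divide_distrib[symmetric] del: exp_add)
  then show ?thesis
    unfolding gauss_density_eq by (simp add: mult_ac)
qed

lemma std_gauss_rotation:
  assumes "cos a > 0"
  shows "distr (std_gauss \<Otimes>\<^sub>M std_gauss) (borel \<Otimes>\<^sub>M borel) (rot a) = (std_gauss \<Otimes>\<^sub>M std_gauss :: ('a::euclidean_space \<times> 'a) measure)"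
proof (rule measure_eqI)
  fix A assume "A \<in> sets (distr (std_gauss \<Otimes>\<^sub>M std_gauss) (borel \<Otimes>\<^sub>M borel) (rot a) :: ('a \<times> 'a) measure)"
  then have [measurable]: "A \<in> sets (borel \<Otimes>\<^sub>M borel)" by simp
  have I: "(\<integral>\<^sup>+p. f p \<partial>(std_gauss \<Otimes>\<^sub>M std_gauss))
      = (\<integral>\<^sup>+x. (\<integral>\<^sup>+y. f (x, y) * ennreal (gauss_density x * gauss_density y) \<partial>lborel) \<partial>lborel)"
    if [measurable]: "f \<in> borel_measurable (borel \<Otimes>\<^sub>M borel)" for f :: "'a \<times> 'a \<Rightarrow> ennreal"
  proof -
    have "(\<integral>\<^sup>+p. f p \<partial>(std_gauss \<Otimes>\<^sub>M std_gauss)) = (\<integral>\<^sup>+x. (\<integral>\<^sup>+y. f (x, y) \<partial>std_gauss) \<partial>std_gauss)"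
      by (rule std_gauss.nn_integral_fst[symmetric]) measurable
    also have "\<dots> = (\<integral>\<^sup>+x. (\<integral>\<^sup>+y. f (x, y) * ennreal (gauss_density y) \<partial>lborel) * ennreal (gauss_density x) \<partial>lborel)"
      by (subst nn_integral_std_gauss, measurable, intro nn_integral_cong) (subst nn_integral_std_gauss, measurable)
    also have "\<dots> = (\<integral>\<^sup>+x. (\<integral>\<^sup>+y. f (x, y) * ennreal (gauss_density x * gauss_density y) \<partial>lborel) \<partial>lborel)"
      by (intro nn_integral_cong, subst nn_integral_multc[symmetric]) (auto simp: ennreal_mult mult_ac)
    finally show ?thesis .
  qed
  have "emeasure (distr (std_gauss \<Otimes>\<^sub>M std_gauss) (borel \<Otimes>\<^sub>M borel) (rot a)) A
      = (\<integral>\<^sup>+p. indicator A (rot a p) \<partial>(std_gauss \<Otimes>\<^sub>M std_gauss))"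
  proof -
    have "emeasure (distr (std_gauss \<Otimes>\<^sub>M std_gauss) (borel \<Otimes>\<^sub>M borel) (rot a)) A
        = (\<integral>\<^sup>+p. indicator A p \<partial>distr (std_gauss \<Otimes>\<^sub>M std_gauss) (borel \<Otimes>\<^sub>M borel) (rot a))"
      by simp
    also have "\<dots> = (\<integral>\<^sup>+p. indicator A (rot a p) \<partial>(std_gauss \<Otimes>\<^sub>M std_gauss))"
      by (rule nn_integral_distr) measurable
    finally show ?thesis .
  qed
  also have "\<dots> = (\<integral>\<^sup>+x. (\<integral>\<^sup>+y. indicator A (rot a (x, y)) * ennreal (gauss_density x * gauss_density y) \<partial>lborel) \<partial>lborel)"
    by (rule I) measurable
  also have "\<dots> = (\<integral>\<^sup>+x. (\<integral>\<^sup>+y. indicator A (cos a *\<^sub>R x + sin a *\<^sub>R y, cos a *\<^sub>R y - sin a *\<^sub>R x)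
      * ennreal (gauss_density (cos a *\<^sub>R x + sin a *\<^sub>R y) * gauss_density (cos a *\<^sub>R y - sin a *\<^sub>R x)) \<partial>lborel) \<partial>lborel)"
    by (simp add: rot_def gauss_density_rotation)
  also have "\<dots> = (\<integral>\<^sup>+x. (\<integral>\<^sup>+y. indicator A (x, y) * ennreal (gauss_density x * gauss_density y) \<partial>lborel) \<partial>lborel)"
    using nn_integral_lborel_rotation[of "\<lambda>(x, y). indicator A (x, y) * ennreal (gauss_density x * gauss_density y)" "cos a" "sin a"]
      assms by (simp add: case_prod_beta)
  also have "\<dots> = (\<integral>\<^sup>+p. indicator A p \<partial>(std_gauss \<Otimes>\<^sub>M std_gauss))"
    by (rule I[symmetric]) measurable
  also have "\<dots> = emeasure (std_gauss \<Otimes>\<^sub>M std_gauss) A"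
    by (rule nn_integral_indicator) simp
  finally show "emeasure (distr (std_gauss \<Otimes>\<^sub>M std_gauss) (borel \<Otimes>\<^sub>M borel) (rot a)) A = emeasure (std_gauss \<Otimes>\<^sub>M std_gauss) A" .
qed simp

lemma distr_lborel_uminus: "distr lborel borel uminus = (lborel :: 'a::euclidean_space measure)"
  by (subst lborel_affine[of "-1" 0]) (auto simp: density_1 one_ennreal_def[symmetric])

lemma std_gauss_uminus: "distr std_gauss borel uminus = (std_gauss :: 'a::euclidean_space measure)"
proof -
  have "std_gauss = density (distr lborel borel uminus) (\<lambda>x::'a. ennreal (gauss_density x))"
    by (simp only: distr_lborel_uminus std_gauss_def)
  also have "\<dots> = distr (density lborel (\<lambda>x::'a. ennreal (gauss_density (- x)))) borel uminus"
    by (rule density_distr) simp_all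
  also have "(\<lambda>x::'a. ennreal (gauss_density (- x))) = (\<lambda>x. ennreal (gauss_density x))"
    by (simp add: gauss_density_eq)
  finally show ?thesis
    by (simp add: std_gauss_def)
qed

lemma integral_std_gauss_odd:
  fixes h :: "'a::euclidean_space \<Rightarrow> real"
  assumes [measurable]: "h \<in> borel_measurable borel" and odd: "\<And>x. h (- x) = - h x"
  shows "(\<integral>x. h x \<partial>std_gauss) = 0"
proof -
  have "(\<integral>x. h x \<partial>std_gauss) = (\<integral>x. h (- x) \<partial>std_gauss)"
    by (subst std_gauss_uminus[symmetric], subst integral_distr) auto
  then show ?thesis
    by (simp add: odd)
qed

lemma AE_std_gauss_neq_0: "AE x in std_gauss. (x::'a::euclidean_space) \<noteq> 0"
  unfolding std_gauss_def using AE_lborel_neq_0[where 'a='a] by (subst AE_density) auto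

locale square_integrable_odd =
  fixes h :: "'a::euclidean_space \<Rightarrow> real"
  assumes h_meas [measurable]: "h \<in> borel_measurable borel"
    and odd: "\<And>x. h (- x) = - h x"
    and sq: "integrable std_gauss (\<lambda>x. (h x)\<^sup>2)"
begin

abbreviation Q :: "('a \<times> 'a) measure" where "Q \<equiv> std_gauss \<Otimes>\<^sub>M std_gauss"

definition u :: "real \<Rightarrow> 'a \<times> 'a \<Rightarrow> real" where "u a p = h (fst (rot a p))"

text \<open>This is the function \<open>c\<close> of the introduction, and \<open>m2\<close> below
  is its value at \<open>0\<close>.\<close>

definition corr :: "real \<Rightarrow> real" where "corr a = (\<integral>p. u 0 p * u a p \<partial>Q)"

definition m2 :: real where "m2 = (\<integral>x. (h x)\<^sup>2 \<partial>std_gauss)"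

lemma u_measurable [measurable]: "u a \<in> borel_measurable (borel \<Otimes>\<^sub>M borel)"
  unfolding u_def[abs_def] by measurable

lemma u_0: "u 0 p = h (fst p)"
  by (simp add: u_def rot_def)

lemma u_rot: "u a (rot b p) = u (a + b) p"
  by (simp add: u_def fst_rot_rot)

lemma bochner_rot:
  fixes f :: "'a \<times> 'a \<Rightarrow> real"
  assumes "cos a > 0" "has_bochner_integral Q f I" and [measurable]: "f \<in> borel_measurable (borel \<Otimes>\<^sub>M borel)"
  shows "has_bochner_integral Q (\<lambda>p. f (rot a p)) I"
  using assms(2) std_gauss_rotation[OF assms(1), where 'a='a]
    integrable_distr_eq[of "rot a" Q "borel \<Otimes>\<^sub>M borel" f]
    integral_distr[of "rot a" Q "borel \<Otimes>\<^sub>M borel" f]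
  by (simp add: has_bochner_integral_iff)

lemma u_sq_0: "has_bochner_integral Q (\<lambda>p. (u 0 p)\<^sup>2) m2"
proof -
  have d: "distr Q std_gauss fst = (std_gauss :: 'a measure)"
    by (rule std_gauss.distr_pair_fst)
  have [measurable]: "(\<lambda>x. (h x)\<^sup>2) \<in> borel_measurable std_gauss"
    by measurable
  show ?thesis
    using sq integrable_distr_eq[of fst Q std_gauss "\<lambda>x. (h x)\<^sup>2"] integral_distr[of fst Q std_gauss "\<lambda>x. (h x)\<^sup>2"]
    unfolding m2_def d by (simp add: has_bochner_integral_iff u_0)
qed

lemma u_sq: "cos a > 0 \<Longrightarrow> has_bochner_integral Q (\<lambda>p. (u a p)\<^sup>2) m2"
  using bochner_rot[of a, OF _ u_sq_0] by (simp add: u_rot)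

lemma u_prod_integrable:
  assumes "integrable Q (\<lambda>p. (u a p)\<^sup>2)" "integrable Q (\<lambda>p. (u b p)\<^sup>2)"
  shows "integrable Q (\<lambda>p. u a p * u b p)"
proof (rule Bochner_Integration.integrable_bound)
  show "integrable Q (\<lambda>p. (u a p)\<^sup>2 + (u b p)\<^sup>2)"
    using assms by simp
  show "AE p in Q. norm (u a p * u b p) \<le> norm ((u a p)\<^sup>2 + (u b p)\<^sup>2)"
  proof (rule AE_I2)
    fix p
    have "2 * (\<bar>u a p\<bar> * \<bar>u b p\<bar>) \<le> (u a p)\<^sup>2 + (u b p)\<^sup>2"
      using sum_squares_bound[of "\<bar>u a p\<bar>" "\<bar>u b p\<bar>"] by simp
    moreover have "0 \<le> \<bar>u a p\<bar> * \<bar>u b p\<bar>"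
      by simp
    ultimately have "\<bar>u a p\<bar> * \<bar>u b p\<bar> \<le> (u a p)\<^sup>2 + (u b p)\<^sup>2"
      by linarith
    then show "norm (u a p * u b p) \<le> norm ((u a p)\<^sup>2 + (u b p)\<^sup>2)"
      by (simp add: abs_mult)
  qed
qed measurable

lemma corr_half_angle:
  assumes a: "cos a > 0" and IH: "corr (2 * a) \<le> cos (2 * a) * m2"
  shows "corr a \<le> cos a * m2"
proof -
  let ?l = "cos a"
  have i0: "has_bochner_integral Q (\<lambda>p. (u 0 p)\<^sup>2) m2" by (rule u_sq_0)
  have i1: "has_bochner_integral Q (\<lambda>p. (u a p)\<^sup>2) m2" by (rule u_sq[OF a])
  \<comment> \<open>The rotation by \<open>a\<close> is applied twice, because
    \<open>cos (2 * a)\<close> is not known to be positive; in the first use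
    \<open>a = pi / 4\<close> and it is \<open>0\<close>.\<close>
  have i2: "has_bochner_integral Q (\<lambda>p. (u (2 * a) p)\<^sup>2) m2"
    using bochner_rot[OF a i1] by (simp add: u_rot)
  have c01: "has_bochner_integral Q (\<lambda>p. u 0 p * u a p) (corr a)"
    using u_prod_integrable[of 0 a] i0 i1 by (auto simp: has_bochner_integral_iff corr_def)
  \<comment> \<open>Stationarity: the pair \<open>u a\<close>, \<open>u (2 * a)\<close> is the pair
    \<open>u 0\<close>, \<open>u a\<close> seen after a measure-preserving rotation.\<close>
  have c12: "has_bochner_integral Q (\<lambda>p. u a p * u (2 * a) p) (corr a)"
    using bochner_rot[OF a c01] by (simp add: u_rot)
  have c02: "has_bochner_integral Q (\<lambda>p. u 0 p * u (2 * a) p) (corr (2 * a))"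
    using u_prod_integrable[of 0 "2 * a"] i0 i2 by (auto simp: has_bochner_integral_iff corr_def)
  have "has_bochner_integral Q (\<lambda>p. (u 0 p)\<^sup>2 + (u (2 * a) p)\<^sup>2 + 4 * ?l\<^sup>2 * (u a p)\<^sup>2
      + 2 * (u 0 p * u (2 * a) p) - 4 * ?l * (u 0 p * u a p) - 4 * ?l * (u a p * u (2 * a) p))
      (m2 + m2 + 4 * ?l\<^sup>2 * m2 + 2 * corr (2 * a) - 4 * ?l * corr a - 4 * ?l * corr a)" (is "has_bochner_integral Q ?f ?I")
    by (intro has_bochner_integral_add has_bochner_integral_diff has_bochner_integral_mult_right i0 i1 i2 c01 c12 c02)
  moreover have "?f p = (u 0 p + u (2 * a) p - 2 * ?l * u a p)\<^sup>2" for p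
    by (simp add: power2_eq_square algebra_simps)
  ultimately have "has_bochner_integral Q (\<lambda>p. (u 0 p + u (2 * a) p - 2 * ?l * u a p)\<^sup>2) ?I"
    by simp
  then have "?I = (\<integral>p. (u 0 p + u (2 * a) p - 2 * ?l * u a p)\<^sup>2 \<partial>Q)"
    by (simp add: has_bochner_integral_iff)
  also have "\<dots> \<ge> 0"
    by simp
  finally have "0 \<le> ?I" .
  moreover have "cos (2 * a) = 2 * ?l\<^sup>2 - 1"
    by (simp add: cos_double_cos)
  ultimately have "0 \<le> m2 + m2 + 4 * ?l\<^sup>2 * m2 + 2 * ((2 * ?l\<^sup>2 - 1) * m2) - 4 * ?l * corr a - 4 * ?l * corr a"
    using IH by (simp only:)
  also have "\<dots> = 8 * ?l * (?l * m2 - corr a)"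
    by (simp add: algebra_simps power2_eq_square)
  finally have "0 \<le> 8 * ?l * (?l * m2 - corr a)" .
  then show ?thesis
    using a by (simp add: zero_le_mult_iff)
qed

lemma corr_right_angle: "corr (pi / 2) = 0"
proof -
  have int_h: "integrable std_gauss h"
    by (rule std_gauss.square_integrable_imp_integrable[OF _ sq]) simp
  have "corr (pi / 2) = (\<integral>p. h (fst p) * h (snd p) \<partial>Q)"
    by (simp add: corr_def u_0) (simp add: u_def rot_def)
  also have "\<dots> = (\<integral>x. (\<integral>y. h x * h y \<partial>std_gauss) \<partial>std_gauss)"
  proof -
    have "integrable Q (\<lambda>p. h (fst p) * h (snd p))"
      by (rule std_gauss_pair.Fubini_integrable) (auto simp: abs_mult intro!: int_h integrable_abs integrable_mult_left)
    then show ?thesis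
      using std_gauss_pair.integral_fst'[of "\<lambda>p. h (fst p) * h (snd p)"] by simp
  qed
  also have "\<dots> = 0"
    using integral_std_gauss_odd[OF h_meas odd] by simp
  finally show ?thesis .
qed

lemma corr_dyadic: "corr (pi / 2 ^ Suc k) \<le> cos (pi / 2 ^ Suc k) * m2"
proof (induction k)
  case 0
  then show ?case by (simp add: corr_right_angle)
next
  case (Suc k)
  have "(2::real) < 2 ^ Suc (Suc k)"
    using power_strict_increasing[of 1 "Suc (Suc k)" "2::real"] by simp
  then have "pi / 2 ^ Suc (Suc k) < pi / 2"
    by (intro divide_strict_left_mono) auto
  then have "cos (pi / 2 ^ Suc (Suc k)) > 0"
    by (intro cos_gt_zero_pi) (auto intro: less_trans[of _ 0])
  then show ?case
    by (rule corr_half_angle) (use Suc in simp)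
qed

end

lemma one_minus_cos_dyadic_limit:
  "(\<lambda>k. 2 * (1 - cos (pi / 2 ^ Suc k)) / (pi / 2 ^ Suc k)\<^sup>2) \<longlonglongrightarrow> 1"
proof -
  have "((\<lambda>t::real. 2 * (1 - cos t) / t\<^sup>2) \<longlongrightarrow> 1) (at 0)"
    by real_asymp
  moreover have "filterlim (\<lambda>k. pi / 2 ^ Suc k) (at 0) sequentially"
    by real_asymp
  ultimately show ?thesis
    by (rule filterlim_compose)
qed

text \<open>Expanding the square, the mean of \<open>(u a - u 0)\<^sup>2\<close> is
  \<open>2 * (m2 - corr a)\<close>, which the dyadic bound makes at least
  \<open>2 * (1 - cos a) * m2\<close>. After division by \<open>a\<^sup>2\<close> the limit is taken
  by dominated convergence, the Lipschitz bound giving the majorant. Differentiability is asked only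
  off the origin, since the functions of interest are homogeneous extensions from the
  sphere.\<close>

lemma std_gauss_odd_poincare:
  fixes h :: "'a::euclidean_space \<Rightarrow> real"
  assumes [measurable]: "h \<in> borel_measurable borel" and odd: "\<And>x. h (- x) = - h x"
    and lip: "\<And>x y. \<bar>h x - h y\<bar> \<le> L * norm (x - y)"
    and deriv: "\<And>x y. x \<noteq> 0 \<Longrightarrow> ((\<lambda>t. (h (cos t *\<^sub>R x + sin t *\<^sub>R y) - h x) / t) \<longlongrightarrow> D x y) (at 0)"
  shows "(\<integral>\<^sup>+x. ennreal ((h x)\<^sup>2) \<partial>std_gauss) \<le> (\<integral>\<^sup>+x. (\<integral>\<^sup>+y. ennreal ((D x y)\<^sup>2) \<partial>std_gauss) \<partial>std_gauss)"
proof -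
  have L: "0 \<le> L"
  proof -
    obtain b :: 'a where b: "b \<in> Basis"
      by (meson nonempty_Basis ex_in_conv)
    have "0 \<le> L * norm (b - 0)"
      using lip[of b 0] by (meson abs_ge_zero order_trans)
    then show ?thesis using b by simp
  qed
  have h0: "h 0 = 0"
    using odd[of 0] by simp
  have bound: "\<bar>h x\<bar> \<le> L * norm x" for x
    using lip[of x 0] h0 by simp
  have n2: "integrable std_gauss (\<lambda>x::'a. (norm x)\<^sup>2)"
    using std_gauss_norm_second_moment[where 'a='a] by (simp add: has_bochner_integral_iff)
  have sq: "integrable std_gauss (\<lambda>x. (h x)\<^sup>2)"
  proof (rule Bochner_Integration.integrable_bound)
    show "integrable std_gauss (\<lambda>x::'a. L\<^sup>2 * (norm x)\<^sup>2)"
      using n2 by simp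
    show "AE x in std_gauss. norm ((h x)\<^sup>2) \<le> norm (L\<^sup>2 * (norm x)\<^sup>2)"
      using bound by (intro AE_I2) (simp add: power_mult_distrib[symmetric] power2_le_iff_abs_le abs_mult L)
  qed measurable
  interpret square_integrable_odd h
    by standard (use odd sq in auto)
  define T where "T k = pi / 2 ^ Suc k" for k :: nat
  have T: "T k > 0" for k by (simp add: T_def)
  have T_lim: "filterlim T (at 0) sequentially"
    unfolding T_def by real_asymp
  \<comment> \<open>The indicator removes the null set on which no derivative is available, so that
    the limit exists at every point.\<close>
  define S where "S k p = indicator {p. fst p \<noteq> 0} p * ((u (T k) p - u 0 p) / T k)\<^sup>2" for k p
  have [measurable]: "S k \<in> borel_measurable Q" for k
    unfolding S_def[abs_def] by measurable
  have AE_Q: "AE p in Q. fst p \<noteq> 0"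
  proof -
    have "AE x in distr Q std_gauss fst. (x::'a) \<noteq> 0"
      unfolding std_gauss.distr_pair_fst by (rule AE_std_gauss_neq_0)
    then show ?thesis
      by (rule AE_distrD[rotated]) measurable
  qed
  \<comment> \<open>Defined as a limit of measurable functions, hence measurable; nothing is assumed
    about the measurability of \<open>D\<close>.\<close>
  define w where "w p = lim (\<lambda>k. S k p)" for p
  have S_lim: "(\<lambda>k. S k p) \<longlonglongrightarrow> indicator {p. fst p \<noteq> 0} p * (D (fst p) (snd p))\<^sup>2" for p
  proof (cases "fst p = 0")
    case False
    have "(\<lambda>k. (h (cos (T k) *\<^sub>R fst p + sin (T k) *\<^sub>R snd p) - h (fst p)) / T k) \<longlonglongrightarrow> D (fst p) (snd p)"
      by (rule filterlim_compose[OF deriv[OF False] T_lim])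
    then show ?thesis
      using False unfolding S_def by (auto simp: u_def rot_def intro!: tendsto_power)
  qed (simp add: S_def)
  have w_eq: "w p = indicator {p. fst p \<noteq> 0} p * (D (fst p) (snd p))\<^sup>2" for p
    unfolding w_def by (rule limI[OF S_lim])
  have w_nonneg: "0 \<le> w p" for p
    by (simp add: w_eq)
  have S_lim': "(\<lambda>k. S k p) \<longlonglongrightarrow> w p" for p
    using S_lim[of p] by (simp only: w_eq)
  have [measurable]: "w \<in> borel_measurable Q"
    unfolding w_def[abs_def] by (rule borel_measurable_lim_metric) measurable
  have fst_n2: "integrable Q (\<lambda>p. (norm (fst p))\<^sup>2)"
  proof -
    have d: "distr Q std_gauss fst = (std_gauss :: 'a measure)"
      by (rule std_gauss.distr_pair_fst)
    show ?thesis
      using n2 integrable_distr_eq[of fst Q std_gauss "\<lambda>x::'a. (norm x)\<^sup>2"] unfolding d by simp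
  qed
  have snd_n2: "integrable Q (\<lambda>p. (norm (snd p))\<^sup>2)"
    using std_gauss_pair.integrable_product_swap[OF fst_n2] by (simp add: case_prod_unfold)
  have S_bound: "\<bar>S k p\<bar> \<le> L\<^sup>2 * (2 * (norm (fst p))\<^sup>2 + 2 * (norm (snd p))\<^sup>2)" for k p
  proof -
    let ?t = "T k"
    have "\<bar>cos ?t - 1\<bar> \<le> ?t"
    proof -
      have "1 - cos ?t = 2 * (sin (?t / 2))\<^sup>2"
        using cos_double_sin[of "?t / 2"] by simp
      also have "\<dots> \<le> 2 * \<bar>sin (?t / 2)\<bar>"
        using mult_left_le[of "\<bar>sin (?t / 2)\<bar>" "\<bar>sin (?t / 2)\<bar>"] by (simp add: power2_eq_square)
      also have "\<dots> \<le> ?t"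
        using abs_sin_x_le_abs_x[of "?t / 2"] T[of k] by simp
      finally show ?thesis by simp
    qed
    moreover have "\<bar>sin ?t\<bar> \<le> ?t"
      using abs_sin_x_le_abs_x[of ?t] T[of k] by simp
    ultimately have "norm ((cos ?t - 1) *\<^sub>R fst p + sin ?t *\<^sub>R snd p) \<le> ?t * norm (fst p) + ?t * norm (snd p)"
      by (intro order_trans[OF norm_triangle_ineq] add_mono) (auto intro: mult_right_mono)
    moreover have "cos ?t *\<^sub>R fst p + sin ?t *\<^sub>R snd p - fst p = (cos ?t - 1) *\<^sub>R fst p + sin ?t *\<^sub>R snd p"
      by (simp add: algebra_simps)
    ultimately have n: "norm (cos ?t *\<^sub>R fst p + sin ?t *\<^sub>R snd p - fst p) \<le> ?t * norm (fst p) + ?t * norm (snd p)"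
      by (simp only:)
    have "\<bar>u ?t p - u 0 p\<bar> \<le> L * norm (cos ?t *\<^sub>R fst p + sin ?t *\<^sub>R snd p - fst p)"
      using lip[of "cos ?t *\<^sub>R fst p + sin ?t *\<^sub>R snd p" "fst p"] by (simp add: u_def rot_def)
    also have "\<dots> \<le> L * (?t * norm (fst p) + ?t * norm (snd p))"
      by (rule mult_left_mono[OF n L])
    finally have "\<bar>u ?t p - u 0 p\<bar> \<le> L * (?t * norm (fst p) + ?t * norm (snd p))" .
    then have "\<bar>(u ?t p - u 0 p) / ?t\<bar> \<le> L * (norm (fst p) + norm (snd p))"
      using T[of k] by (simp add: field_simps)
    then have "((u ?t p - u 0 p) / ?t)\<^sup>2 \<le> (L * (norm (fst p) + norm (snd p)))\<^sup>2"
      by (metis abs_ge_zero power2_abs power_mono)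
    also have "\<dots> \<le> L\<^sup>2 * (2 * (norm (fst p))\<^sup>2 + 2 * (norm (snd p))\<^sup>2)"
      unfolding power_mult_distrib using sum_squares_bound[of "norm (fst p)" "norm (snd p)"]
      by (intro mult_left_mono) (auto simp: power2_sum)
    finally show ?thesis
      by (auto simp: S_def indicator_def)
  qed
  have dom: "integrable Q (\<lambda>p. L\<^sup>2 * (2 * (norm (fst p))\<^sup>2 + 2 * (norm (snd p))\<^sup>2))"
    using fst_n2 snd_n2 by simp
  have S_tendsto: "(\<lambda>k. \<integral>p. S k p \<partial>Q) \<longlonglongrightarrow> (\<integral>p. w p \<partial>Q)"
    using S_lim' S_bound by (intro integral_dominated_convergence[OF _ _ dom]) auto
  have w_int: "integrable Q w"
    using S_lim' S_bound by (intro integrable_dominated_convergence[OF _ _ dom, of w S]) auto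
  have S_int: "2 * (1 - cos (T (Suc k))) / (T (Suc k))\<^sup>2 * m2 \<le> (\<integral>p. S (Suc k) p \<partial>Q)" for k
  proof -
    let ?t = "T (Suc k)"
    have "(2::real) < 2 ^ Suc (Suc k)"
      using power_strict_increasing[of 1 "Suc (Suc k)" "2::real"] by simp
    then have "?t < pi / 2"
      unfolding T_def by (intro divide_strict_left_mono) auto
    then have c: "cos ?t > 0"
      using T[of "Suc k"] by (intro cos_gt_zero_pi) auto
    note i = u_sq[OF c] u_sq_0
    have "has_bochner_integral Q (\<lambda>p. u 0 p * u ?t p) (corr ?t)"
      using u_prod_integrable[of 0 ?t] i by (auto simp: has_bochner_integral_iff corr_def)
    then have "has_bochner_integral Q (\<lambda>p. ((u ?t p)\<^sup>2 + (u 0 p)\<^sup>2 - 2 * (u 0 p * u ?t p)) / ?t\<^sup>2) ((m2 + m2 - 2 * corr ?t) / ?t\<^sup>2)"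
      using i T[of "Suc k"] by (intro has_bochner_integral_divide_zero has_bochner_integral_diff has_bochner_integral_add has_bochner_integral_mult_right) auto
    moreover have "((u ?t p)\<^sup>2 + (u 0 p)\<^sup>2 - 2 * (u 0 p * u ?t p)) / ?t\<^sup>2 = ((u ?t p - u 0 p) / ?t)\<^sup>2" for p
      by (simp add: power_divide power2_diff mult_ac)
    ultimately have "(\<integral>p. ((u ?t p - u 0 p) / ?t)\<^sup>2 \<partial>Q) = (m2 + m2 - 2 * corr ?t) / ?t\<^sup>2"
      by (simp add: has_bochner_integral_iff)
    moreover have "(\<integral>p. S (Suc k) p \<partial>Q) = (\<integral>p. ((u ?t p - u 0 p) / ?t)\<^sup>2 \<partial>Q)"
      using AE_Q by (intro integral_cong_AE) (auto simp: S_def elim!: eventually_mono)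
    moreover have "2 * (1 - cos ?t) * m2 \<le> m2 + m2 - 2 * corr ?t"
      using corr_dyadic[of "Suc k"] unfolding T_def by (simp add: algebra_simps)
    ultimately show ?thesis
      using T[of "Suc k"] by (simp add: divide_right_mono)
  qed
  have "(\<lambda>k. 2 * (1 - cos (T (Suc k))) / (T (Suc k))\<^sup>2 * m2) \<longlonglongrightarrow> 1 * m2"
    unfolding T_def by (intro tendsto_mult tendsto_const LIMSEQ_Suc one_minus_cos_dyadic_limit)
  from LIMSEQ_le[OF this LIMSEQ_Suc[OF S_tendsto]] S_int have "m2 \<le> (\<integral>p. w p \<partial>Q)"
    by auto
  then have "ennreal m2 \<le> (\<integral>\<^sup>+p. ennreal (w p) \<partial>Q)"
    using w_int w_nonneg by (subst nn_integral_eq_integral) (auto intro!: ennreal_leI)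
  also have "\<dots> = (\<integral>\<^sup>+x. (\<integral>\<^sup>+y. ennreal (w (x, y)) \<partial>std_gauss) \<partial>std_gauss)"
    by (rule std_gauss.nn_integral_fst[symmetric]) measurable
  also have "\<dots> \<le> (\<integral>\<^sup>+x. (\<integral>\<^sup>+y. ennreal ((D x y)\<^sup>2) \<partial>std_gauss) \<partial>std_gauss)"
    by (intro nn_integral_mono) (auto simp: w_eq indicator_def)
  finally show ?thesis
    unfolding m2_def using sq by (subst nn_integral_eq_integral) auto
qed

text \<open>Apply the Gaussian inequality to the extension \<open>h\<close> of \<open>w\<close> that
  is homogeneous of degree \<open>1\<close>. On the sphere its gradient \<open>a e\<close> has
  radial part \<open>w e\<close> and tangential part that of \<open>D e\<close>, so its squared norm
  is at most \<open>(w e)\<^sup>2 + b e\<close>. The left side becomes \<open>DIM('a)\<close> times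
  the mean of the square of \<open>w\<close>; moving one copy of that mean across produces the
  constant \<open>DIM('a) - 1\<close>.\<close>

lemma sphere_odd_poincare:
  fixes w :: "'a::euclidean_space \<Rightarrow> real" and D :: "'a \<Rightarrow> 'a"
  assumes [measurable]: "w \<in> borel_measurable borel" "b \<in> borel_measurable borel"
    and odd: "\<And>x. w (- x) = - w x"
    and lip: "\<And>x y. norm x = 1 \<Longrightarrow> norm y = 1 \<Longrightarrow> \<bar>w x - w y\<bar> \<le> L * norm (x - y)"
    and deriv: "\<And>x. norm x = 1 \<Longrightarrow> (w has_derivative (\<lambda>v. D x \<bullet> v)) (at x)"
    and bound: "\<And>x. norm x = 1 \<Longrightarrow> (norm (D x))\<^sup>2 \<le> b x"
  shows "ennreal (real DIM('a) - 1) * (\<integral>\<^sup>+e. ennreal ((w e)\<^sup>2) \<partial>uniform_sphere) \<le> (\<integral>\<^sup>+e. ennreal (b e) \<partial>uniform_sphere)"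
proof -
  let ?N = "\<lambda>x::'a. x /\<^sub>R norm x"
  define h where "h x = norm x * w (?N x)" for x
  define a where "a e = w e *\<^sub>R e + (D e - (D e \<bullet> e) *\<^sub>R e)" for e
  have [measurable]: "h \<in> borel_measurable borel"
    unfolding h_def[abs_def] by measurable
  have N: "norm (?N x) = 1" if "x \<noteq> 0" for x
    using that by simp
  have hom: "h (r *\<^sub>R x) = r * h x" if "r > 0" for r x
  proof -
    have "h z = norm z * w (sgn z)" for z
      by (simp add: h_def sgn_div_norm)
    then show ?thesis
      using that by (simp add: sgn_scaleR)
  qed
  have h_odd: "h (- x) = - h x" for x
    by (simp add: h_def odd scaleR_minus_right)
  \<comment> \<open>Antipodal points have distance \<open>2\<close> and opposite values, so the
    Lipschitz bound between them bounds \<open>w\<close> itself.\<close>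
  have wb: "\<bar>w x\<bar> \<le> L" if "norm x = 1" for x
  proof -
    have "x - - x = 2 *\<^sub>R x"
      by (simp add: scaleR_2)
    then show ?thesis
      using lip[of x "- x"] odd[of x] that by simp
  qed
  have L: "L \<ge> 0"
  proof -
    obtain c :: 'a where "c \<in> Basis"
      by (meson nonempty_Basis ex_in_conv)
    then show ?thesis
      using wb[of c] by simp
  qed
  \<comment> \<open>The constant \<open>3\<close> is \<open>2 + 1\<close>: normalising the two
    points costs a factor \<open>2\<close> in \<open>L * norm (x - y)\<close>, and the difference of
    the two norms, times a value of \<open>w\<close>, adds one more.\<close>
  have h_lip: "\<bar>h x - h y\<bar> \<le> 3 * L * norm (x - y)" for x y
  proof (cases "x = 0 \<or> y = 0")
    case True
    have *: "\<bar>h z\<bar> \<le> 3 * L * norm z" for z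
    proof (cases "z = 0")
      case False
      then have "\<bar>h z\<bar> \<le> norm z * L"
        using wb[OF N[OF False]] by (simp add: h_def abs_mult)
      also have "\<dots> \<le> 3 * L * norm z"
        using L by simp
      finally show ?thesis .
    qed (simp add: h_def)
    show ?thesis
      using True *[of x] *[of y] by (auto simp: h_def)
  next
    case False
    then have x: "x \<noteq> 0" and y: "y \<noteq> 0" by auto
    have "norm x * norm (?N x - ?N y) = norm (norm x *\<^sub>R (?N x - ?N y))"
      by simp
    also have "norm x *\<^sub>R (?N x - ?N y) = (x - y) + (1 - norm x / norm y) *\<^sub>R y"
      using x by (simp add: algebra_simps divide_inverse)
    also have "norm \<dots> \<le> norm (x - y) + norm ((1 - norm x / norm y) *\<^sub>R y)"
      by (rule norm_triangle_ineq)
    also have "norm ((1 - norm x / norm y) *\<^sub>R y) = \<bar>norm y - norm x\<bar>"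
      using y by (simp add: abs_mult[symmetric] field_simps flip: abs_mult_pos)
    also have "\<dots> \<le> norm (x - y)"
      using norm_triangle_ineq3[of y x] by (simp add: norm_minus_commute)
    finally have A: "norm x * norm (?N x - ?N y) \<le> 2 * norm (x - y)" by simp
    have "h x - h y = norm x * (w (?N x) - w (?N y)) + (norm x - norm y) * w (?N y)"
      by (simp add: h_def algebra_simps)
    then have "\<bar>h x - h y\<bar> \<le> norm x * \<bar>w (?N x) - w (?N y)\<bar> + \<bar>norm x - norm y\<bar> * \<bar>w (?N y)\<bar>"
      using abs_triangle_ineq[of "norm x * (w (?N x) - w (?N y))" "(norm x - norm y) * w (?N y)"]
      by (simp add: abs_mult)
    also have "\<dots> \<le> norm x * (L * norm (?N x - ?N y)) + norm (x - y) * L"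
      using lip[OF N[OF x] N[OF y]] wb[OF N[OF y]] norm_triangle_ineq3[of x y]
      by (intro add_mono mult_mono) auto
    also have "norm x * (L * norm (?N x - ?N y)) \<le> L * (2 * norm (x - y))"
      using mult_left_mono[OF A L] by (simp add: mult_ac)
    finally show ?thesis
      by (simp add: algebra_simps)
  qed
  have h_deriv: "((\<lambda>t. (h (cos t *\<^sub>R x + sin t *\<^sub>R y) - h x) / t) \<longlongrightarrow> a (?N x) \<bullet> y) (at 0)" if x: "x \<noteq> 0" for x y
  proof -
    define e where "e = ?N x"
    have e: "norm e = 1" "e = sgn x"
      using x by (auto simp: e_def sgn_div_norm)
    define c where "c t = cos t *\<^sub>R x + sin t *\<^sub>R y" for t
    have c0: "c 0 = x"
      by (simp add: c_def)
    have dc: "(c has_derivative (\<lambda>t. t *\<^sub>R y)) (at 0)"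
      unfolding c_def[abs_def] by (auto intro!: derivative_eq_intros)
    have dn: "((\<lambda>t. norm (c t)) has_derivative (\<lambda>t. t * (y \<bullet> e))) (at 0)"
      using has_derivative_compose[OF dc, of norm "\<lambda>v. v \<bullet> sgn x"] has_derivative_norm[OF x]
      by (simp add: c0 e)
    have di: "((\<lambda>t. inverse (norm (c t))) has_derivative (\<lambda>t. - (inverse (norm x) * (t * (y \<bullet> e)) * inverse (norm x)))) (at 0)"
      using Deriv.has_derivative_inverse[OF _ dn] x by (simp add: c0)
    have "((\<lambda>t. ?N (c t)) has_derivative (\<lambda>t. inverse (norm x) *\<^sub>R (t *\<^sub>R y)
        + (- (inverse (norm x) * (t * (y \<bullet> e)) * inverse (norm x))) *\<^sub>R x)) (at 0)"
      using has_derivative_scaleR[OF di dc] by (simp add: c0)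
    also have "(\<lambda>t. inverse (norm x) *\<^sub>R (t *\<^sub>R y) + (- (inverse (norm x) * (t * (y \<bullet> e)) * inverse (norm x))) *\<^sub>R x)
        = (\<lambda>t. (t / norm x) *\<^sub>R (y - (y \<bullet> e) *\<^sub>R e))"
      by (simp add: e_def fun_eq_iff algebra_simps divide_inverse)
    finally have dN: "((\<lambda>t. ?N (c t)) has_derivative (\<lambda>t. (t / norm x) *\<^sub>R (y - (y \<bullet> e) *\<^sub>R e))) (at 0)" .
    have dw: "((\<lambda>t. w (?N (c t))) has_derivative (\<lambda>t. D e \<bullet> ((t / norm x) *\<^sub>R (y - (y \<bullet> e) *\<^sub>R e)))) (at 0)"
      using has_derivative_compose[OF dN, of w "\<lambda>v. D e \<bullet> v"] deriv[OF e(1)] by (simp add: c0 e_def)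
    have "((\<lambda>t. h (c t)) has_derivative (\<lambda>t. norm x * (D e \<bullet> ((t / norm x) *\<^sub>R (y - (y \<bullet> e) *\<^sub>R e))) + (t * (y \<bullet> e)) * w e)) (at 0)"
      using has_derivative_mult[OF dn dw] by (simp add: c0 e_def h_def)
    also have "(\<lambda>t. norm x * (D e \<bullet> ((t / norm x) *\<^sub>R (y - (y \<bullet> e) *\<^sub>R e))) + (t * (y \<bullet> e)) * w e) = (*) (a e \<bullet> y)"
      using x by (simp add: a_def fun_eq_iff algebra_simps inner_add_left inner_diff_left inner_diff_right inner_commute)
    finally have "((\<lambda>t. h (c t)) has_real_derivative a e \<bullet> y) (at 0)"
      by (simp add: has_field_derivative_def)
    then show ?thesis
      unfolding DERIV_def c_def e_def by simp
  qed
  have a_norm: "(norm (a e))\<^sup>2 \<le> (w e)\<^sup>2 + b e" if e: "norm e = 1" for e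
  proof -
    have ee: "e \<bullet> e = 1"
      using e by (simp add: dot_square_norm)
    have "(norm (a e))\<^sup>2 = (w e)\<^sup>2 + (norm (D e))\<^sup>2 - (D e \<bullet> e)\<^sup>2"
    proof -
      define \<alpha> where "\<alpha> = D e \<bullet> e"
      define g where "g = D e - \<alpha> *\<^sub>R e"
      have ge: "g \<bullet> e = 0" "e \<bullet> g = 0"
        by (simp_all add: g_def \<alpha>_def inner_diff_left inner_diff_right ee inner_commute)
      have "g \<bullet> g = g \<bullet> D e"
        using ge by (simp add: g_def inner_diff_right)
      also have "\<dots> = D e \<bullet> D e - \<alpha> * \<alpha>"
        by (simp add: g_def \<alpha>_def inner_diff_left inner_commute[of e])
      finally have gg: "g \<bullet> g = D e \<bullet> D e - \<alpha> * \<alpha>" .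
      have "a e = w e *\<^sub>R e + g"
        by (simp add: a_def g_def \<alpha>_def)
      then have "(norm (a e))\<^sup>2 = w e * w e + g \<bullet> g"
        unfolding power2_norm_eq_inner by (simp add: inner_add_left inner_add_right ge ee)
      then show ?thesis
        by (simp add: gg power2_norm_eq_inner[of "D e"] power2_eq_square[of "w e"] power2_eq_square[of "D e \<bullet> e"] \<alpha>_def)
    qed
    also have "\<dots> \<le> (w e)\<^sup>2 + b e"
      using bound[OF e] zero_le_power2[of "D e \<bullet> e"] by linarith
    finally show ?thesis .
  qed
  define W where "W = (\<integral>\<^sup>+e. ennreal ((w e)\<^sup>2) \<partial>(uniform_sphere :: 'a measure))"
  define B where "B = (\<integral>\<^sup>+e. ennreal (b e) \<partial>(uniform_sphere :: 'a measure))"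
  have W_h: "W = (\<integral>\<^sup>+e. ennreal ((h e)\<^sup>2) \<partial>(uniform_sphere :: 'a measure))"
    unfolding W_def using AE_uniform_sphere by (intro nn_integral_cong_AE) (auto simp: h_def elim!: eventually_mono)
  have "ennreal (real DIM('a)) * W = (\<integral>\<^sup>+x. ennreal (norm (x::'a) ^ 2) \<partial>std_gauss) * W"
    using std_gauss_norm_second_moment[where 'a='a]
    by (subst nn_integral_eq_integral) (auto simp: has_bochner_integral_iff)
  also have "\<dots> = (\<integral>\<^sup>+x. ennreal ((h x)\<^sup>2) \<partial>std_gauss)"
    unfolding W_h by (rule nn_integral_std_gauss_homogeneous[symmetric]) (auto simp: hom power_mult_distrib ennreal_mult)
  also have "\<dots> \<le> (\<integral>\<^sup>+x. (\<integral>\<^sup>+y. ennreal ((a (?N x) \<bullet> y)\<^sup>2) \<partial>std_gauss) \<partial>std_gauss)"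
    by (rule std_gauss_odd_poincare[OF _ h_odd h_lip h_deriv]) auto
  also have "\<dots> = (\<integral>\<^sup>+x. ennreal ((norm (a (?N x)))\<^sup>2) \<partial>std_gauss)"
    using std_gauss_linear_second_moment
    by (intro nn_integral_cong, subst nn_integral_eq_integral) (auto simp: has_bochner_integral_iff)
  also have "\<dots> \<le> (\<integral>\<^sup>+x. ennreal ((w (?N x))\<^sup>2) + ennreal (b (?N x)) \<partial>std_gauss)"
    using AE_std_gauss_neq_0
  proof (intro nn_integral_mono_AE, eventually_elim)
    fix x :: 'a assume "x \<noteq> 0"
    from a_norm[OF N[OF this]] bound[OF N[OF this]]
    show "ennreal ((norm (a (?N x)))\<^sup>2) \<le> ennreal ((w (?N x))\<^sup>2) + ennreal (b (?N x))"
      by (subst ennreal_plus[symmetric]) (auto intro: ennreal_leI order_trans[OF zero_le_power2])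
  qed
  \<comment> \<open>The integrand is homogeneous of degree \<open>0\<close>, so its Gaussian mean
    equals its mean over the sphere.\<close>
  also have "\<dots> = (\<integral>\<^sup>+x. ennreal (norm (x::'a) ^ 0) \<partial>std_gauss)
      * (\<integral>\<^sup>+x. ennreal ((w (?N x))\<^sup>2) + ennreal (b (?N x)) \<partial>uniform_sphere)"
  proof (rule nn_integral_std_gauss_homogeneous)
    fix r :: real and x :: 'a assume "r > 0"
    then have "?N (r *\<^sub>R x) = ?N x"
      unfolding sgn_div_norm[symmetric] by (simp add: sgn_scaleR)
    then show "ennreal ((w (?N (r *\<^sub>R x)))\<^sup>2) + ennreal (b (?N (r *\<^sub>R x)))
        = ennreal (r ^ 0) * (ennreal ((w (?N x))\<^sup>2) + ennreal (b (?N x)))"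
      by (simp only: power_0 ennreal_1 mult_1_left)
  qed measurable
  also have "(\<integral>\<^sup>+x. ennreal (norm (x::'a) ^ 0) \<partial>std_gauss) = 1"
    using std_gauss.emeasure_space_1[where 'a='a] by simp
  also have "(\<integral>\<^sup>+x. ennreal ((w (?N x))\<^sup>2) + ennreal (b (?N x)) \<partial>uniform_sphere)
      = (\<integral>\<^sup>+x. ennreal ((w x)\<^sup>2) + ennreal (b x) \<partial>(uniform_sphere :: 'a measure))"
    using AE_uniform_sphere by (intro nn_integral_cong_AE) (auto elim!: eventually_mono)
  also have "\<dots> = W + B"
    unfolding W_def B_def by (rule nn_integral_add) auto
  finally have "ennreal (real DIM('a)) * W \<le> W + B" by simp
  moreover have "ennreal (real DIM('a)) * W = W + ennreal (real DIM('a) - 1) * W"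
  proof -
    have "ennreal (real DIM('a)) = ennreal 1 + ennreal (real DIM('a) - 1)"
      by (subst ennreal_plus[symmetric]) (auto simp: DIM_positive Suc_le_eq)
    then show ?thesis
      by (simp add: distrib_right)
  qed
  \<comment> \<open>Finiteness is what permits cancelling \<open>W\<close> on both sides in
    \<open>ennreal\<close>.\<close>
  moreover have "W \<noteq> top"
  proof -
    have "W \<le> (\<integral>\<^sup>+e. ennreal (L\<^sup>2) \<partial>(uniform_sphere :: 'a measure))"
      unfolding W_def using AE_uniform_sphere wb
      by (intro nn_integral_mono_AE) (auto elim!: eventually_mono intro!: ennreal_leI simp: power2_le_iff_abs_le L)
    also have "\<dots> = ennreal (L\<^sup>2)"
      using uniform_sphere.emeasure_space_1[where 'a='a] by simp
    finally show ?thesis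
      by (auto simp: top_unique)
  qed
  ultimately show ?thesis
    unfolding W_def B_def by (simp add: ennreal_add_left_cancel_le)
qed

subsection \<open>Averages over balls and their gradients\<close>

abbreviation uniform_ball :: "'a::euclidean_space measure" where
  "uniform_ball \<equiv> uniform_measure lborel (cball 0 1)"

lemma prob_space_uniform_ball: "prob_space (uniform_ball :: 'a::euclidean_space measure)"
  using unit_ball_vol_pos[of "real DIM('a)"]
  by (intro prob_space_uniform_measure) (auto simp: emeasure_unit_ball simp del: unit_ball_vol_pos)

interpretation uniform_ball: prob_space uniform_ball
  by (rule prob_space_uniform_ball)

lemma AE_uniform_ball: "AE v in uniform_ball. norm (v::'a::euclidean_space) \<le> 1"
  by (rule AE_uniform_measureI) auto

lemma integral_uniform_ball:
  fixes f :: "'a::euclidean_space \<Rightarrow> real"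
  assumes [measurable]: "f \<in> borel_measurable borel"
  shows "(\<integral>v. f v \<partial>uniform_ball) = (\<integral>v. indicator (cball 0 1) v * f v \<partial>lborel) / unit_ball_vol (real DIM('a))"
proof -
  have "uniform_ball = density lborel (\<lambda>x::'a. ennreal (indicator (cball 0 1) x / unit_ball_vol (real DIM('a))))"
    unfolding uniform_measure_def emeasure_unit_ball
    by (intro arg_cong[of _ _ "density lborel"]) (auto simp: fun_eq_iff indicator_def divide_ennreal[symmetric])
  then have "(\<integral>v. f v \<partial>uniform_ball) = (\<integral>v. indicator (cball 0 1) v / unit_ball_vol (real DIM('a)) * f v \<partial>lborel)"
    by (simp only:) (subst integral_density, auto intro!: borel_measurable_divide borel_measurable_indicator)
  also have "\<dots> = (\<integral>v. indicator (cball 0 1) v * f v / unit_ball_vol (real DIM('a)) \<partial>lborel)"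
    by simp
  finally show ?thesis
    by (simp only: integral_divide_zero)
qed

lemma integral_lborel_polar:
  fixes f :: "'a::euclidean_space \<Rightarrow> real"
  assumes f: "integrable lborel f"
  shows "(\<integral>x. f x \<partial>lborel) = (\<integral>e. (\<integral>r. f (r *\<^sub>R e) \<partial>radial_measure TYPE('a)) \<partial>uniform_sphere)"
    and "integrable uniform_sphere (\<lambda>e. \<integral>r. f (r *\<^sub>R e) \<partial>radial_measure TYPE('a))"
proof -
  interpret R: sigma_finite_measure "radial_measure TYPE('a)"
    by (rule sigma_finite_radial_measure)
  interpret P: pair_sigma_finite "uniform_sphere :: 'a measure" "radial_measure TYPE('a)"
    by standard
  have [measurable]: "f \<in> borel_measurable borel"
    using borel_measurable_integrable[OF f] by simp
  have "integrable (distr (uniform_sphere \<Otimes>\<^sub>M radial_measure TYPE('a)) borel (\<lambda>(e, r). r *\<^sub>R e)) f"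
    using f by (simp add: lborel_polar[symmetric])
  then have i: "integrable (uniform_sphere \<Otimes>\<^sub>M radial_measure TYPE('a)) (\<lambda>(e, r). f (r *\<^sub>R e))"
    by (subst (asm) integrable_distr_eq) (auto simp: case_prod_unfold)
  show "integrable uniform_sphere (\<lambda>e. \<integral>r. f (r *\<^sub>R e) \<partial>radial_measure TYPE('a))"
    using P.integrable_fst'[OF i] by simp
  have "(\<integral>x. f x \<partial>lborel) = (\<integral>x. f x \<partial>distr (uniform_sphere \<Otimes>\<^sub>M radial_measure TYPE('a)) borel (\<lambda>(e, r). r *\<^sub>R e))"
    by (simp add: lborel_polar[symmetric])
  also have "\<dots> = (\<integral>p. (\<lambda>(e, r). f (r *\<^sub>R e)) p \<partial>(uniform_sphere \<Otimes>\<^sub>M radial_measure TYPE('a)))"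
    by (subst integral_distr) (auto simp: case_prod_unfold)
  also have "\<dots> = (\<integral>e. (\<integral>r. f (r *\<^sub>R e) \<partial>radial_measure TYPE('a)) \<partial>uniform_sphere)"
    using P.integral_fst'[OF i] by simp
  finally show "(\<integral>x. f x \<partial>lborel) = (\<integral>e. (\<integral>r. f (r *\<^sub>R e) \<partial>radial_measure TYPE('a)) \<partial>uniform_sphere)" .
qed

text \<open>First-order expansion at \<open>R = 1\<close> of the integral of \<open>\<psi>\<close>
  from \<open>1\<close> to \<open>R\<close>. The difference of indicators is the oriented interval,
  so \<open>R < 1\<close> needs no separate case.\<close>

lemma interval_increment:
  fixes \<psi> :: "real \<Rightarrow> real"
  assumes [measurable]: "\<psi> \<in> borel_measurable borel" and R: "0 < R" "R \<le> 2"
    and lip: "\<And>r. 0 < r \<Longrightarrow> r \<le> 2 \<Longrightarrow> \<bar>\<psi> r - \<psi> 1\<bar> \<le> C * \<bar>r - 1\<bar>"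
  shows "\<bar>(\<integral>r. (indicator {0<..R} r - indicator {0<..1} r) * \<psi> r \<partial>lborel) - \<psi> 1 * (R - 1)\<bar> \<le> C * (R - 1)\<^sup>2"
proof -
  let ?i = "\<lambda>r. indicator {0<..R} r - indicator {0<..1} r :: real"
  let ?J = "{min 1 R..max 1 R}"
  have C: "C \<ge> 0"
    using lip[of 2] by simp
  have i: "has_bochner_integral lborel ?i (R - 1)"
    using R has_bochner_integral_diff[OF has_bochner_integral_real_indicator has_bochner_integral_real_indicator,
      of "{0<..R}" lborel "{0<..1}"] by simp
  have J: "has_bochner_integral lborel (indicator ?J :: real \<Rightarrow> real) \<bar>R - 1\<bar>"
    using has_bochner_integral_real_indicator[of ?J lborel] by (simp add: max_def min_def split: if_splits)
  have bnd: "\<bar>?i r * (\<psi> r - \<psi> 1)\<bar> \<le> C * \<bar>R - 1\<bar> * indicator ?J r" for r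
  proof (cases "?i r = 0")
    case False
    then have "(0 < r \<and> r \<le> R) \<noteq> (0 < r \<and> r \<le> 1)"
      by (auto simp: indicator_def)
    then have r: "r \<in> ?J" "0 < r" "r \<le> 2" "\<bar>?i r\<bar> = 1"
      using R by (auto simp: indicator_def)
    have "\<bar>?i r * (\<psi> r - \<psi> 1)\<bar> \<le> C * \<bar>r - 1\<bar>"
      using lip[of r] r by (simp add: abs_mult)
    also have "\<dots> \<le> C * \<bar>R - 1\<bar>"
      using r C by (intro mult_left_mono) auto
    finally show ?thesis
      using r by simp
  qed (use C in simp)
  have d: "integrable lborel (\<lambda>r. C * \<bar>R - 1\<bar> * indicator ?J r)"
    using J by (auto simp: has_bochner_integral_iff)
  have int: "integrable lborel (\<lambda>r. ?i r * (\<psi> r - \<psi> 1))"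
    by (rule Bochner_Integration.integrable_bound[OF d]) (use bnd in \<open>auto intro: order_trans[OF _ abs_ge_self]\<close>)
  have "(\<integral>r. ?i r * \<psi> r \<partial>lborel) = (\<integral>r. ?i r * (\<psi> r - \<psi> 1) + \<psi> 1 * ?i r \<partial>lborel)"
    by (simp add: algebra_simps)
  also have "\<dots> = (\<integral>r. ?i r * (\<psi> r - \<psi> 1) \<partial>lborel) + \<psi> 1 * (R - 1)"
    using int i by (subst Bochner_Integration.integral_add) (auto simp: has_bochner_integral_iff)
  finally have "\<bar>(\<integral>r. ?i r * \<psi> r \<partial>lborel) - \<psi> 1 * (R - 1)\<bar> = \<bar>\<integral>r. ?i r * (\<psi> r - \<psi> 1) \<partial>lborel\<bar>"
    by simp
  also have "\<dots> \<le> (\<integral>r. C * \<bar>R - 1\<bar> * indicator ?J r \<partial>lborel)"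
    using int d bnd by (intro order_trans[OF integral_abs_bound] integral_mono) auto
  also have "\<dots> = C * \<bar>R - 1\<bar> * \<bar>R - 1\<bar>"
    using J by (simp add: has_bochner_integral_iff)
  also have "\<dots> = C * (R - 1)\<^sup>2"
    by (simp add: power2_eq_square)
  finally show ?thesis .
qed

lemma abs_power_minus_one_le:
  fixes r :: real
  assumes "0 \<le> r" "r \<le> 2"
  shows "\<bar>r ^ k - 1\<bar> \<le> (2 ^ k - 1) * \<bar>r - 1\<bar>"
proof (induction k)
  case (Suc k)
  have "\<bar>r ^ Suc k - 1\<bar> = \<bar>r * (r ^ k - 1) + (r - 1)\<bar>"
    by (simp add: algebra_simps)
  also have "\<dots> \<le> r * \<bar>r ^ k - 1\<bar> + \<bar>r - 1\<bar>"
    using assms abs_triangle_ineq[of "r * (r ^ k - 1)" "r - 1"] by (simp add: abs_mult)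
  also have "\<dots> \<le> 2 * ((2 ^ k - 1) * \<bar>r - 1\<bar>) + \<bar>r - 1\<bar>"
    using Suc assms by (intro add_right_mono mult_mono) auto
  finally show ?case
    by (simp add: algebra_simps)
qed simp

lemma integrable_uniform_sphere_bounded:
  fixes f :: "'a::euclidean_space \<Rightarrow> 'b::{banach, second_countable_topology}"
  assumes "f \<in> borel_measurable borel" "\<And>e. norm e = 1 \<Longrightarrow> norm (f e) \<le> B"
  shows "integrable uniform_sphere f"
  using assms AE_uniform_sphere
  by (intro uniform_sphere.integrable_const_bound[where B = B]) (auto elim!: eventually_mono)

lemma lipschitz_measurable:
  fixes F :: "'a::euclidean_space \<Rightarrow> real"
  assumes "L-lipschitz_on UNIV F"
  shows "F \<in> borel_measurable borel"
  using lipschitz_on_continuous_on[OF assms] by (simp add: borel_measurable_continuous_onI)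

lemma lipschitz_bound:
  fixes F :: "'a::real_normed_vector \<Rightarrow> real"
  assumes "L-lipschitz_on UNIV F"
  shows "\<bar>F x - F y\<bar> \<le> L * norm (x - y)"
  using lipschitz_onD[OF assms, of x y] by (simp add: dist_norm)

text \<open>The ray \<open>r *\<^sub>R e\<close>, \<open>r > 0\<close>, leaves the shifted ball \<open>cball h 1\<close> at
  \<open>R = 1 + e \<bullet> h + O((norm h)\<^sup>2)\<close>; integrating along rays turns the difference of the
  integrals over the two balls into an integral over the sphere.\<close>

lemma ball_exit_radius:
  fixes e h :: "'a::euclidean_space"
  assumes e: "norm e = 1" and h: "norm h \<le> 1 / 2"
  obtains R where "0 < R" "R \<le> 2" "\<bar>R - 1 - e \<bullet> h\<bar> \<le> (norm h)\<^sup>2" "\<bar>R - 1\<bar> \<le> 2 * norm h"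
    "\<And>r. r > 0 \<Longrightarrow> r *\<^sub>R e \<in> cball h 1 \<longleftrightarrow> r \<le> R"
proof -
  define a where "a = e \<bullet> h"
  \<comment> \<open>The ray meets the boundary of the shifted ball where
    \<open>(r - a)\<^sup>2 = q\<close>. Of the two roots \<open>a - sqrt q\<close> and
    \<open>a + sqrt q\<close> the first is negative.\<close>
  define q where "q = 1 - (norm h)\<^sup>2 + a\<^sup>2"
  have a: "\<bar>a\<bar> \<le> norm h"
    using Cauchy_Schwarz_ineq2[of e h] e by (simp add: a_def)
  have hh: "(norm h)\<^sup>2 \<le> 1 / 4" "(norm h)\<^sup>2 \<le> norm h / 2"
    using h power_mono[OF h, of 2] mult_left_mono[OF h, of "norm h"] by (auto simp: power2_eq_square)
  have a2: "a\<^sup>2 \<le> (norm h)\<^sup>2"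
    using a power_mono[OF a, of 2] by simp
  have q: "1 - (norm h)\<^sup>2 \<le> q" "q \<le> 1" "0 < q"
    using a2 hh zero_le_power2[of a] unfolding q_def by linarith+
  have sq1: "sqrt q \<le> 1"
    using q by simp
  have "q * q \<le> q"
    using q by (simp add: mult_left_le)
  then have sq2: "1 - (norm h)\<^sup>2 \<le> sqrt q"
    using q real_le_rsqrt[of q q] by (simp add: power2_eq_square)
  have sqa: "\<bar>a\<bar> < sqrt q"
  proof (rule real_less_rsqrt)
    show "\<bar>a\<bar>\<^sup>2 < q"
      using hh unfolding q_def power2_abs by linarith
  qed
  show ?thesis
  proof (rule that[of "a + sqrt q"])
    show "0 < a + sqrt q"
      using sqa by linarith
    show "a + sqrt q \<le> 2"
      using a h sq1 by linarith
    show "\<bar>a + sqrt q - 1 - e \<bullet> h\<bar> \<le> (norm h)\<^sup>2"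
      using sq1 sq2 by (simp add: a_def[symmetric] abs_le_iff)
    show "\<bar>a + sqrt q - 1\<bar> \<le> 2 * norm h"
      by (rule abs_leI) (use sq1 sq2 a hh norm_ge_zero[of h] in linarith)+
    show "r *\<^sub>R e \<in> cball h 1 \<longleftrightarrow> r \<le> a + sqrt q" if "r > 0" for r
    proof -
      have "(norm (r *\<^sub>R e - h))\<^sup>2 = r\<^sup>2 - 2 * r * a + (norm h)\<^sup>2"
      proof -
        have "e \<bullet> e = 1"
          using e by (simp add: dot_square_norm)
        then show ?thesis
          unfolding power2_norm_eq_inner a_def
          by (simp add: inner_diff_left inner_diff_right inner_commute power2_eq_square[of r] algebra_simps)
      qed
      moreover have "r *\<^sub>R e \<in> cball h 1 \<longleftrightarrow> (norm (r *\<^sub>R e - h))\<^sup>2 \<le> 1"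
        by (simp add: dist_norm norm_minus_commute power_le_one_iff abs_square_le_1)
      ultimately have "r *\<^sub>R e \<in> cball h 1 \<longleftrightarrow> (r - a)\<^sup>2 \<le> q"
        unfolding q_def power2_diff by (simp only: mult.commute[of _ a] mult.assoc) linarith
      also have "\<dots> \<longleftrightarrow> \<bar>r - a\<bar> \<le> sqrt q"
        using q by (metis real_sqrt_abs real_sqrt_le_iff)
      also have "\<dots> \<longleftrightarrow> r \<le> a + sqrt q"
        using sqa that by (auto simp: abs_le_iff)
      finally show ?thesis .
    qed
  qed
qed

text \<open>A divergence theorem for the ball with \<open>F\<close> merely Lipschitz: to first order
  in \<open>h\<close>, shifting the ball changes the average of \<open>F\<close> by a boundary
  integral. The quadratic remainder, with \<open>C\<close> independent of \<open>h\<close>, later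
  gives differentiability of the ball average.\<close>

lemma ball_shift_estimate:
  fixes F :: "'a::euclidean_space \<Rightarrow> real"
  assumes F: "L-lipschitz_on UNIV F"
  obtains C where "\<And>h. norm h \<le> 1 / 2 \<Longrightarrow>
    \<bar>(\<integral>v. F (h + v) \<partial>uniform_ball) - (\<integral>v. F v \<partial>uniform_ball) - real DIM('a) * (\<integral>e. F e * (e \<bullet> h) \<partial>uniform_sphere)\<bar>
      \<le> C * (norm h)\<^sup>2"
proof -
  define n where "n = DIM('a)"
  define V where "V = unit_ball_vol (real DIM('a))"
  have V: "V > 0"
    unfolding V_def by (rule unit_ball_vol_pos) simp
  have n: "n > 0"
    by (simp add: n_def)
  define B where "B = \<bar>F 0\<bar> + L"
  \<comment> \<open>A Lipschitz constant at \<open>r = 1\<close>, valid up to \<open>r = 2\<close>,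
    for the radial integrand \<open>F (r *\<^sub>R e) * r ^ (n - 1)\<close>, with \<open>B\<close>
    bounding \<open>F\<close> on the sphere.\<close>
  define C1 where "C1 = 2 ^ (n - 1) * (B + L)"
  have [measurable]: "F \<in> borel_measurable borel"
    by (rule lipschitz_measurable[OF F])
  have contF: "continuous_on S F" for S
    using lipschitz_on_continuous_on[OF F] continuous_on_subset by blast
  have L: "L \<ge> 0"
    using lipschitz_on_nonneg[OF F] .
  have FB: "\<bar>F e\<bar> \<le> B" if "norm e = 1" for e
    using lipschitz_bound[OF F, of e 0] that by (simp add: B_def)
  have B: "B \<ge> 0"
    using L by (simp add: B_def)
  have psi: "\<bar>F (r *\<^sub>R e) * r ^ (n - 1) - F (1 *\<^sub>R e) * 1 ^ (n - 1)\<bar> \<le> C1 * \<bar>r - 1\<bar>"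
    if e: "norm e = 1" and r: "0 < r" "r \<le> 2" for e r
  proof -
    have "F (r *\<^sub>R e) * r ^ (n - 1) - F (1 *\<^sub>R e) * 1 ^ (n - 1)
        = (F (r *\<^sub>R e) - F e) * r ^ (n - 1) + F e * (r ^ (n - 1) - 1)"
      by (simp add: algebra_simps)
    then have "\<bar>F (r *\<^sub>R e) * r ^ (n - 1) - F (1 *\<^sub>R e) * 1 ^ (n - 1)\<bar>
        \<le> \<bar>F (r *\<^sub>R e) - F e\<bar> * r ^ (n - 1) + \<bar>F e\<bar> * \<bar>r ^ (n - 1) - 1\<bar>"
      using abs_triangle_ineq[of "(F (r *\<^sub>R e) - F e) * r ^ (n - 1)" "F e * (r ^ (n - 1) - 1)"] r
      by (simp add: abs_mult)
    also have "\<dots> \<le> (L * \<bar>r - 1\<bar>) * 2 ^ (n - 1) + B * (2 ^ (n - 1) * \<bar>r - 1\<bar>)"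
    proof (intro add_mono mult_mono)
      have "r *\<^sub>R e - e = (r - 1) *\<^sub>R e"
        by (simp add: algebra_simps)
      then show "\<bar>F (r *\<^sub>R e) - F e\<bar> \<le> L * \<bar>r - 1\<bar>"
        using lipschitz_bound[OF F, of "r *\<^sub>R e" e] e by simp
      show "r ^ (n - 1) \<le> 2 ^ (n - 1)"
        using r by (intro power_mono) auto
      have "\<bar>r ^ (n - 1) - 1\<bar> \<le> (2 ^ (n - 1) - 1) * \<bar>r - 1\<bar>"
        using r by (intro abs_power_minus_one_le) auto
      also have "\<dots> \<le> 2 ^ (n - 1) * \<bar>r - 1\<bar>"
        by (intro mult_right_mono) auto
      finally show "\<bar>r ^ (n - 1) - 1\<bar> \<le> 2 ^ (n - 1) * \<bar>r - 1\<bar>" .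
    qed (use FB[OF e] L B r in auto)
    also have "\<dots> = C1 * \<bar>r - 1\<bar>"
      by (simp add: C1_def algebra_simps)
    finally show ?thesis .
  qed
  have C1: "C1 \<ge> 0"
    using L B by (simp add: C1_def)
  \<comment> \<open>The term \<open>4 * C1\<close> comes from
    \<open>(R - 1)\<^sup>2 \<le> 4 * (norm h)\<^sup>2\<close> in the expansion along the ray, and
    \<open>B\<close> from replacing \<open>R - 1\<close> by \<open>e \<bullet> h\<close>.\<close>
  define C where "C = real n * (4 * C1 + B)"
  show ?thesis
  proof (rule that[of C])
    fix h :: 'a assume h: "norm h \<le> 1 / 2"
    define f where "f c x = indicator (cball c 1) x * F x" for c x
    have f_int: "integrable lborel (f c)" for c
      using borel_integrable_compact[of "cball c 1" F] contF by (simp add: f_def[abs_def])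
    have J: "(\<integral>v. F (c + v) \<partial>uniform_ball) = (\<integral>x. f c x \<partial>lborel) / V" for c
    proof -
      have "(\<integral>v. F (c + v) \<partial>uniform_ball) = (\<integral>v. indicator (cball 0 1) v * F (c + v) \<partial>lborel) / V"
        unfolding V_def by (rule integral_uniform_ball) measurable
      also have "(\<integral>v. indicator (cball 0 1) v * F (c + v) \<partial>lborel) = (\<integral>v. f c (c + v) \<partial>lborel)"
        by (intro Bochner_Integration.integral_cong) (auto simp: f_def indicator_def dist_norm)
      also have "\<dots> = (\<integral>x. f c x \<partial>distr lborel borel ((+) c))"
        by (subst integral_distr) (use borel_measurable_integrable[OF f_int] in auto)
      finally show ?thesis
        by (simp add: lborel_distr_plus)
    qed
    define T where "T e = (\<integral>r. f h (r *\<^sub>R e) - f 0 (r *\<^sub>R e) \<partial>radial_measure TYPE('a))" for e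
    have diff_int: "integrable lborel (\<lambda>x. f h x - f 0 x)"
      using f_int by simp
    have "(\<integral>v. F (h + v) \<partial>uniform_ball) - (\<integral>v. F v \<partial>uniform_ball) = (\<integral>x. f h x - f 0 x \<partial>lborel) / V"
      using J[of h] J[of 0] f_int by (simp add: diff_divide_distrib)
    also have "(\<integral>x. f h x - f 0 x \<partial>lborel) = (\<integral>e. T e \<partial>uniform_sphere)"
      unfolding T_def by (rule integral_lborel_polar[OF diff_int])
    finally have J_diff: "(\<integral>v. F (h + v) \<partial>uniform_ball) - (\<integral>v. F v \<partial>uniform_ball) = (\<integral>e. T e \<partial>uniform_sphere) / V" .
    have T_int: "integrable uniform_sphere T"
      unfolding T_def by (rule integral_lborel_polar[OF diff_int])
    have T: "\<bar>T e / V - real n * (F e * (e \<bullet> h))\<bar> \<le> C * (norm h)\<^sup>2" if e: "norm e = 1" for e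
    proof -
      obtain R where R: "0 < R" "R \<le> 2" "\<bar>R - 1 - e \<bullet> h\<bar> \<le> (norm h)\<^sup>2" "\<bar>R - 1\<bar> \<le> 2 * norm h"
        and RR: "\<And>r. r > 0 \<Longrightarrow> r *\<^sub>R e \<in> cball h 1 \<longleftrightarrow> r \<le> R"
        using ball_exit_radius[OF e h] by blast
      let ?I = "\<integral>r. (indicator {0<..R} r - indicator {0<..1} r) * (F (r *\<^sub>R e) * r ^ (n - 1)) \<partial>lborel"
      have rm: "radial_measure TYPE('a) = density lborel (\<lambda>r. ennreal (real n * V * r ^ (n - 1) * indicator {0<..} r))"
        unfolding radial_measure_def n_def V_def
        by (intro arg_cong[of _ _ "density lborel"]) (auto simp: fun_eq_iff indicator_def)
      have "T e = (\<integral>r. real n * V * r ^ (n - 1) * indicator {0<..} r * (f h (r *\<^sub>R e) - f 0 (r *\<^sub>R e)) \<partial>lborel)"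
        unfolding T_def rm using V borel_measurable_integrable[OF f_int]
        by (subst integral_density) (auto simp: indicator_def)
      also have "\<dots> = (\<integral>r. real n * V * ((indicator {0<..R} r - indicator {0<..1} r) * (F (r *\<^sub>R e) * r ^ (n - 1))) \<partial>lborel)"
      proof (rule Bochner_Integration.integral_cong[OF refl])
        fix r :: real
        show "real n * V * r ^ (n - 1) * indicator {0<..} r * (f h (r *\<^sub>R e) - f 0 (r *\<^sub>R e))
          = real n * V * ((indicator {0<..R} r - indicator {0<..1} r) * (F (r *\<^sub>R e) * r ^ (n - 1)))"
        proof (cases "r > 0")
          case True
          have "r *\<^sub>R e \<in> cball 0 1 \<longleftrightarrow> r \<le> 1"
            using True e by simp
          then show ?thesis
            using True RR[OF True] unfolding f_def by (simp add: indicator_def del: mem_cball)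
        qed simp
      qed
      also have "\<dots> = real n * V * ?I"
        by (rule integral_mult_right_zero)
      finally have "T e / V - real n * (F e * (e \<bullet> h)) = real n * ((?I - F e * (R - 1)) + F e * (R - 1 - e \<bullet> h))"
        using V by (simp add: algebra_simps)
      then have "\<bar>T e / V - real n * (F e * (e \<bullet> h))\<bar> \<le> real n * (\<bar>?I - F e * (R - 1)\<bar> + \<bar>F e\<bar> * \<bar>R - 1 - e \<bullet> h\<bar>)"
        using abs_triangle_ineq[of "?I - F e * (R - 1)" "F e * (R - 1 - e \<bullet> h)"] n by (simp add: abs_mult)
      also have "\<dots> \<le> real n * (4 * C1 * (norm h)\<^sup>2 + B * (norm h)\<^sup>2)"
      proof (intro mult_left_mono add_mono mult_mono)
        have "\<bar>?I - F (1 *\<^sub>R e) * 1 ^ (n - 1) * (R - 1)\<bar> \<le> C1 * (R - 1)\<^sup>2"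
          by (rule interval_increment) (use R psi[OF e] in auto)
        also have "\<dots> \<le> C1 * (4 * (norm h)\<^sup>2)"
          using C1 power_mono[OF R(4), of 2] by (intro mult_left_mono) (auto simp: power_mult_distrib)
        finally show "\<bar>?I - F e * (R - 1)\<bar> \<le> 4 * C1 * (norm h)\<^sup>2"
          by simp
      qed (use FB[OF e] R B in auto)
      also have "\<dots> = C * (norm h)\<^sup>2"
        by (simp add: C_def algebra_simps)
      finally show ?thesis .
    qed
    have G_int: "integrable uniform_sphere (\<lambda>e. F e * (e \<bullet> h))"
    proof (rule integrable_uniform_sphere_bounded)
      fix e :: 'a assume e: "norm e = 1"
      show "norm (F e * (e \<bullet> h)) \<le> B * norm h"
        unfolding norm_mult using FB[OF e] Cauchy_Schwarz_ineq2[of e h] e B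
        by (intro mult_mono) auto
    qed measurable
    have "\<bar>(\<integral>v. F (h + v) \<partial>uniform_ball) - (\<integral>v. F v \<partial>uniform_ball) - real n * (\<integral>e. F e * (e \<bullet> h) \<partial>uniform_sphere)\<bar>
        = \<bar>\<integral>e. T e / V - real n * (F e * (e \<bullet> h)) \<partial>uniform_sphere\<bar>"
      unfolding J_diff using T_int G_int by simp
    also have "\<dots> \<le> (\<integral>e. C * (norm h)\<^sup>2 \<partial>(uniform_sphere :: 'a measure))"
    proof (rule integral_abs_bound[THEN order_trans], rule integral_mono_AE)
      show "AE e in uniform_sphere. \<bar>T e / V - real n * (F e * (e \<bullet> h))\<bar> \<le> C * (norm h)\<^sup>2"
        using AE_uniform_sphere T by (auto elim!: eventually_mono)
    qed (use T_int G_int in auto)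
    also have "\<dots> = C * (norm h)\<^sup>2"
      using uniform_sphere.prob_space[where 'a='a] by simp
    finally show "\<bar>(\<integral>v. F (h + v) \<partial>uniform_ball) - (\<integral>v. F v \<partial>uniform_ball)
        - real DIM('a) * (\<integral>e. F e * (e \<bullet> h) \<partial>uniform_sphere)\<bar> \<le> C * (norm h)\<^sup>2"
      by (simp add: n_def)
  qed
qed

definition ball_avg :: "('a::euclidean_space \<Rightarrow> real) \<Rightarrow> real \<Rightarrow> 'a \<Rightarrow> real" where
  "ball_avg F \<eta> x = (\<integral>v. F (x + \<eta> *\<^sub>R v) \<partial>uniform_ball)"

text \<open>The boundary-integral formula for the gradient of \<open>ball_avg F \<eta>\<close>. Up
  to the sign of the \<open>y\<close>-part it is also the mean of the estimator without noise and
  without \<open>\<delta>\<close>.\<close>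

definition ball_avg_grad :: "('a::euclidean_space \<Rightarrow> real) \<Rightarrow> real \<Rightarrow> 'a \<Rightarrow> 'a" where
  "ball_avg_grad F \<eta> x = (real DIM('a) / \<eta>) *\<^sub>R (\<integral>e. F (x + \<eta> *\<^sub>R e) *\<^sub>R e \<partial>uniform_sphere)"

context
  fixes F :: "'a::euclidean_space \<Rightarrow> real" and L :: real
  assumes F: "L-lipschitz_on UNIV F"
begin

lemma lipschitz_shift_bound: "\<bar>F (x + \<eta> *\<^sub>R v)\<bar> \<le> \<bar>F x\<bar> + L * \<bar>\<eta>\<bar>" if "norm v \<le> 1"
proof -
  have "\<bar>F (x + \<eta> *\<^sub>R v) - F x\<bar> \<le> L * norm (\<eta> *\<^sub>R v)"
    using lipschitz_bound[OF F, of "x + \<eta> *\<^sub>R v" x] by simp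
  also have "\<dots> \<le> L * \<bar>\<eta>\<bar>"
    using that lipschitz_on_nonneg[OF F] by (intro mult_left_mono) (auto simp: mult_left_le)
  finally show ?thesis by linarith
qed

lemma ball_avg_integrable: "integrable uniform_ball (\<lambda>v. F (x + \<eta> *\<^sub>R v))"
proof (rule uniform_ball.integrable_const_bound)
  show "AE v in uniform_ball. norm (F (x + \<eta> *\<^sub>R v)) \<le> \<bar>F x\<bar> + L * \<bar>\<eta>\<bar>"
    using AE_uniform_ball lipschitz_shift_bound by (auto elim!: eventually_mono)
  show "(\<lambda>v. F (x + \<eta> *\<^sub>R v)) \<in> borel_measurable uniform_ball"
    by (rule measurable_compose[OF _ lipschitz_measurable[OF F]]) measurable
qed

lemma ball_avg_grad_integrable: "integrable uniform_sphere (\<lambda>e. F (x + \<eta> *\<^sub>R e) *\<^sub>R e)"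
proof (rule integrable_uniform_sphere_bounded)
  fix e :: 'a assume "norm e = 1"
  then show "norm (F (x + \<eta> *\<^sub>R e) *\<^sub>R e) \<le> \<bar>F x\<bar> + L * \<bar>\<eta>\<bar>"
    using lipschitz_shift_bound[of e x \<eta>] by simp
next
  have "(\<lambda>e. F (x + \<eta> *\<^sub>R e)) \<in> borel_measurable borel"
    by (rule measurable_compose[OF _ lipschitz_measurable[OF F]]) measurable
  then show "(\<lambda>e. F (x + \<eta> *\<^sub>R e) *\<^sub>R e) \<in> borel_measurable borel"
    by measurable
qed

lemma ball_avg_grad_inner:
  "ball_avg_grad F \<eta> x \<bullet> v = (real DIM('a) / \<eta>) * (\<integral>e. F (x + \<eta> *\<^sub>R e) * (e \<bullet> v) \<partial>uniform_sphere)"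
  unfolding ball_avg_grad_def using integral_inner_left[of v uniform_sphere "\<lambda>e. F (x + \<eta> *\<^sub>R e) *\<^sub>R e"] ball_avg_grad_integrable
  by simp

lemma ball_avg_approx: "\<bar>ball_avg F \<eta> x - F x\<bar> \<le> L * \<bar>\<eta>\<bar>"
proof -
  have "ball_avg F \<eta> x - F x = (\<integral>v. F (x + \<eta> *\<^sub>R v) - F x \<partial>uniform_ball)"
    unfolding ball_avg_def using ball_avg_integrable uniform_ball.prob_space[where 'a='a] by simp
  then have "\<bar>ball_avg F \<eta> x - F x\<bar> = \<bar>\<integral>v. F (x + \<eta> *\<^sub>R v) - F x \<partial>uniform_ball\<bar>"
    by (simp only:)
  also have "\<dots> \<le> (\<integral>v. L * \<bar>\<eta>\<bar> \<partial>(uniform_ball :: 'a measure))"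
  proof (rule integral_abs_bound[THEN order_trans], rule integral_mono_AE)
    show "AE v in uniform_ball. \<bar>F (x + \<eta> *\<^sub>R v) - F x\<bar> \<le> L * \<bar>\<eta>\<bar>"
      using AE_uniform_ball
    proof eventually_elim
      fix v :: 'a assume "norm v \<le> 1"
      then have "L * norm (\<eta> *\<^sub>R v) \<le> L * \<bar>\<eta>\<bar>"
        using lipschitz_on_nonneg[OF F] by (intro mult_left_mono) (auto simp: mult_left_le)
      then show "\<bar>F (x + \<eta> *\<^sub>R v) - F x\<bar> \<le> L * \<bar>\<eta>\<bar>"
        using lipschitz_bound[OF F, of "x + \<eta> *\<^sub>R v" x] by simp
    qed
  qed (use ball_avg_integrable in auto)
  also have "\<dots> = L * \<bar>\<eta>\<bar>"
    using uniform_ball.prob_space[where 'a='a] by simp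
  finally show ?thesis .
qed

lemma ball_avg_lipschitz: "L-lipschitz_on UNIV (ball_avg F \<eta>)"
proof (rule lipschitz_onI)
  fix x y :: 'a
  have "ball_avg F \<eta> x - ball_avg F \<eta> y = (\<integral>v. F (x + \<eta> *\<^sub>R v) - F (y + \<eta> *\<^sub>R v) \<partial>uniform_ball)"
    unfolding ball_avg_def using ball_avg_integrable by simp
  then have "\<bar>ball_avg F \<eta> x - ball_avg F \<eta> y\<bar> = \<bar>\<integral>v. F (x + \<eta> *\<^sub>R v) - F (y + \<eta> *\<^sub>R v) \<partial>uniform_ball\<bar>"
    by (simp only:)
  also have "\<dots> \<le> (\<integral>v. L * norm (x - y) \<partial>(uniform_ball :: 'a measure))"
  proof (rule integral_abs_bound[THEN order_trans], rule integral_mono_AE)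
    show "AE v in uniform_ball. \<bar>F (x + \<eta> *\<^sub>R v) - F (y + \<eta> *\<^sub>R v)\<bar> \<le> L * norm (x - y)"
    proof (rule AE_I2)
      fix v
      show "\<bar>F (x + \<eta> *\<^sub>R v) - F (y + \<eta> *\<^sub>R v)\<bar> \<le> L * norm (x - y)"
        using lipschitz_bound[OF F, of "x + \<eta> *\<^sub>R v" "y + \<eta> *\<^sub>R v"] by simp
    qed
  qed (use ball_avg_integrable in auto)
  also have "\<dots> = L * norm (x - y)"
    using uniform_ball.prob_space[where 'a='a] by simp
  finally show "dist (ball_avg F \<eta> x) (ball_avg F \<eta> y) \<le> L * dist x y"
    by (simp add: dist_norm)
qed (rule lipschitz_on_nonneg[OF F])

lemma ball_avg_has_derivative:
  assumes \<eta>: "\<eta> > 0"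
  shows "(ball_avg F \<eta> has_derivative (\<lambda>v. ball_avg_grad F \<eta> x \<bullet> v)) (at x)"
proof -
  define G where "G v = F (x + \<eta> *\<^sub>R v)" for v
  have "(L * \<eta>)-lipschitz_on UNIV G"
  proof (rule lipschitz_onI)
    fix u v
    have "\<bar>G u - G v\<bar> \<le> L * norm (\<eta> *\<^sub>R (u - v))"
      using lipschitz_bound[OF F, of "x + \<eta> *\<^sub>R u" "x + \<eta> *\<^sub>R v"] by (simp add: G_def algebra_simps)
    then show "dist (G u) (G v) \<le> L * \<eta> * dist u v"
      using \<eta> by (simp add: dist_norm)
  qed (use \<eta> lipschitz_on_nonneg[OF F] in auto)
  then obtain C where C: "\<And>h. norm h \<le> 1 / 2 \<Longrightarrow>
    \<bar>(\<integral>v. G (h + v) \<partial>uniform_ball) - (\<integral>v. G v \<partial>uniform_ball) - real DIM('a) * (\<integral>e. G e * (e \<bullet> h) \<partial>uniform_sphere)\<bar>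
      \<le> C * (norm h)\<^sup>2"
    using ball_shift_estimate[of "L * \<eta>" G] by blast
  show ?thesis
  \<comment> \<open>After scaling the ball to radius \<open>1\<close>, the shift estimate holds for
    \<open>norm h \<le> 1 / 2\<close>, that is, within distance \<open>\<eta> / 2\<close> of
    \<open>x\<close>.\<close>
  proof (rule has_derivativeI_sandwich[where e = "\<eta> / 2" and H = "\<lambda>y. C / \<eta>\<^sup>2 * norm (y - x)"])
    show "0 < \<eta> / 2" using \<eta> by simp
    show "bounded_linear (\<lambda>v. ball_avg_grad F \<eta> x \<bullet> v)"
      by (rule bounded_linear_inner_right)
    show "((\<lambda>y. C / \<eta>\<^sup>2 * norm (y - x)) \<longlongrightarrow> 0) (at x)"
      by (rule tendsto_eq_intros refl | simp)+
    fix y assume y: "y \<noteq> x" "dist y x < \<eta> / 2"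
    define h where "h = (1 / \<eta>) *\<^sub>R (y - x)"
    have yx: "y - x = \<eta> *\<^sub>R h" "y = x + \<eta> *\<^sub>R h"
      using \<eta> by (simp_all add: h_def)
    have "norm h \<le> 1 / 2"
      using y \<eta> unfolding h_def norm_scaleR by (simp add: dist_norm field_simps)
    from C[OF this] have "\<bar>ball_avg F \<eta> y - ball_avg F \<eta> x - ball_avg_grad F \<eta> x \<bullet> (y - x)\<bar> \<le> C * (norm h)\<^sup>2"
      unfolding ball_avg_def ball_avg_grad_inner G_def yx using \<eta> by (simp add: algebra_simps)
    also have "\<dots> = C / \<eta>\<^sup>2 * norm (y - x) * norm (y - x)"
      using \<eta> unfolding h_def norm_scaleR by (simp add: power2_eq_square field_simps)
    finally show "norm (ball_avg F \<eta> y - ball_avg F \<eta> x - ball_avg_grad F \<eta> x \<bullet> (y - x)) / norm (y - x) \<le> C / \<eta>\<^sup>2 * norm (y - x)"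
      using y by (simp add: divide_le_eq)
  qed
qed

end

section \<open>Fourth moments of odd Lipschitz functions on the sphere\<close>

lemma norm_gradient_le_lipschitz:
  fixes f :: "'a::euclidean_space \<Rightarrow> real"
  assumes f: "L-lipschitz_on UNIV f" and d: "(f has_derivative (\<lambda>v. D \<bullet> v)) (at x)"
  shows "norm D \<le> L"
proof (cases "D = 0")
  case False
  have "((\<lambda>t. f (x + t *\<^sub>R D)) has_derivative (\<lambda>t. D \<bullet> (t *\<^sub>R D))) (at 0)"
    by (rule has_derivative_compose[of "\<lambda>t. x + t *\<^sub>R D" "\<lambda>t. t *\<^sub>R D" 0 UNIV f "\<lambda>v. D \<bullet> v"])
       (use d in \<open>auto intro!: derivative_eq_intros\<close>)
  moreover have "(\<lambda>t. D \<bullet> (t *\<^sub>R D)) = (*) (D \<bullet> D)"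
    by auto
  ultimately have "((\<lambda>t. f (x + t *\<^sub>R D)) has_real_derivative (D \<bullet> D)) (at 0)"
    by (simp add: has_field_derivative_def)
  then have lim: "((\<lambda>t. (f (x + t *\<^sub>R D) - f x) / t) \<longlongrightarrow> D \<bullet> D) (at 0)"
    by (simp add: DERIV_def)
  have "D \<bullet> D \<le> L * norm D"
  proof (rule tendsto_upperbound[OF lim])
    have "(f (x + t *\<^sub>R D) - f x) / t \<le> L * norm D" if "t \<noteq> 0" for t
    proof -
      have "\<bar>f (x + t *\<^sub>R D) - f x\<bar> / \<bar>t\<bar> \<le> L * norm D"
        using lipschitz_bound[OF f, of "x + t *\<^sub>R D" x] that by (simp add: field_simps)
      then show ?thesis
        by (metis abs_divide abs_le_D1)
    qed
    then show "\<forall>\<^sub>F t in at 0. (f (x + t *\<^sub>R D) - f x) / t \<le> L * norm D"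
      by (auto simp: eventually_at_filter)
  qed simp
  then have "norm D * norm D \<le> L * norm D"
    by (simp add: dot_square_norm power2_eq_square)
  then show ?thesis
    using False by simp
qed (use lipschitz_on_nonneg[OF f] in simp)

text \<open>Multiplying by the absolute value squares the size and keeps the sign, so oddness
  survives; unlike the absolute value alone, the result is differentiable at \<open>0\<close>
  too.\<close>

lemma has_real_derivative_mult_abs: "((\<lambda>t::real. t * \<bar>t\<bar>) has_real_derivative 2 * \<bar>t\<bar>) (at t)"
proof (cases t "0::real" rule: linorder_cases)
  case less
  have "((\<lambda>t::real. t * - t) has_real_derivative 2 * \<bar>t\<bar>) (at t)"
    using less by (auto intro!: derivative_eq_intros)
  then show ?thesis
    by (rule has_field_derivative_transform_within_open[where S = "{..<0}"]) (use less in auto)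
next
  case equal
  have "((\<lambda>h::real. h * \<bar>h\<bar> / h) \<longlongrightarrow> 0) (at 0)"
  proof (rule Lim_transform_eventually)
    show "((\<lambda>h::real. \<bar>h\<bar>) \<longlongrightarrow> 0) (at 0)"
      by (rule tendsto_eq_intros refl | simp)+
    have "\<bar>h\<bar> = h * \<bar>h\<bar> / h" for h :: real
      by (cases "h = 0") auto
    then show "\<forall>\<^sub>F h in at 0. \<bar>h\<bar> = h * \<bar>h\<bar> / (h::real)"
      by (intro always_eventually) blast
  qed
  then show ?thesis
    using equal by (simp add: DERIV_def)
next
  case greater
  have "((\<lambda>t::real. t * t) has_real_derivative 2 * \<bar>t\<bar>) (at t)"
    using greater by (auto intro!: derivative_eq_intros)
  then show ?thesis
    by (rule has_field_derivative_transform_within_open[where S = "{0<..}"]) (use greater in auto)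
qed

text \<open>The odd Poincare inequality is used twice: for \<open>G\<close>, and for \<open>G * \<bar>G\<bar>\<close>, which is again odd,
  has square \<open>G ^ 4\<close>, and has a gradient of norm at most \<open>2 * K * \<bar>G\<bar>\<close>.\<close>

lemma sphere_fourth_moment_smooth:
  fixes G :: "'a::euclidean_space \<Rightarrow> real"
  assumes G: "K-lipschitz_on UNIV G" and odd: "\<And>x. G (- x) = - G x"
    and deriv: "\<And>x. (G has_derivative (\<lambda>v. D x \<bullet> v)) (at x)"
    and n: "DIM('a) \<ge> 2"
  shows "(\<integral>e. (G e) ^ 4 \<partial>uniform_sphere) \<le> 4 * K ^ 4 / (real DIM('a) - 1)\<^sup>2"
proof -
  define m where "m = real DIM('a) - 1"
  have m: "m > 0" using n by (simp add: m_def)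
  have [measurable]: "G \<in> borel_measurable borel"
    by (rule lipschitz_measurable[OF G])
  have K: "K \<ge> 0"
    by (rule lipschitz_on_nonneg[OF G])
  have D: "norm (D x) \<le> K" for x
    by (rule norm_gradient_le_lipschitz[OF G deriv])
  have GK: "\<bar>G e\<bar> \<le> K" if "norm e = 1" for e
  proof -
    have "e - - e = 2 *\<^sub>R e"
      by (simp add: scaleR_2)
    then show ?thesis
      using lipschitz_bound[OF G, of e "- e"] odd[of e] that by simp
  qed
  have 1: "ennreal m * (\<integral>\<^sup>+e. ennreal ((G e)\<^sup>2) \<partial>uniform_sphere) \<le> (\<integral>\<^sup>+(e::'a). ennreal (K\<^sup>2) \<partial>uniform_sphere)"
    unfolding m_def
    by (rule sphere_odd_poincare[where L = K and D = D])
       (use odd lipschitz_bound[OF G] deriv D in \<open>auto intro: power_mono\<close>)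
  have 2: "ennreal m * (\<integral>\<^sup>+e. ennreal ((G e * \<bar>G e\<bar>)\<^sup>2) \<partial>uniform_sphere)
      \<le> (\<integral>\<^sup>+e. ennreal (4 * K\<^sup>2 * (G e)\<^sup>2) \<partial>uniform_sphere)"
    unfolding m_def
  proof (rule sphere_odd_poincare[where L = "2 * K\<^sup>2" and D = "\<lambda>x. (2 * \<bar>G x\<bar>) *\<^sub>R D x"])
    fix x :: 'a
    show "G (- x) * \<bar>G (- x)\<bar> = - (G x * \<bar>G x\<bar>)"
      by (simp add: odd)
    have "((\<lambda>y. G y * \<bar>G y\<bar>) has_derivative (\<lambda>v. (2 * \<bar>G x\<bar>) * (D x \<bullet> v))) (at x)"
      using has_derivative_compose[OF deriv[of x] has_real_derivative_mult_abs[of "G x", unfolded has_field_derivative_def]]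
      by simp
    then show "((\<lambda>y. G y * \<bar>G y\<bar>) has_derivative (\<lambda>v. (2 * \<bar>G x\<bar>) *\<^sub>R D x \<bullet> v)) (at x)"
      by simp
    have "(2 * \<bar>G x\<bar> * norm (D x))\<^sup>2 \<le> (2 * \<bar>G x\<bar> * K)\<^sup>2"
      using D[of x] by (intro power_mono mult_left_mono) auto
    then show "(norm ((2 * \<bar>G x\<bar>) *\<^sub>R D x))\<^sup>2 \<le> 4 * K\<^sup>2 * (G x)\<^sup>2"
      by (simp add: power_mult_distrib mult_ac)
    fix y :: 'a
    assume x: "norm x = 1" and y: "norm y = 1"
    have "G x * \<bar>G x\<bar> - G y * \<bar>G y\<bar> = (G x - G y) * \<bar>G x\<bar> + G y * (\<bar>G x\<bar> - \<bar>G y\<bar>)"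
      by (simp add: algebra_simps)
    then have "\<bar>G x * \<bar>G x\<bar> - G y * \<bar>G y\<bar>\<bar> \<le> \<bar>G x - G y\<bar> * \<bar>G x\<bar> + \<bar>G y\<bar> * \<bar>\<bar>G x\<bar> - \<bar>G y\<bar>\<bar>"
      using abs_triangle_ineq[of "(G x - G y) * \<bar>G x\<bar>" "G y * (\<bar>G x\<bar> - \<bar>G y\<bar>)"] by (simp add: abs_mult)
    also have "\<dots> \<le> \<bar>G x - G y\<bar> * K + K * \<bar>G x - G y\<bar>"
      using GK[OF x] GK[OF y] K by (intro add_mono mult_mono) auto
    also have "\<dots> \<le> (K * norm (x - y)) * K + K * (K * norm (x - y))"
      using lipschitz_bound[OF G, of x y] K by (intro add_mono mult_mono) auto
    finally show "\<bar>G x * \<bar>G x\<bar> - G y * \<bar>G y\<bar>\<bar> \<le> 2 * K\<^sup>2 * norm (x - y)"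
      by (simp add: power2_eq_square mult_ac)
  qed measurable
  define I2 where "I2 = (\<integral>e. (G e)\<^sup>2 \<partial>uniform_sphere)"
  define I4 where "I4 = (\<integral>e. (G e) ^ 4 \<partial>uniform_sphere)"
  have i2: "(\<integral>\<^sup>+e. ennreal ((G e)\<^sup>2) \<partial>uniform_sphere) = ennreal I2"
    unfolding I2_def
    by (intro nn_integral_eq_integral integrable_uniform_sphere_bounded[where B = "K\<^sup>2"])
       (use GK K in \<open>auto simp: power2_le_iff_abs_le\<close>)
  have "\<bar>G e\<bar> ^ 4 \<le> K ^ 4" if "norm e = 1" for e
    using GK[OF that] by (intro power_mono) auto
  then have int4: "integrable uniform_sphere (\<lambda>e. (G e) ^ 4)"
    by (intro integrable_uniform_sphere_bounded[where B = "K ^ 4"]) (auto simp: power_abs)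
  have "(G e * \<bar>G e\<bar>)\<^sup>2 = (G e) ^ 4" for e
    by (simp add: power_mult_distrib power_add[symmetric])
  with int4 have i4: "(\<integral>\<^sup>+e. ennreal ((G e * \<bar>G e\<bar>)\<^sup>2) \<partial>uniform_sphere) = ennreal I4"
    unfolding I4_def by (simp add: nn_integral_eq_integral)
  have I2: "0 \<le> I2" and I4: "0 \<le> I4"
    by (auto simp: I2_def I4_def)
  have "ennreal (m * I2) \<le> ennreal (K\<^sup>2)"
    using 1 uniform_sphere.emeasure_space_1[where 'a='a] m by (simp add: i2 ennreal_mult I2)
  then have A: "m * I2 \<le> K\<^sup>2"
    by simp
  have "(\<integral>\<^sup>+e. ennreal (4 * K\<^sup>2 * (G e)\<^sup>2) \<partial>uniform_sphere) = ennreal (4 * K\<^sup>2) * ennreal I2"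
    unfolding i2[symmetric] by (subst nn_integral_cmult[symmetric]) (auto simp: ennreal_mult)
  then have "ennreal (m * I4) \<le> ennreal (4 * K\<^sup>2 * I2)"
    using 2 m by (simp add: i4 ennreal_mult I2 I4)
  then have B: "m * I4 \<le> 4 * K\<^sup>2 * I2"
    using I2 by simp
  have "m\<^sup>2 * I4 = m * (m * I4)"
    by (simp add: power2_eq_square)
  also have "\<dots> \<le> m * (4 * K\<^sup>2 * I2)"
    using B m by (intro mult_left_mono) auto
  also have "\<dots> = 4 * K\<^sup>2 * (m * I2)"
    by simp
  also have "\<dots> \<le> 4 * K\<^sup>2 * K\<^sup>2"
    by (intro mult_left_mono A) auto
  finally show ?thesis
    using m unfolding m_def[symmetric] I4_def[symmetric] by (simp add: field_simps power4_eq_xxxx power2_eq_square)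
qed

text \<open>Ball averages with radius tending to \<open>0\<close> remove the differentiability
  hypothesis. Their antisymmetric parts are \<open>2 * L\<close>-Lipschitz, which gives
  \<open>64 * L ^ 4 / (n - 1)\<^sup>2\<close> with \<open>n = DIM('a)\<close>; this is at most
  \<open>144 * L ^ 4 / n\<^sup>2\<close> precisely because \<open>2 * n \<le> 3 * (n - 1)\<close>
  for \<open>n \<ge> 3\<close>.\<close>

lemma sphere_fourth_moment:
  fixes F :: "'a::euclidean_space \<Rightarrow> real"
  assumes F: "L-lipschitz_on UNIV F" and n: "DIM('a) \<ge> 3"
  shows "(\<integral>e. (F e - F (- e)) ^ 4 \<partial>uniform_sphere) \<le> 144 * L ^ 4 / (real DIM('a))\<^sup>2"
proof -
  have [measurable]: "F \<in> borel_measurable borel"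
    by (rule lipschitz_measurable[OF F])
  have L: "L \<ge> 0"
    by (rule lipschitz_on_nonneg[OF F])
  define \<eta> where "\<eta> k = 1 / real (Suc k)" for k
  have \<eta>: "\<eta> k > 0" for k
    by (simp add: \<eta>_def)
  have \<eta>0: "\<eta> \<longlonglongrightarrow> 0"
    unfolding \<eta>_def by real_asymp
  define f where "f k = ball_avg F (\<eta> k)" for k
  have f_lip: "L-lipschitz_on UNIV (f k)" for k
    unfolding f_def by (rule ball_avg_lipschitz[OF F])
  have [measurable]: "f k \<in> borel_measurable borel" for k
    by (rule lipschitz_measurable[OF f_lip])
  have f_lim: "(\<lambda>k. f k x) \<longlonglongrightarrow> F x" for x
  proof (rule LIM_zero_cancel, rule Lim_null_comparison)
    show "\<forall>\<^sub>F k in sequentially. norm (f k x - F x) \<le> L * \<eta> k"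
      using ball_avg_approx[OF F, of "\<eta> _" x] \<eta> by (intro always_eventually) (simp add: f_def abs_of_pos)
    show "(\<lambda>k. L * \<eta> k) \<longlonglongrightarrow> 0"
      using tendsto_mult_right_zero[OF \<eta>0] by simp
  qed
  have bnd: "(f k e - f k (- e)) ^ 4 \<le> (2 * L) ^ 4" if "norm e = 1" for k e
  proof -
    have "e - - e = 2 *\<^sub>R e"
      by (simp add: scaleR_2)
    then have "\<bar>f k e - f k (- e)\<bar> \<le> 2 * L"
      using lipschitz_bound[OF f_lip[of k], of e "- e"] that by simp
    then have "\<bar>f k e - f k (- e)\<bar> ^ 4 \<le> (2 * L) ^ 4"
      by (intro power_mono) auto
    then show ?thesis by simp
  qed
  have lim: "(\<lambda>k. \<integral>e. (f k e - f k (- e)) ^ 4 \<partial>uniform_sphere) \<longlonglongrightarrow> (\<integral>e. (F e - F (- e)) ^ 4 \<partial>uniform_sphere)"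
  proof (rule integral_dominated_convergence[where w = "\<lambda>_. (2 * L) ^ 4"])
    show "AE e in uniform_sphere. (\<lambda>k. (f k e - f k (- e)) ^ 4) \<longlonglongrightarrow> (F e - F (- e)) ^ 4"
      by (intro AE_I2 tendsto_intros f_lim)
    show "AE e in uniform_sphere. norm ((f k e - f k (- e)) ^ 4) \<le> (2 * L) ^ 4" for k
      using AE_uniform_sphere bnd by (auto elim!: eventually_mono)
  qed auto
  have "(\<integral>e. (f k e - f k (- e)) ^ 4 \<partial>uniform_sphere) \<le> 4 * (2 * L) ^ 4 / (real DIM('a) - 1)\<^sup>2" for k
  proof (rule sphere_fourth_moment_smooth)
    show "(2 * L)-lipschitz_on UNIV (\<lambda>x. f k x - f k (- x))"
    proof (rule lipschitz_onI)
      fix x y :: 'a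
      have "\<bar>(f k x - f k (- x)) - (f k y - f k (- y))\<bar> \<le> \<bar>f k x - f k y\<bar> + \<bar>f k (- x) - f k (- y)\<bar>"
        by linarith
      also have "\<dots> \<le> L * norm (x - y) + L * norm (- x - - y)"
        by (intro add_mono lipschitz_bound[OF f_lip])
      also have "norm (- x - - y) = norm (x - y)"
        by (metis minus_diff_eq minus_diff_minus norm_minus_cancel)
      finally show "dist (f k x - f k (- x)) (f k y - f k (- y)) \<le> 2 * L * dist x y"
        by (simp add: dist_norm)
    qed (use L in simp)
    fix x :: 'a
    let ?D = "ball_avg_grad F (\<eta> k)"
    have d: "(f k has_derivative (\<lambda>v. ?D x \<bullet> v)) (at x)" for x
      unfolding f_def by (rule ball_avg_has_derivative[OF F \<eta>])
    have "((\<lambda>x. f k (- x)) has_derivative (\<lambda>v. ?D (- x) \<bullet> (- v))) (at x)"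
      by (rule has_derivative_compose[of uminus "\<lambda>v. - v" x UNIV "f k" "\<lambda>v. ?D (- x) \<bullet> v"])
         (auto intro!: derivative_eq_intros d)
    from has_derivative_diff[OF d this]
    show "((\<lambda>x. f k x - f k (- x)) has_derivative (\<lambda>v. (?D x + ?D (- x)) \<bullet> v)) (at x)"
      by (simp add: inner_add_left)
  qed (use n in auto)
  then have "(\<integral>e. (F e - F (- e)) ^ 4 \<partial>uniform_sphere) \<le> 4 * (2 * L) ^ 4 / (real DIM('a) - 1)\<^sup>2"
    by (intro LIMSEQ_le_const2[OF lim]) auto
  also have "\<dots> \<le> 144 * L ^ 4 / (real DIM('a))\<^sup>2"
  proof -
    have "(2 * real DIM('a))\<^sup>2 \<le> (3 * (real DIM('a) - 1))\<^sup>2"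
      using n by (intro power_mono) auto
    then have "4 * (real DIM('a))\<^sup>2 \<le> 9 * (real DIM('a) - 1)\<^sup>2"
      unfolding power_mult_distrib by simp
    then have "16 * L ^ 4 * (4 * (real DIM('a))\<^sup>2) \<le> 16 * L ^ 4 * (9 * (real DIM('a) - 1)\<^sup>2)"
      by (intro mult_left_mono) auto
    then show ?thesis
      using n by (simp add: field_simps)
  qed
  finally show ?thesis .
qed

subsection \<open>Hoelder duality and moments of \<open>p\<close>-norms on the sphere\<close>

lemma p_norm_nonneg [simp]: "0 \<le> p_norm p v"
  by (simp add: p_norm_def)

lemma p_norm_measurable [measurable]: "p_norm p \<in> borel_measurable borel"
  unfolding p_norm_def[abs_def] by measurable

lemma p_norm_powr:
  "p \<noteq> 0 \<Longrightarrow> p_norm p v powr p = (\<Sum>b\<in>Basis. \<bar>v \<bullet> b\<bar> powr p)"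
  by (simp add: p_norm_def powr_powr sum_nonneg)

lemma p_norm_cong_abs:
  "(\<And>b. b \<in> Basis \<Longrightarrow> \<bar>v \<bullet> b\<bar> = \<bar>w \<bullet> b\<bar>) \<Longrightarrow> p_norm p v = p_norm p w"
  unfolding p_norm_def by simp

lemma p_norm_pos:
  assumes "p > 0" "v \<noteq> 0"
  shows "p_norm p v > 0"
proof -
  obtain b where b: "b \<in> Basis" "v \<bullet> b \<noteq> 0"
    using assms(2) euclidean_all_zero_iff by blast
  have "0 < \<bar>v \<bullet> b\<bar> powr p"
    using b by simp
  also have "\<dots> \<le> (\<Sum>b\<in>Basis. \<bar>v \<bullet> b\<bar> powr p)"
    by (rule member_le_sum) (use b in auto)
  finally show ?thesis
    by (simp add: p_norm_def)
qed

lemma p_norm_minus_commute: "p_norm p (v - w) = p_norm p (w - v)"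
  by (rule p_norm_cong_abs) (simp add: inner_diff_left abs_minus_commute)

lemma Hoelder_sum:
  fixes x y :: "'b \<Rightarrow> real"
  assumes "finite A" and r: "r > 1" "s > 1" "1 / r + 1 / s = 1"
    and x: "\<And>i. i \<in> A \<Longrightarrow> 0 \<le> x i" and y: "\<And>i. i \<in> A \<Longrightarrow> 0 \<le> y i"
  shows "(\<Sum>i\<in>A. x i * y i) \<le> (\<Sum>i\<in>A. x i powr r) powr (1 / r) * (\<Sum>i\<in>A. y i powr s) powr (1 / s)"
proof -
  define X where "X = (\<Sum>i\<in>A. x i powr r)"
  define Y where "Y = (\<Sum>i\<in>A. y i powr s)"
  have XY: "X \<ge> 0" "Y \<ge> 0"
    by (auto simp: X_def Y_def sum_nonneg)
  show ?thesis
  proof (cases "X = 0 \<or> Y = 0")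
    case True
    then have "x i * y i = 0" if "i \<in> A" for i
      using that assms(1) unfolding X_def Y_def by (auto simp: sum_nonneg_eq_0_iff)
    then have "(\<Sum>i\<in>A. x i * y i) = 0"
      by (intro sum.neutral) auto
    then show ?thesis
      by simp
  next
    case False
    then have X: "X > 0" and Y: "Y > 0"
      using XY by auto
    define X' where "X' = X powr (1 / r)"
    define Y' where "Y' = Y powr (1 / s)"
    have X': "X' > 0" "X' powr r = X" and Y': "Y' > 0" "Y' powr s = Y"
      using X Y r by (auto simp: X'_def Y'_def powr_powr)
    have "(\<Sum>i\<in>A. (x i / X') * (y i / Y')) \<le> (\<Sum>i\<in>A. (x i / X') powr r / r + (y i / Y') powr s / s)"
      using x y X' Y' r by (intro sum_mono Youngs_inequality) auto
    also have "\<dots> = (\<Sum>i\<in>A. x i powr r / X / r + y i powr s / Y / s)"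
      using x y X' Y' by (intro sum.cong) (auto simp: powr_divide)
    also have "\<dots> = X / X / r + Y / Y / s"
      by (simp add: sum.distrib sum_divide_distrib[symmetric] X_def Y_def)
    also have "\<dots> = 1"
      using X Y r by simp
    finally have "(\<Sum>i\<in>A. x i * y i) / (X' * Y') \<le> 1"
      by (simp add: sum_divide_distrib)
    then show ?thesis
      using X' Y' by (simp add: X'_def Y'_def X_def Y_def divide_le_eq)
  qed
qed

lemma inner_le_p_norm:
  fixes v u :: "'a::euclidean_space"
  assumes "r > 1" "s > 1" "1 / r + 1 / s = 1"
  shows "\<bar>v \<bullet> u\<bar> \<le> p_norm r v * p_norm s u"
proof -
  have "\<bar>v \<bullet> u\<bar> = \<bar>\<Sum>b\<in>Basis. (v \<bullet> b) * (u \<bullet> b)\<bar>"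
    by (subst euclidean_inner) simp
  also have "\<dots> \<le> (\<Sum>b\<in>Basis. \<bar>v \<bullet> b\<bar> * \<bar>u \<bullet> b\<bar>)"
    using sum_abs[of "\<lambda>b. (v \<bullet> b) * (u \<bullet> b)" Basis] by (simp add: abs_mult)
  also have "\<dots> \<le> p_norm r v * p_norm s u"
    unfolding p_norm_def by (rule Hoelder_sum) (use assms in auto)
  finally show ?thesis .
qed

lemma p_norm_compare:
  fixes u :: "'a::euclidean_space"
  assumes p: "p \<ge> 1" and s: "s > 1"
  shows "p_norm s u \<le> real DIM('a) powr (max 0 (1 / s - 1 / p)) * p_norm p u"
proof (cases "p \<le> s")
  case True
  define N where "N = p_norm p u"
  have N: "N \<ge> 0" by (simp add: N_def)
  have "\<bar>u \<bullet> b\<bar> \<le> N" if b: "b \<in> Basis" for b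
  proof -
    have "\<bar>u \<bullet> b\<bar> powr p \<le> (\<Sum>b\<in>Basis. \<bar>u \<bullet> b\<bar> powr p)"
      by (rule member_le_sum) (use b in auto)
    then have "(\<bar>u \<bullet> b\<bar> powr p) powr (1 / p) \<le> N"
      unfolding N_def p_norm_def using p by (intro powr_mono2) auto
    then show ?thesis
      using p by (simp add: powr_powr)
  qed
  then have "\<bar>u \<bullet> b\<bar> powr s \<le> N powr (s - p) * \<bar>u \<bullet> b\<bar> powr p" if "b \<in> Basis" for b
    using True that by (simp add: powr_add[of _ "s - p" p, simplified] powr_mono2 mult_right_mono)
  then have "(\<Sum>b\<in>Basis. \<bar>u \<bullet> b\<bar> powr s) \<le> N powr (s - p) * (\<Sum>b\<in>Basis. \<bar>u \<bullet> b\<bar> powr p)"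
    by (subst sum_distrib_left) (intro sum_mono)
  also have "\<dots> = N powr (s - p) * N powr p"
    unfolding N_def using p by (subst p_norm_powr) auto
  also have "\<dots> = N powr s"
    by (simp add: powr_add[symmetric])
  finally have "p_norm s u \<le> (N powr s) powr (1 / s)"
    unfolding p_norm_def[of s] using s by (intro powr_mono2) (auto simp: sum_nonneg)
  also have "\<dots> = N"
    using s N by (simp add: powr_powr)
  finally show ?thesis
    using True p s by (simp add: N_def max_def field_simps)
next
  case False
  let ?n = "real DIM('a)"
  define k where "k = p / s"
  have k: "k > 1" "s * k = p"
    using False s by (auto simp: k_def)
  define l where "l = k / (k - 1)"
  have l: "l > 1" "1 / k + 1 / l = 1"
    using k by (auto simp: l_def field_simps)
  have "(\<Sum>b\<in>Basis. \<bar>u \<bullet> b\<bar> powr s * 1) \<le> (\<Sum>b\<in>Basis. (\<bar>u \<bullet> b\<bar> powr s) powr k) powr (1 / k) * (\<Sum>b\<in>(Basis::'a set). 1 powr l) powr (1 / l)"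
    by (rule Hoelder_sum) (use k l in auto)
  then have "(\<Sum>b\<in>Basis. \<bar>u \<bullet> b\<bar> powr s) \<le> (\<Sum>b\<in>Basis. \<bar>u \<bullet> b\<bar> powr p) powr (1 / k) * ?n powr (1 / l)"
    by (simp add: powr_powr k)
  then have "p_norm s u \<le> ((\<Sum>b\<in>Basis. \<bar>u \<bullet> b\<bar> powr p) powr (1 / k) * ?n powr (1 / l)) powr (1 / s)"
    unfolding p_norm_def[of s] using s by (intro powr_mono2) (auto simp: sum_nonneg)
  also have "\<dots> = p_norm p u * ?n powr (1 / l * (1 / s))"
    unfolding p_norm_def using s k by (simp add: powr_mult powr_powr sum_nonneg mult.commute)
  also have "1 / l * (1 / s) = 1 / s - 1 / p"
  proof -
    have "1 / l = 1 - 1 / k"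
      using l by simp
    then show ?thesis
      using k s p by (simp add: k_def field_simps)
  qed
  also have "\<dots> = max 0 (1 / s - 1 / p)"
    using False p s by (simp add: max_def field_simps)
  finally show ?thesis
    by (simp add: mult.commute)
qed

text \<open>A concave power lies below its tangent at \<open>c\<close>. Used as Jensen's inequality
  in pointwise form: if the mean of \<open>t\<close> is at most \<open>c\<close>, integrating the
  tangent bounds the mean of \<open>t powr a\<close> by \<open>c powr a\<close>.\<close>

lemma powr_le_tangent:
  fixes t c a :: real
  assumes "0 \<le> t" "0 < c" "0 \<le> a" "a \<le> 1"
  shows "t powr a \<le> c powr a * (1 - a) + c powr a * a / c * t"
proof (cases "t = 0")
  case False
  then have "t powr a * c powr (1 - a) \<le> a * t + (1 - a) * c"
    using assms by (intro Youngs_inequality_0) auto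
  moreover have "c powr (1 - a) = c / c powr a"
    using assms by (simp add: powr_diff)
  ultimately have "t powr a * c \<le> (a * t + (1 - a) * c) * c powr a"
    using assms by (simp add: field_simps)
  then show ?thesis
    using assms by (simp add: field_simps)
qed (use assms in simp)

text \<open>The fourth power of the norm is \<open>T e powr (2 / m)\<close>, where \<open>T\<close>
  is a sum of even coordinate moments. The exponent \<open>2 / m\<close> is at most \<open>1\<close>
  because \<open>m \<ge> 2\<close>, so Jensen reduces everything to the mean of
  \<open>T\<close>.\<close>

lemma sphere_p_norm_fourth_moment:
  assumes m: "m \<ge> 2"
  shows "(\<integral>\<^sup>+e. ennreal (p_norm (2 * real m) (e::'a::euclidean_space) ^ 4) \<partial>uniform_sphere)
    \<le> ennreal ((2 * real m - 1)\<^sup>2 * real DIM('a) powr (2 / real m - 2))"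
proof -
  define n where "n = real DIM('a)"
  have n: "n > 0" by (simp add: n_def)
  define T where "T e = (\<Sum>b\<in>Basis. (e \<bullet> b) ^ (2 * m))" for e :: 'a
  have [measurable]: "T \<in> borel_measurable borel"
    unfolding T_def[abs_def] by measurable
  have T: "0 \<le> T e" for e
    by (simp add: T_def sum_nonneg)
  define a where "a = 2 / real m"
  have a: "0 \<le> a" "a \<le> 1"
    using m by (auto simp: a_def)
  define c where "c = n * ((2 * real m - 1) / n) ^ m"
  have c: "c > 0"
    using n m by (simp add: c_def)
  have "\<bar>x\<bar> powr (2 * real m) = x ^ (2 * m)" for x :: real
    using powr_realpow'[of "\<bar>x\<bar>" "2 * m"] m by (simp add: power_even_abs)
  then have "p_norm (2 * real m) e = T e powr (1 / (2 * real m))" for e :: 'a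
    by (simp add: p_norm_def T_def)
  then have eq: "p_norm (2 * real m) e ^ 4 = T e powr a" for e :: 'a
    using m by (simp add: power4_eq_xxxx powr_add[symmetric] a_def)
  have ET: "(\<integral>\<^sup>+e. ennreal (T e) \<partial>uniform_sphere) \<le> ennreal c"
  proof -
    have "(\<integral>\<^sup>+e. ennreal (T e) \<partial>uniform_sphere) = (\<integral>\<^sup>+e. (\<Sum>b\<in>Basis. ennreal ((e \<bullet> b) ^ (2 * m))) \<partial>(uniform_sphere :: 'a measure))"
      unfolding T_def by (subst sum_ennreal) auto
    also have "\<dots> = (\<Sum>b\<in>Basis. \<integral>\<^sup>+e. ennreal ((e \<bullet> b) ^ (2 * m)) \<partial>(uniform_sphere :: 'a measure))"
      by (rule nn_integral_sum) measurable
    also have "\<dots> \<le> (\<Sum>b\<in>(Basis :: 'a set). ennreal (((2 * real m - 1) / n) ^ m))"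
      unfolding n_def using m by (intro sum_mono uniform_sphere_moment_le) auto
    also have "\<dots> = ennreal c"
      using m n by (subst sum_ennreal) (auto simp: c_def n_def)
    finally show ?thesis .
  qed
  have "(\<integral>\<^sup>+e. ennreal (p_norm (2 * real m) (e::'a) ^ 4) \<partial>uniform_sphere)
      \<le> (\<integral>\<^sup>+e. ennreal (c powr a * (1 - a)) + ennreal (c powr a * a / c) * ennreal (T e) \<partial>uniform_sphere)"
  proof (rule nn_integral_mono)
    fix e :: 'a
    have "ennreal (p_norm (2 * real m) e ^ 4) \<le> ennreal (c powr a * (1 - a) + c powr a * a / c * T e)"
      unfolding eq by (intro ennreal_leI powr_le_tangent T c a)
    also have "\<dots> = ennreal (c powr a * (1 - a)) + ennreal (c powr a * a / c) * ennreal (T e)"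
      using a c T by (subst ennreal_plus) (auto simp: ennreal_mult[symmetric])
    finally show "ennreal (p_norm (2 * real m) e ^ 4)
      \<le> ennreal (c powr a * (1 - a)) + ennreal (c powr a * a / c) * ennreal (T e)" .
  qed
  also have "\<dots> = ennreal (c powr a * (1 - a)) + ennreal (c powr a * a / c) * (\<integral>\<^sup>+e. ennreal (T e) \<partial>uniform_sphere)"
    using uniform_sphere.emeasure_space_1[where 'a='a] by (subst nn_integral_add) (auto simp: nn_integral_cmult)
  also have "\<dots> \<le> ennreal (c powr a * (1 - a)) + ennreal (c powr a * a / c) * ennreal c"
    by (intro add_left_mono mult_left_mono ET) auto
  also have "\<dots> = ennreal (c powr a * (1 - a) + c powr a * a / c * c)"
    using a c by (subst ennreal_plus) (auto simp: ennreal_mult[symmetric])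
  also have "c powr a * (1 - a) + c powr a * a / c * c = c powr a"
    using c by (simp add: algebra_simps)
  also have "c powr a = n powr a * ((2 * real m - 1) / n) ^ 2"
  proof -
    have "(((2 * real m - 1) / n) ^ m) powr a = ((2 * real m - 1) / n) powr (real m * a)"
      using m n by (simp add: powr_realpow[symmetric] powr_powr)
    also have "real m * a = 2"
      using m by (simp add: a_def)
    finally show ?thesis
      using m n by (simp add: c_def powr_mult)
  qed
  also have "\<dots> = (2 * real m - 1)\<^sup>2 * n powr (2 / real m - 2)"
    using n by (simp add: a_def powr_diff power_divide)
  finally show ?thesis
    by (simp add: n_def)
qed

text \<open>The argument \<open>iq\<close> stands for \<open>1 / q\<close>, so that \<open>iq = 0\<close> means \<open>q = \<infinity>\<close>.\<close>

definition a_factor :: "real \<Rightarrow> nat \<Rightarrow> real" where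
  "a_factor iq n = (if iq = 0 then 32 * ln (real n) - 8 else min (2 / iq - 1) (32 * ln (real n) - 8))"

lemma one_le_ln_of_ge_3: "n \<ge> (3::nat) \<Longrightarrow> 1 \<le> ln (real n)"
  using exp_le by (subst ln_ge_iff) (auto intro: order_trans)

text \<open>Write \<open>q\<close> for \<open>1 / iq\<close>. If \<open>q + 1\<close> is at most the
  logarithmic term, \<open>2 * m\<close> is the least even integer above \<open>q\<close>, but at
  least \<open>4\<close>: the powers of \<open>n\<close> then combine to exactly
  \<open>2 * iq - 1\<close>, and \<open>2 * m - 1 \<le> q + 1 \<le> 2 * q - 1\<close>. Otherwise the
  logarithmic term is the minimum, and \<open>m \<ge> ln n\<close> gives
  \<open>n powr (1 / m) \<le> exp 1 \<le> 3\<close>, so that the left side costs at most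
  \<open>3 * (2 * ln n + 1)\<close>, which \<open>32 * ln n - 8\<close> covers.\<close>

lemma exponent_choice:
  assumes iq: "0 \<le> iq" "iq \<le> 1 / 2" and n: "n \<ge> 3"
  obtains m :: nat where "m \<ge> 2"
    "(2 * real m - 1) * real n powr (2 * max 0 (iq - 1 / (2 * real m)) + 1 / real m - 1)
      \<le> a_factor iq n * real n powr (2 * iq - 1)"
proof -
  have ln1: "1 \<le> ln (real n)"
    by (rule one_le_ln_of_ge_3[OF n])
  have n0: "real n > 0" "real n \<ge> 1" using n by auto
  show ?thesis
  proof (cases "iq > 0 \<and> 1 / iq + 1 \<le> 32 * ln (real n) - 8")
    case True
    define m where "m = max 2 (nat \<lceil>1 / iq / 2\<rceil>)"
    have q: "1 / iq \<ge> 2"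
      using True iq by (simp add: field_simps)
    have m2: "m \<ge> 2" by (simp add: m_def)
    have m_ge: "1 / iq / 2 \<le> real m"
      unfolding m_def by linarith
    have m_le: "2 * real m - 1 \<le> 1 / iq + 1"
      using q unfolding m_def by (cases "nat \<lceil>1 / iq / 2\<rceil> \<le> 2") (auto simp: max_def, linarith+)
    have "1 / (2 * real m) \<le> iq"
      using m_ge True m2 by (simp add: field_simps)
    then have e: "2 * max 0 (iq - 1 / (2 * real m)) + 1 / real m - 1 = 2 * iq - 1"
      using m2 by (simp add: max_def field_simps)
    have "2 * real m - 1 \<le> a_factor iq n"
      using True m_le q by (simp add: a_factor_def)
    then show ?thesis
      by (intro that[of m] m2) (simp add: e mult_right_mono)
  next
    case False
    define m where "m = max 2 (nat \<lceil>ln (real n)\<rceil>)"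
    have m2: "m \<ge> 2" by (simp add: m_def)
    have m_ge: "ln (real n) \<le> real m" and m_le: "real m \<le> ln (real n) + 1"
      unfolding m_def using ln1 by linarith+
    have A: "a_factor iq n = 32 * ln (real n) - 8"
    proof (cases "iq = 0")
      case F: False
      then have "1 / iq + 1 > 32 * ln (real n) - 8"
        using False iq by auto
      then have "2 / iq - 1 \<ge> 32 * ln (real n) - 8"
        using ln1 by simp
      then show ?thesis
        using F by (simp add: a_factor_def)
    qed (simp add: a_factor_def)
    have "iq \<le> 1 / (2 * real m)"
    proof (cases "iq = 0")
      case F: False
      then have "1 / iq + 1 > 32 * ln (real n) - 8"
        using False iq by auto
      then have "2 * real m \<le> 1 / iq"
        using m_le ln1 by linarith
      then show ?thesis
        using F iq m2 by (simp add: field_simps)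
    qed simp
    then have e: "2 * max 0 (iq - 1 / (2 * real m)) + 1 / real m - 1 = 1 / real m - 1"
      by (simp add: max_def)
    have "real n powr (1 / real m) = exp (ln (real n) / real m)"
      using n by (simp add: powr_def)
    also have "\<dots> \<le> exp 1"
      using m_ge m2 by simp
    also have "\<dots> \<le> 3" by (rule exp_le)
    finally have n3: "real n powr (1 / real m) \<le> 3" .
    have "(2 * real m - 1) * real n powr (1 / real m) \<le> (2 * ln (real n) + 1) * 3"
      using m_le ln1 m2 by (intro mult_mono n3) auto
    also have "\<dots> \<le> a_factor iq n"
      using A ln1 by simp
    finally have B: "(2 * real m - 1) * real n powr (1 / real m) \<le> a_factor iq n" .
    have "(2 * real m - 1) * real n powr (1 / real m - 1) = (2 * real m - 1) * real n powr (1 / real m) * real n powr (- 1)"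
      using n0 powr_add[of "real n" "1 / real m" "-1"] by simp
    also have "\<dots> \<le> a_factor iq n * real n powr (2 * iq - 1)"
      using B n0 iq m2 A ln1 by (intro mult_mono powr_mono) auto
    finally show ?thesis
      by (intro that[of m] m2) (simp add: e)
  qed
qed

lemma a_const_sq:
  assumes pq: "1 \<le> p" "2 \<le> q" "1 / ereal p + 1 / q = 1" and n: "n \<ge> 3"
  shows "(a_const n q)\<^sup>2 = a_factor (1 - 1 / p) n * real n powr (2 * (1 - 1 / p) - 1)"
    and "0 \<le> a_const n q" "1 - 1 / p \<le> 1 / 2"
proof -
  have ln1: "1 \<le> ln (real n)"
    by (rule one_le_ln_of_ge_3[OF n])
  have "real_of_ereal (min (2 * q - 1) (ereal (32 * ln (real n) - 8))) = a_factor (1 - 1 / p) n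
      \<and> real_of_ereal (2 / q) = 2 * (1 - 1 / p) \<and> 0 \<le> a_factor (1 - 1 / p) n \<and> 1 - 1 / p \<le> 1 / 2"
  proof (cases q)
    case (real r)
    then have r: "r \<ge> 2"
      using pq(2) by simp
    have "1 / p + 1 / r = 1"
      using pq r real by (simp add: one_ereal_def)
    then have "1 - 1 / p = 1 / r"
      by simp
    then show ?thesis
      using r real ln1 by (auto simp: a_factor_def one_ereal_def min_def)
  next
    case PInf
    then have "1 / p = 1"
      using pq by (simp add: one_ereal_def)
    then show ?thesis
      using PInf ln1 by (auto simp: a_factor_def one_ereal_def min_def)
  qed (use pq in auto)
  then show "(a_const n q)\<^sup>2 = a_factor (1 - 1 / p) n * real n powr (2 * (1 - 1 / p) - 1)"
    "0 \<le> a_const n q" "1 - 1 / p \<le> 1 / 2"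
    by (auto simp: a_const_def)
qed

text \<open>\<open>S\<close> plays the role of the dual norm \<open>\<parallel>\<cdot>\<parallel>\<close> with exponent \<open>q\<close>. It is a multiple of an even-exponent
  norm, whose moments on the sphere reduce to moments of a single coordinate; the exponent is
  \<open>q\<close> rounded up for small \<open>q\<close> and \<open>2 * \<lceil>ln n\<rceil>\<close> for large \<open>q\<close>, including \<open>q = \<infinity>\<close>.\<close>

lemma dual_gauge_exists:
  assumes pq: "1 \<le> p" "2 \<le> q" "1 / ereal p + 1 / q = 1" and n: "DIM('a::euclidean_space) \<ge> 3"
  obtains S :: "'a::euclidean_space \<Rightarrow> real" where "S \<in> borel_measurable borel" "\<And>v. 0 \<le> S v"
    "\<And>v u. \<bar>v \<bullet> u\<bar> \<le> S v * p_norm p u"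
    "(\<integral>\<^sup>+e. ennreal (S e ^ 4) \<partial>uniform_sphere) \<le> ennreal ((a_const DIM('a::euclidean_space) q) ^ 4)"
proof -
  define N where "N = real DIM('a)"
  have N: "N > 0" by (simp add: N_def)
  define iq where "iq = 1 - 1 / p"
  have iq: "0 \<le> iq" "iq \<le> 1 / 2"
    using pq a_const_sq(3)[OF pq n] by (auto simp: iq_def)
  obtain m :: nat where m: "m \<ge> 2"
    and mA: "(2 * real m - 1) * N powr (2 * max 0 (iq - 1 / (2 * real m)) + 1 / real m - 1)
      \<le> a_factor iq DIM('a) * N powr (2 * iq - 1)"
    using exponent_choice[OF iq n] unfolding N_def by blast
  define k where "k = max 0 (iq - 1 / (2 * real m))"
  define S where "S v = N powr k * p_norm (2 * real m) v" for v :: 'a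
  show ?thesis
  proof (rule that[of S])
    show "S \<in> borel_measurable borel"
      unfolding S_def[abs_def] by measurable
    show "0 \<le> S v" for v by (simp add: S_def)
    show "\<bar>v \<bullet> u\<bar> \<le> S v * p_norm p u" for v u
    proof -
      \<comment> \<open>The exponent conjugate to \<open>2 * m\<close>; Hoelder leads to the
        \<open>s\<close>-norm of \<open>u\<close>, which is then compared with its
        \<open>p\<close>-norm.\<close>
      define s where "s = 2 * real m / (2 * real m - 1)"
      have s: "s > 1" "1 / s = 1 - 1 / (2 * real m)"
        using m by (auto simp: s_def field_simps)
      have "\<bar>v \<bullet> u\<bar> \<le> p_norm (2 * real m) v * p_norm s u"
        by (rule inner_le_p_norm) (use m s in auto)
      also have "\<dots> \<le> p_norm (2 * real m) v * (N powr (max 0 (1 / s - 1 / p)) * p_norm p u)"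
        unfolding N_def using pq s by (intro mult_left_mono p_norm_compare) auto
      also have "1 / s - 1 / p = iq - 1 / (2 * real m)"
        by (simp add: s iq_def)
      finally show ?thesis
        by (simp add: S_def k_def mult_ac)
    qed
    have "(\<integral>\<^sup>+e. ennreal (S e ^ 4) \<partial>uniform_sphere)
        = (\<integral>\<^sup>+e. ennreal ((N powr k) ^ 4) * ennreal (p_norm (2 * real m) (e::'a) ^ 4) \<partial>uniform_sphere)"
      by (simp add: S_def power_mult_distrib ennreal_mult)
    also have "\<dots> = ennreal ((N powr k) ^ 4) * (\<integral>\<^sup>+e. ennreal (p_norm (2 * real m) (e::'a) ^ 4) \<partial>uniform_sphere)"
      by (rule nn_integral_cmult) measurable
    also have "\<dots> \<le> ennreal ((N powr k) ^ 4) * ennreal ((2 * real m - 1)\<^sup>2 * N powr (2 / real m - 2))"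
      unfolding N_def by (intro mult_left_mono sphere_p_norm_fourth_moment m) auto
    also have "\<dots> = ennreal (((2 * real m - 1) * N powr (2 * k + 1 / real m - 1))\<^sup>2)"
    proof -
      have "(N powr k) ^ 4 * N powr (2 / real m - 2) = (N powr (2 * k + 1 / real m - 1))\<^sup>2"
        using N by (simp add: powr_power powr_add[symmetric] algebra_simps)
      then show ?thesis
        by (simp add: ennreal_mult[symmetric] power_mult_distrib mult_ac)
    qed
    also have "\<dots> \<le> ennreal (((a_const DIM('a) q)\<^sup>2)\<^sup>2)"
      using mA m unfolding a_const_sq(1)[OF pq n] iq_def[symmetric] N_def[symmetric] k_def[symmetric]
      by (intro ennreal_leI power_mono) auto
    finally show "(\<integral>\<^sup>+e. ennreal (S e ^ 4) \<partial>uniform_sphere) \<le> ennreal ((a_const DIM('a::euclidean_space) q) ^ 4)"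
      by simp
  qed
qed

subsection \<open>Bregman divergences and prox-mappings\<close>

text \<open>The segment from \<open>z\<close> to \<open>w\<close> stays in \<open>Z\<close>, so even
  when the derivative relative to \<open>Z\<close> is not unique its value on \<open>w - z\<close>
  is determined, as a one-sided limit. All facts about the Bregman divergence rest on this
  limit.\<close>

lemma directional_derivative_within:
  fixes f :: "'a::real_normed_vector \<Rightarrow> real"
  assumes f: "(f has_derivative f') (at z within Z)" and Z: "convex Z" "z \<in> Z" "w \<in> Z"
  shows "((\<lambda>t. (f (z + t *\<^sub>R (w - z)) - f z) / t) \<longlongrightarrow> f' (w - z)) (at_right 0)"
proof -
  let ?c = "\<lambda>t::real. z + t *\<^sub>R (w - z)"
  have sub: "?c ` {0..1} \<subseteq> Z"
  proof safe
    fix t :: real assume "t \<in> {0..1}"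
    then have "(1 - t) *\<^sub>R z + t *\<^sub>R w \<in> Z"
      using Z by (intro convexD) auto
    then show "z + t *\<^sub>R (w - z) \<in> Z"
      by (simp add: algebra_simps)
  qed
  have c: "(?c has_derivative (\<lambda>t. t *\<^sub>R (w - z))) (at 0 within {0..1})"
    by (auto intro!: derivative_eq_intros)
  have "(f has_derivative f') (at (?c 0) within ?c ` {0..1})"
    using has_derivative_subset[OF f sub] by simp
  then have "((\<lambda>t. f (?c t)) has_derivative (\<lambda>t. f' (t *\<^sub>R (w - z)))) (at 0 within {0..1})"
    by (rule has_derivative_in_compose[OF c])
  moreover have "(\<lambda>t. f' (t *\<^sub>R (w - z))) = (*) (f' (w - z))"
    using linear_scale[OF has_derivative_linear[OF f]] by (auto simp: mult.commute)
  ultimately have "((\<lambda>t. f (?c t)) has_real_derivative f' (w - z)) (at 0 within {0..1})"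
    by (simp add: has_field_derivative_def)
  then show ?thesis
    by (simp add: has_field_derivative_iff at_within_Icc_at_right)
qed

lemma eventually_at_right_0_less_1: "\<forall>\<^sub>F t in at_right (0::real). 0 < t \<and> t < 1"
  by (auto simp: eventually_at_right_field intro: exI[of _ 1])

locale prox_setup =
  fixes d :: "'a::euclidean_space \<Rightarrow> real" and Z :: "'a set" and p :: real
  assumes Z: "compact Z" "convex Z" "Z \<noteq> {}"
    and diff: "d differentiable_on Z"
    and sc: "strongly_convex_on (p_norm p) 1 Z d"
    and p: "p \<ge> 1"
    and bdd: "bdd_above (bregman_distances d Z)"
begin

abbreviation V :: "'a \<Rightarrow> 'a \<Rightarrow> real" where "V \<equiv> bregman d Z"
abbreviation \<Omega> :: real where "\<Omega> \<equiv> bregman_diameter d Z"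
abbreviation D :: "'a \<Rightarrow> 'a \<Rightarrow> real" where "D z \<equiv> frechet_derivative d (at z within Z)"

lemma D: "z \<in> Z \<Longrightarrow> (d has_derivative D z) (at z within Z)"
  using diff by (simp add: differentiable_on_def frechet_derivative_works)

lemma D_linear: "z \<in> Z \<Longrightarrow> linear (D z)"
  using has_derivative_linear[OF D] .

lemma d_cont: "continuous_on Z d"
  by (rule differentiable_imp_continuous_on[OF diff])

lemma V_def: "V z w = d w - d z - D z (w - z)"
  by (simp add: bregman_def)

lemma D_limit: "z \<in> Z \<Longrightarrow> w \<in> Z \<Longrightarrow> ((\<lambda>t. (d (z + t *\<^sub>R (w - z)) - d z) / t) \<longlongrightarrow> D z (w - z)) (at_right 0)"
  by (rule directional_derivative_within[OF D Z(2)])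

text \<open>Strong convexity along the segment, divided by \<open>t\<close>, in the limit of
  \<open>t\<close> tending to \<open>0\<close> from the right.\<close>

lemma V_ge:
  assumes z: "z \<in> Z" and w: "w \<in> Z"
  shows "(p_norm p (w - z))\<^sup>2 / 2 \<le> V z w"
proof -
  have "D z (w - z) \<le> d w - d z - 1 / 2 * (1 - 0) * (p_norm p (w - z))\<^sup>2"
  proof (rule tendsto_le[OF _ _ D_limit[OF z w]])
    show "((\<lambda>t. d w - d z - 1 / 2 * (1 - t) * (p_norm p (w - z))\<^sup>2)
        \<longlongrightarrow> d w - d z - 1 / 2 * (1 - 0) * (p_norm p (w - z))\<^sup>2) (at_right 0)"
      by (intro tendsto_intros)
    show "\<forall>\<^sub>F t in at_right 0. (d (z + t *\<^sub>R (w - z)) - d z) / t \<le> d w - d z - 1 / 2 * (1 - t) * (p_norm p (w - z))\<^sup>2"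
      using eventually_at_right_0_less_1
    proof eventually_elim
      fix t :: real assume t: "0 < t \<and> t < 1"
      have "d ((1 - t) *\<^sub>R z + t *\<^sub>R w) \<le> (1 - t) * d z + t * d w - 1 / 2 * t * (1 - t) * (p_norm p (z - w))\<^sup>2"
        using sc z w t unfolding strongly_convex_on_def by auto
      moreover have "(1 - t) *\<^sub>R z + t *\<^sub>R w = z + t *\<^sub>R (w - z)"
        by (simp add: algebra_simps)
      ultimately have "d (z + t *\<^sub>R (w - z)) - d z \<le> t * (d w - d z - 1 / 2 * (1 - t) * (p_norm p (w - z))\<^sup>2)"
        by (simp add: algebra_simps p_norm_minus_commute[of p z w])
      then show "(d (z + t *\<^sub>R (w - z)) - d z) / t \<le> d w - d z - 1 / 2 * (1 - t) * (p_norm p (w - z))\<^sup>2"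
        using t by (simp add: divide_le_eq mult.commute)
    qed
  qed simp
  then show ?thesis
    by (simp add: V_def)
qed

lemma V_nonneg: "z \<in> Z \<Longrightarrow> w \<in> Z \<Longrightarrow> 0 \<le> V z w"
  using V_ge[of z w] by (meson order_trans zero_le_power2 divide_nonneg_pos zero_less_numeral)

lemma V_pos: "z \<in> Z \<Longrightarrow> w \<in> Z \<Longrightarrow> w \<noteq> z \<Longrightarrow> 0 < V z w"
  using V_ge[of z w] p_norm_pos[of p "w - z"] p by (smt (verit) zero_less_power divide_pos_pos right_minus_eq)

lemma sqrt_V_le: "z \<in> Z \<Longrightarrow> w \<in> Z \<Longrightarrow> sqrt (2 * V z w) \<le> \<Omega>"
  unfolding bregman_diameter_def by (rule cSup_upper[OF _ bdd]) (auto simp: bregman_distances_def)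

lemma \<Omega>_nonneg: "0 \<le> \<Omega>"
proof -
  obtain z where z: "z \<in> Z" using Z by auto
  then have "0 \<le> sqrt (2 * V z z)"
    using V_nonneg by simp
  then show ?thesis
    using sqrt_V_le[OF z z] by linarith
qed

lemma V_le: "z \<in> Z \<Longrightarrow> w \<in> Z \<Longrightarrow> V z w \<le> \<Omega>\<^sup>2 / 2"
  using sqrt_le_D[OF sqrt_V_le[of z w]] by simp

lemma p_norm_le_\<Omega>:
  assumes "z \<in> Z" "w \<in> Z"
  shows "p_norm p (w - z) \<le> \<Omega>"
proof -
  have "(p_norm p (w - z))\<^sup>2 \<le> \<Omega>\<^sup>2"
    using V_ge[OF assms] V_le[OF assms] by linarith
  then show ?thesis
    using \<Omega>_nonneg by (rule power2_le_imp_le)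
qed

definition F :: "'a \<Rightarrow> 'a \<Rightarrow> 'a \<Rightarrow> real" where "F z w u = V z u + w \<bullet> u"

lemma F_cont:
  assumes "z \<in> Z"
  shows "continuous_on Z (F z w)"
proof -
  have "continuous_on Z (\<lambda>u. D z (u - z))"
    by (rule continuous_on_compose2[OF linear_continuous_on[OF has_derivative_bounded_linear[OF D[OF assms]], of UNIV]])
       (auto intro!: continuous_intros)
  then show ?thesis
    unfolding F_def V_def by (intro continuous_intros d_cont)
qed

lemma prox_minimizes:
  assumes z: "z \<in> Z"
  shows "prox d Z z w \<in> Z" "\<And>u. u \<in> Z \<Longrightarrow> F z w (prox d Z z w) \<le> F z w u"
proof -
  obtain m where "m \<in> Z" "\<And>u. u \<in> Z \<Longrightarrow> F z w m \<le> F z w u"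
    using continuous_attains_inf[OF Z(1,3) F_cont[OF z]] by blast
  then have "is_arg_min (F z w) (\<lambda>x. x \<in> Z) m"
    by (auto simp: is_arg_min_def not_less)
  then have "is_arg_min (F z w) (\<lambda>x. x \<in> Z) (arg_min_on (F z w) Z)"
    unfolding arg_min_on_def arg_min_def by (rule someI)
  moreover have "prox d Z z w = arg_min_on (F z w) Z"
    by (simp add: prox_def F_def[abs_def])
  ultimately show "prox d Z z w \<in> Z" "\<And>u. u \<in> Z \<Longrightarrow> F z w (prox d Z z w) \<le> F z w u"
    by (auto simp: is_arg_min_def not_less)
qed

text \<open>The minimiser has nonnegative directional derivative towards \<open>u\<close>. Expanding
  the three divergences turns this optimality condition into the claim.\<close>

lemma prox_three_point:
  fixes w :: 'a
  assumes z: "z \<in> Z" and u: "u \<in> Z"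
  defines "z' \<equiv> prox d Z z w"
  shows "w \<bullet> (z' - u) \<le> V z u - V z' u - V z z'"
proof -
  have z': "z' \<in> Z" and min: "\<And>v. v \<in> Z \<Longrightarrow> F z w z' \<le> F z w v"
    using prox_minimizes[OF z] by (auto simp: z'_def)
  have "((\<lambda>v. v - z) has_derivative (\<lambda>v. v)) (at z' within Z)"
    by (auto intro!: derivative_eq_intros)
  then have "((\<lambda>v. D z (v - z)) has_derivative D z) (at z' within Z)"
    by (rule bounded_linear.has_derivative[OF has_derivative_bounded_linear[OF D[OF z]]])
  then have "(F z w has_derivative (\<lambda>h. D z' h - D z h + w \<bullet> h)) (at z' within Z)"
    unfolding F_def[abs_def] V_def[abs_def] by (auto intro!: derivative_eq_intros D[OF z'])
  from directional_derivative_within[OF this Z(2) z' u]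
  have lim: "((\<lambda>t. (F z w (z' + t *\<^sub>R (u - z')) - F z w z') / t) \<longlongrightarrow> D z' (u - z') - D z (u - z') + w \<bullet> (u - z')) (at_right 0)" .
  have "0 \<le> D z' (u - z') - D z (u - z') + w \<bullet> (u - z')"
  proof (rule tendsto_lowerbound[OF lim])
    show "\<forall>\<^sub>F t in at_right 0. 0 \<le> (F z w (z' + t *\<^sub>R (u - z')) - F z w z') / t"
      using eventually_at_right_0_less_1
    proof eventually_elim
      fix t :: real assume t: "0 < t \<and> t < 1"
      have "(1 - t) *\<^sub>R z' + t *\<^sub>R u \<in> Z"
        using t z' u Z(2) by (intro convexD) auto
      moreover have "(1 - t) *\<^sub>R z' + t *\<^sub>R u = z' + t *\<^sub>R (u - z')"
        by (simp add: algebra_simps)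
      ultimately show "0 \<le> (F z w (z' + t *\<^sub>R (u - z')) - F z w z') / t"
        using t min[of "z' + t *\<^sub>R (u - z')"] by simp
    qed
  qed simp
  moreover have "D z (u - z') = D z (u - z) - D z (z' - z)"
    using linear_diff[OF D_linear[OF z], of "u - z" "z' - z"] by simp
  ultimately show ?thesis
    by (simp add: V_def inner_diff_right)
qed

lemma prox_unique:
  assumes z: "z \<in> Z" and u: "u \<in> Z" and le: "F z w u \<le> F z w (prox d Z z w)"
  shows "u = prox d Z z w"
proof (rule ccontr)
  assume "u \<noteq> prox d Z z w"
  then have "0 < V (prox d Z z w) u"
    using V_pos prox_minimizes(1)[OF z] u by blast
  then show False
    using prox_three_point[OF z u, of w] le by (simp add: F_def inner_diff_right)
qed

text \<open>Here \<open>s\<close> bounds the dual norm of \<open>w\<close>. The movement from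
  \<open>z\<close> to the new point costs at most \<open>s\<close> times its length, while strong
  convexity returns half the squared length; the net cost is at most
  \<open>s\<^sup>2 / 2\<close>.\<close>

lemma prox_step:
  assumes z: "z \<in> Z" and u: "u \<in> Z" and s: "\<And>h. \<bar>w \<bullet> h\<bar> \<le> s * p_norm p h"
  shows "w \<bullet> (z - u) \<le> V z u - V (prox d Z z w) u + s\<^sup>2 / 2"
proof -
  let ?z' = "prox d Z z w"
  let ?n = "p_norm p (z - ?z')"
  have "w \<bullet> (z - u) = w \<bullet> (z - ?z') + w \<bullet> (?z' - u)"
    by (simp add: inner_diff_right)
  also have "\<dots> \<le> s * ?n + (V z u - V ?z' u - V z ?z')"
    using s[of "z - ?z'"] prox_three_point[OF z u, of w] by linarith
  finally have "w \<bullet> (z - u) \<le> s * ?n + (V z u - V ?z' u - V z ?z')" .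
  moreover have "V z ?z' \<ge> ?n\<^sup>2 / 2"
    using V_ge[OF z prox_minimizes(1)[OF z], of w] by (simp add: p_norm_minus_commute)
  moreover have "s * ?n \<le> s\<^sup>2 / 2 + ?n\<^sup>2 / 2"
    using sum_squares_bound[of s ?n] by simp
  ultimately show ?thesis by linarith
qed

section \<open>Measurability of the prox-mapping\<close>

lemma F_measurable:
  assumes u: "u \<in> Z"
  obtains G where "G \<in> borel_measurable borel" "\<And>z w. z \<in> Z \<Longrightarrow> G (z, w) = F z w u"
proof -
  define d' where "d' x = indicator Z x *\<^sub>R d x" for x
  have [measurable]: "d' \<in> borel_measurable borel"
    unfolding d'_def[abs_def] using d_cont Z(1) by (intro borel_measurable_continuous_on_indicator) (auto simp: compact_imp_closed)
  define t where "t k = 1 / (real k + 2)" for k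
  have t: "t k > 0" "t k < 1" for k
    by (auto simp: t_def)
  have t_lim: "filterlim t (at_right 0) sequentially"
    unfolding t_def by real_asymp
  \<comment> \<open>The chosen derivative \<open>D z\<close> need not depend measurably on
    \<open>z\<close>, but its value on \<open>u - z\<close> does: it is a limit of difference
    quotients of \<open>d\<close>, taken here along the points
    \<open>z + t k *\<^sub>R (u - z)\<close> of \<open>Z\<close>. The extension \<open>d'\<close> by
    zero makes the quotients total.\<close>
  define l where "l z = lim (\<lambda>k. (d' (z + t k *\<^sub>R (u - z)) - d' z) / t k)" for z
  have [measurable]: "l \<in> borel_measurable borel"
    unfolding l_def[abs_def] by (rule borel_measurable_lim_metric) measurable
  have l: "l z = D z (u - z)" if z: "z \<in> Z" for z
    unfolding l_def
  proof (rule limI)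
    have "z + t k *\<^sub>R (u - z) \<in> Z" for k
    proof -
      have "(1 - t k) *\<^sub>R z + t k *\<^sub>R u \<in> Z"
        using t[of k] z u Z(2) by (intro convexD) auto
      then show ?thesis by (simp add: algebra_simps)
    qed
    then have "(\<lambda>k. (d' (z + t k *\<^sub>R (u - z)) - d' z) / t k) = (\<lambda>k. (d (z + t k *\<^sub>R (u - z)) - d z) / t k)"
      using z by (simp add: d'_def)
    then show "(\<lambda>k. (d' (z + t k *\<^sub>R (u - z)) - d' z) / t k) \<longlonglongrightarrow> D z (u - z)"
      using filterlim_compose[OF D_limit[OF z u] t_lim] by simp
  qed
  define G where "G q = d' u - d' (fst q) - l (fst q) + snd q \<bullet> u" for q :: "'a \<times> 'a"
  show ?thesis
  proof (rule that[of G])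
    show "G \<in> borel_measurable borel"
      unfolding G_def[abs_def] borel_prod[symmetric] by measurable
    show "G (z, w) = F z w u" if "z \<in> Z" for z w
      using that u by (simp add: G_def F_def V_def l d'_def)
  qed
qed

text \<open>The prox-mapping is the unique minimiser, so it lies in a closed set \<open>C\<close> iff the infimum over
  \<open>Z \<inter> C\<close> equals the infimum over \<open>Z\<close>; both infima may be taken over countable dense sets.\<close>

lemma prox_closed_measurable:
  assumes C: "closed C"
  shows "{q \<in> Z \<times> UNIV. prox d Z (fst q) (snd q) \<in> C} \<in> sets borel"
proof -
  obtain A where A: "countable A" "A \<subseteq> Z \<inter> C" "Z \<inter> C \<subseteq> closure A"
    using separable by blast
  obtain B where B: "countable B" "B \<subseteq> Z" "Z \<subseteq> closure B"
    using separable by blast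
  \<comment> \<open>The slack \<open>1 / real (Suc k)\<close> expresses that the infimum over
    \<open>A\<close> does not exceed the one over \<open>B\<close>; neither infimum need be attained
    on its countable set.\<close>
  have eq: "prox d Z z w \<in> C \<longleftrightarrow> (\<forall>v\<in>B. \<forall>k. \<exists>u\<in>A. F z w u < F z w v + 1 / real (Suc k))" if z: "z \<in> Z" for z w
  proof
    assume P: "prox d Z z w \<in> C"
    let ?m = "prox d Z z w"
    have m: "?m \<in> closure A" "?m \<in> Z"
      using P prox_minimizes(1)[OF z] A by auto
    show "\<forall>v\<in>B. \<forall>k. \<exists>u\<in>A. F z w u < F z w v + 1 / real (Suc k)"
    proof safe
      fix v k assume v: "v \<in> B"
      obtain s where s: "\<And>i. s i \<in> A" "s \<longlonglongrightarrow> ?m"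
        using m closure_sequential by blast
      have "(\<lambda>i. F z w (s i)) \<longlonglongrightarrow> F z w ?m"
        by (rule continuous_on_tendsto_compose[OF F_cont[OF z] s(2) m(2)]) (use s A in \<open>auto intro!: always_eventually\<close>)
      moreover have "F z w ?m < F z w v + 1 / real (Suc k)"
      proof -
        have "F z w ?m \<le> F z w v"
          using prox_minimizes(2)[OF z, of v w] v B by auto
        moreover have "0 < 1 / real (Suc k)"
          by simp
        ultimately show ?thesis by linarith
      qed
      ultimately have "\<forall>\<^sub>F i in sequentially. F z w (s i) < F z w v + 1 / real (Suc k)"
        by (rule order_tendstoD)
      then show "\<exists>u\<in>A. F z w u < F z w v + 1 / real (Suc k)"
        using s(1) by (auto simp: eventually_sequentially)
    qed
  next
    assume R: "\<forall>v\<in>B. \<forall>k. \<exists>u\<in>A. F z w u < F z w v + 1 / real (Suc k)"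
    have "B \<noteq> {}"
      using B Z by auto
    then have ne: "Z \<inter> C \<noteq> {}"
      using R A by blast
    have "compact (Z \<inter> C)"
      using Z C by (simp add: compact_Int_closed)
    then obtain u0 where u0: "u0 \<in> Z \<inter> C" "\<And>u. u \<in> Z \<inter> C \<Longrightarrow> F z w u0 \<le> F z w u"
      using continuous_attains_inf[of "Z \<inter> C" "F z w"] ne continuous_on_subset[OF F_cont[OF z]] by blast
    have "F z w u0 \<le> F z w v" if v: "v \<in> B" for v
    proof (rule field_le_epsilon)
      fix \<epsilon> :: real assume "\<epsilon> > 0"
      then obtain k where k: "1 / real (Suc k) < \<epsilon>"
        using reals_Archimedean by (auto simp: inverse_eq_divide)
      obtain u where "u \<in> A" "F z w u < F z w v + 1 / real (Suc k)"
        using R v by blast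
      moreover from this have "F z w u0 \<le> F z w u"
        using u0(2)[of u] A by auto
      ultimately show "F z w u0 \<le> F z w v + \<epsilon>"
        using k by linarith
    qed
    moreover have "prox d Z z w \<in> closure B"
      using prox_minimizes(1)[OF z] B by auto
    then obtain s where s: "\<And>i. s i \<in> B" "s \<longlonglongrightarrow> prox d Z z w"
      using closure_sequential by blast
    have "(\<lambda>i. F z w (s i)) \<longlonglongrightarrow> F z w (prox d Z z w)"
      by (rule continuous_on_tendsto_compose[OF F_cont[OF z] s(2) prox_minimizes(1)[OF z]]) (use s B in \<open>auto intro!: always_eventually\<close>)
    ultimately have "F z w u0 \<le> F z w (prox d Z z w)"
      using s(1) by (intro LIMSEQ_le_const) auto
    then show "prox d Z z w \<in> C"
      using prox_unique[OF z, of u0 w] u0 by auto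
  qed
  have "\<forall>u\<in>Z. \<exists>G. G \<in> borel_measurable borel \<and> (\<forall>z w. z \<in> Z \<longrightarrow> G (z, w) = F z w u)"
    using F_measurable by metis
  then obtain G where G: "\<And>u. u \<in> Z \<Longrightarrow> G u \<in> borel_measurable borel"
    "\<And>u z w. u \<in> Z \<Longrightarrow> z \<in> Z \<Longrightarrow> G u (z, w) = F z w u"
    by metis
  have "{q \<in> Z \<times> UNIV. prox d Z (fst q) (snd q) \<in> C}
      = (Z \<times> UNIV) \<inter> (\<Inter>v\<in>B. \<Inter>k. \<Union>u\<in>A. {q. G u q < G v q + 1 / real (Suc k)})"
    using eq G(2) A(2) B(2) by (auto simp: subset_iff) 
  also have "\<dots> \<in> sets borel"
  proof (cases "B = {}")
    case True
    then show ?thesis using B Z by auto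
  next
    case False
    have "{q. G u q < G v q + 1 / real (Suc k)} \<in> sets borel" if "u \<in> A" "v \<in> B" for u v k
    proof -
      have [measurable]: "G u \<in> borel_measurable borel" "G v \<in> borel_measurable borel"
        using that A B G(1) by auto
      show ?thesis by measurable
    qed
    moreover have "Z \<times> (UNIV :: 'a set) \<in> sets borel"
      using Z(1) by (intro borel_closed closed_Times) (auto simp: compact_imp_closed)
    ultimately show ?thesis
      using A(1) B(1) False by (intro sets.Int sets.countable_INT'' sets.countable_INT' sets.countable_UN') auto
  qed
  finally show ?thesis .
qed

text \<open>A total version with all values in \<open>Z\<close>, so that it is Borel measurable on
  the whole space and can be iterated without side conditions.\<close>

definition prox' :: "'a \<times> 'a \<Rightarrow> 'a" where
  "prox' q = (if fst q \<in> Z then prox d Z (fst q) (snd q) else (SOME z. z \<in> Z))"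

lemma prox'_in: "prox' q \<in> Z"
  using prox_minimizes(1) Z(3) by (auto simp: prox'_def some_in_eq)

lemma prox'_eq: "z \<in> Z \<Longrightarrow> prox' (z, w) = prox d Z z w"
  by (simp add: prox'_def)

lemma prox'_measurable [measurable]: "prox' \<in> borel_measurable borel"
proof (subst borel_measurable_iff_halfspace_le, safe)
  fix b :: 'a and a :: real
  let ?C = "{x. x \<bullet> b \<le> a}"
  have "closed ?C"
    by (rule closed_Collect_le) (auto intro!: continuous_intros)
  note prox_closed_measurable[OF this]
  moreover have Z': "Z \<times> (UNIV :: 'a set) \<in> sets borel"
    using Z(1) by (intro borel_closed closed_Times) (auto simp: compact_imp_closed)
  moreover have "{q \<in> space borel. prox' q \<bullet> b \<le> a}
      = {q \<in> Z \<times> UNIV. prox d Z (fst q) (snd q) \<in> ?C} \<union> (if (SOME z. z \<in> Z) \<in> ?C then - (Z \<times> UNIV) else {})"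
    by (auto simp: prox'_def)
  moreover have "- (Z \<times> (UNIV :: 'a set)) \<in> sets borel"
    using Z' by (rule borel_comp)
  ultimately show "{q \<in> space borel. prox' q \<bullet> b \<le> a} \<in> sets borel"
    by (cases "(SOME z. z \<in> Z) \<in> ?C") (simp_all only: if_True if_False sets.Un Un_empty_right)
qed

end

subsection \<open>Moments of the gradient estimator\<close>

lemma borel_measurable_fst_raw [measurable (raw)]:
  fixes f :: "'a \<Rightarrow> 'b::second_countable_topology \<times> 'c::second_countable_topology"
  shows "f \<in> borel_measurable M \<Longrightarrow> (\<lambda>x. fst (f x)) \<in> borel_measurable M"
  by (rule measurable_compose[of f M borel fst]) (auto intro!: borel_measurable_continuous_onI continuous_intros)

lemma borel_measurable_snd_raw [measurable (raw)]:
  fixes f :: "'a \<Rightarrow> 'b::second_countable_topology \<times> 'c::second_countable_topology"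
  shows "f \<in> borel_measurable M \<Longrightarrow> (\<lambda>x. snd (f x)) \<in> borel_measurable M"
  by (rule measurable_compose[of f M borel snd]) (auto intro!: borel_measurable_continuous_onI continuous_intros)

text \<open>Mapping both variables into one type \<open>'d\<close> makes the facts about
  \<open>indep_var\<close>, in particular the product formula for integrals, applicable to variables
  of different types.\<close>

lemma (in prob_space) indep_rv_imp_indep_var:
  fixes A :: "'a \<Rightarrow> 'b::topological_space" and B :: "'a \<Rightarrow> 'c::topological_space"
    and f :: "'b \<Rightarrow> 'd::topological_space" and g :: "'c \<Rightarrow> 'd"
  assumes AB: "indep_rv M A B"
    and [measurable]: "f \<in> borel_measurable borel" "g \<in> borel_measurable borel"
  shows "indep_var borel (\<lambda>\<omega>. f (A \<omega>)) borel (\<lambda>\<omega>. g (B \<omega>))"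
proof -
  have [measurable]: "A \<in> borel_measurable M" "B \<in> borel_measurable M"
    and ind: "indep_set {A -` S \<inter> space M | S. S \<in> sets borel} {B -` S \<inter> space M | S. S \<in> sets borel}"
    using AB by (auto simp: indep_rv_def)
  have "Int_stable {(\<lambda>\<omega>. h (C \<omega>)) -` S \<inter> space M | S. S \<in> sets (borel :: 'd measure)}" for h :: "'e \<Rightarrow> 'd" and C
    unfolding Int_stable_def
  proof safe
    fix S T :: "'d set" assume "S \<in> sets borel" "T \<in> sets borel"
    then show "\<exists>U. (\<lambda>\<omega>. h (C \<omega>)) -` S \<inter> space M \<inter> ((\<lambda>\<omega>. h (C \<omega>)) -` T \<inter> space M) = (\<lambda>\<omega>. h (C \<omega>)) -` U \<inter> space M \<and> U \<in> sets borel"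
      by (intro exI[of _ "S \<inter> T"]) auto
  qed
  moreover have "{(\<lambda>\<omega>. f (A \<omega>)) -` S \<inter> space M | S. S \<in> sets borel} \<subseteq> {A -` S \<inter> space M | S. S \<in> sets borel}"
    "{(\<lambda>\<omega>. g (B \<omega>)) -` S \<inter> space M | S. S \<in> sets borel} \<subseteq> {B -` S \<inter> space M | S. S \<in> sets borel}"
  proof safe
    fix S :: "'d set" assume S: "S \<in> sets borel"
    show "\<exists>T. (\<lambda>\<omega>. f (A \<omega>)) -` S \<inter> space M = A -` T \<inter> space M \<and> T \<in> sets borel"
      using measurable_sets[OF assms(2) S] by (intro exI[of _ "f -` S"]) auto
    show "\<exists>T. (\<lambda>\<omega>. g (B \<omega>)) -` S \<inter> space M = B -` T \<inter> space M \<and> T \<in> sets borel"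
      using measurable_sets[OF assms(3) S] by (intro exI[of _ "g -` S"]) auto
  qed
  then have "indep_set {(\<lambda>\<omega>. f (A \<omega>)) -` S \<inter> space M | S. S \<in> sets borel} {(\<lambda>\<omega>. g (B \<omega>)) -` S \<inter> space M | S. S \<in> sets borel}"
    using ind unfolding indep_sets2_eq by (meson subset_iff)
  ultimately show ?thesis
    unfolding indep_var_eq by (intro conjI indep_set_sigma_sets) measurable
qed

lemma a_const_pos:
  assumes pq: "1 \<le> p" "2 \<le> q" "1 / ereal p + 1 / q = 1" and n: "n \<ge> 3"
  shows "0 < a_const n q"
proof -
  have "1 \<le> ln (real n)"
    by (rule one_le_ln_of_ge_3[OF n])
  moreover have "1 < 2 / (1 - 1 / p)" if "1 - 1 / p \<noteq> 0"
    using a_const_sq(3)[OF pq n] that pq(1) by (simp add: field_simps)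
  ultimately have "0 < (a_const n q)\<^sup>2"
    unfolding a_const_sq(1)[OF pq n] using n by (auto simp: a_factor_def)
  then show ?thesis
    using a_const_sq(2)[OF pq n] by (simp add: zero_less_power2)
qed

text \<open>Turns a gradient into the operator of the saddle point problem: descent in
  \<open>x\<close>, ascent in \<open>y\<close>. It is self-adjoint and preserves every
  \<open>p_norm\<close>.\<close>

definition flip_snd :: "'a::real_vector \<times> 'b::real_vector \<Rightarrow> 'a \<times> 'b" where
  "flip_snd v = (fst v, - snd v)"

lemma flip_snd_measurable [measurable]:
  "flip_snd \<in> borel_measurable (borel :: ('a::euclidean_space \<times> 'b::euclidean_space) measure)"
  unfolding flip_snd_def[abs_def] by (intro borel_measurable_continuous_onI continuous_intros)

lemma inner_flip_snd: "flip_snd v \<bullet> w = v \<bullet> flip_snd w"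
  by (simp add: flip_snd_def inner_prod_def)

lemma abs_flip_snd_Basis: "b \<in> Basis \<Longrightarrow> \<bar>flip_snd v \<bullet> b\<bar> = \<bar>v \<bullet> b\<bar>"
  by (auto simp: flip_snd_def Basis_prod_def inner_prod_def)

lemma norm_flip_snd [simp]: "norm (flip_snd v) = norm v"
  by (simp add: flip_snd_def norm_prod_def)

lemma p_norm_flip_snd [simp]: "p_norm p (flip_snd v) = p_norm p v"
  by (rule p_norm_cong_abs) (rule abs_flip_snd_Basis)

text \<open>The scalar factor of \<open>grad_est\<close>. The randomness of one iteration is packed
  into a single argument \<open>w\<close>, consisting of the direction and the two noises.\<close>

definition amp ::
  "('a::euclidean_space \<times> 'b::euclidean_space \<Rightarrow> real) \<Rightarrow> ('a \<times> 'b \<Rightarrow> real) \<Rightarrow> real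
     \<Rightarrow> 'a \<times> 'b \<Rightarrow> ('a \<times> 'b) \<times> real \<times> real \<Rightarrow> real" where
  "amp \<phi> \<delta> \<tau> z w = real DIM('a \<times> 'b)
     * (noisy_value \<phi> \<delta> (z + \<tau> *\<^sub>R fst w) (fst (snd w)) - noisy_value \<phi> \<delta> (z - \<tau> *\<^sub>R fst w) (snd (snd w))) / (2 * \<tau>)"

lemma grad_est_amp: "grad_est \<phi> \<delta> z e \<tau> xp xm = amp \<phi> \<delta> \<tau> z (e, xp, xm) *\<^sub>R flip_snd e"
  by (simp add: grad_est_def amp_def flip_snd_def)

lemma uniform_sphere_uminus: "distr uniform_sphere borel uminus = (uniform_sphere :: 'a::euclidean_space measure)"
proof -
  have ball: "distr uniform_ball borel uminus = (uniform_ball :: 'a measure)"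
  proof (rule measure_eqI)
    fix A :: "'a set" assume "A \<in> sets (distr uniform_ball borel uminus)"
    then have [measurable]: "A \<in> sets borel" by simp
    have "emeasure lborel (cball 0 1 \<inter> A) = emeasure (distr lborel borel uminus) (cball 0 1 \<inter> A)"
      by (simp only: distr_lborel_uminus)
    also have "\<dots> = emeasure lborel (uminus -` (cball 0 1 \<inter> A))"
      by (subst emeasure_distr) auto
    also have "uminus -` (cball 0 1 \<inter> A) = cball 0 1 \<inter> uminus -` A"
      by auto
    finally have "emeasure lborel (cball 0 1 \<inter> A) = emeasure lborel (cball 0 1 \<inter> uminus -` A)" .
    moreover have "uminus -` A \<in> sets borel"
      using measurable_sets[of uminus borel borel A] by simp
    ultimately show "emeasure (distr uniform_ball borel uminus) A = emeasure uniform_ball A"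
      by (subst emeasure_distr) (auto simp: emeasure_uniform_measure)
  qed simp
  let ?N = "\<lambda>v::'a. v /\<^sub>R norm v"
  have "distr uniform_sphere borel uminus = distr uniform_ball borel (\<lambda>v::'a. - ?N v)"
    unfolding uniform_sphere_def by (subst distr_distr) (auto simp: comp_def)
  also have "\<dots> = distr (distr uniform_ball borel uminus) borel ?N"
    by (subst distr_distr) (auto simp: comp_def)
  finally show ?thesis
    by (simp add: ball uniform_sphere_def)
qed

text \<open>One oracle call at a fixed query point; the randomness of the iterates enters only
  later, through independence. \<open>S\<close> is a gauge dominating the dual norm, and
  \<open>\<phi>\<close> and \<open>\<delta>\<close> are the extensions to the whole space.\<close>

locale one_step = prob_space P for P :: "'w measure" +
  fixes \<phi> \<delta> :: "'a::euclidean_space \<times> 'b::euclidean_space \<Rightarrow> real"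
    and M \<tau> \<Delta> \<sigma> p n a Mall :: real and q :: ereal and S :: "'a \<times> 'b \<Rightarrow> real"
    and e :: "'w \<Rightarrow> 'a \<times> 'b" and xp xm :: "'w \<Rightarrow> real"
  assumes n_def: "n = real DIM('a \<times> 'b)" and a_def: "a = a_const DIM('a \<times> 'b) q"
    and Mall_def: "Mall = M_all_sq DIM('a \<times> 'b) M \<sigma> \<Delta> \<tau> q"
    and lip: "M-lipschitz_on UNIV \<phi>"
    and \<delta>_meas [measurable]: "\<delta> \<in> borel_measurable borel" and \<delta>_bound: "\<And>w. \<bar>\<delta> w\<bar> \<le> \<Delta>"
    and pos: "M > 0" "\<tau> > 0" "\<Delta> > 0" "\<sigma> > 0"
    and n3: "DIM('a \<times> 'b) \<ge> 3"
    and pq: "1 \<le> p" "2 \<le> q" "1 / ereal p + 1 / q = 1"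
    and S_meas [measurable]: "S \<in> borel_measurable borel" and S_nonneg: "\<And>v. 0 \<le> S v"
    and S_dual: "\<And>v u. \<bar>v \<bullet> u\<bar> \<le> S v * p_norm p u"
    and S_moment: "(\<integral>\<^sup>+e. ennreal (S e ^ 4) \<partial>uniform_sphere) \<le> ennreal (a ^ 4)"
    and e_sphere: "\<And>\<omega>. \<omega> \<in> space P \<Longrightarrow> norm (e \<omega>) = 1"
    and e_uniform: "distr P borel e = uniform_sphere"
    and xp: "integrable P xp" "(\<integral>\<omega>. xp \<omega> \<partial>P) = 0" "integrable P (\<lambda>\<omega>. (xp \<omega>)\<^sup>2)" "(\<integral>\<omega>. (xp \<omega>)\<^sup>2 \<partial>P) \<le> \<sigma>\<^sup>2"
    and xm: "integrable P xm" "(\<integral>\<omega>. xm \<omega> \<partial>P) = 0" "integrable P (\<lambda>\<omega>. (xm \<omega>)\<^sup>2)" "(\<integral>\<omega>. (xm \<omega>)\<^sup>2 \<partial>P) \<le> \<sigma>\<^sup>2"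
    and ind: "indep_rv P e (\<lambda>\<omega>. (xp \<omega>, xm \<omega>))"
begin

definition W :: "'w \<Rightarrow> ('a \<times> 'b) \<times> real \<times> real" where "W \<omega> = (e \<omega>, xp \<omega>, xm \<omega>)"

definition D\<phi> :: "'a \<times> 'b \<Rightarrow> 'a \<times> 'b \<Rightarrow> real" where "D\<phi> z v = \<phi> (z + \<tau> *\<^sub>R v) - \<phi> (z - \<tau> *\<^sub>R v)"
definition D\<delta> :: "'a \<times> 'b \<Rightarrow> 'a \<times> 'b \<Rightarrow> real" where "D\<delta> z v = \<delta> (z + \<tau> *\<^sub>R v) - \<delta> (z - \<tau> *\<^sub>R v)"

lemma amp_eq: "amp \<phi> \<delta> \<tau> z (W \<omega>) = n / (2 * \<tau>) * (D\<phi> z (e \<omega>) + (xp \<omega> - xm \<omega>) + D\<delta> z (e \<omega>))"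
  by (simp add: amp_def noisy_value_def D\<phi>_def D\<delta>_def W_def n_def field_simps)

lemma n_pos: "n > 0" and a_pos: "a > 0"
  using n3 a_const_pos[OF pq n3] by (auto simp: n_def a_def)

lemma \<phi>_meas [measurable]: "\<phi> \<in> borel_measurable borel"
  by (rule lipschitz_measurable[OF lip])

lemma e_meas [measurable]: "e \<in> borel_measurable P"
  using ind by (simp add: indep_rv_def)

lemma x_meas [measurable]: "xp \<in> borel_measurable P" "xm \<in> borel_measurable P"
  using xp(1) xm(1) by auto

lemma D\<phi>_meas [measurable]: "D\<phi> z \<in> borel_measurable borel"
  unfolding D\<phi>_def[abs_def] by measurable

lemma D\<delta>_meas [measurable]: "D\<delta> z \<in> borel_measurable borel"
  unfolding D\<delta>_def[abs_def] by measurable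

lemma integrable_e: "f \<in> borel_measurable borel \<Longrightarrow> integrable uniform_sphere f \<longleftrightarrow> integrable P (\<lambda>\<omega>. f (e \<omega>))"
  and integral_e: "f \<in> borel_measurable borel \<Longrightarrow> (\<integral>v. f v \<partial>uniform_sphere) = (\<integral>\<omega>. f (e \<omega>) \<partial>P)"
  for f :: "'a \<times> 'b \<Rightarrow> real"
  unfolding e_uniform[symmetric] by (simp_all add: integrable_distr_eq integral_distr)

lemma S4: "integrable P (\<lambda>\<omega>. S (e \<omega>) ^ 4)" "(\<integral>\<omega>. S (e \<omega>) ^ 4 \<partial>P) \<le> a ^ 4"
proof -
  have "integrable uniform_sphere (\<lambda>v. S v ^ 4)"
    using S_moment by (intro integrableI_bounded) (auto simp: S_nonneg intro: le_less_trans)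
  moreover from this have "ennreal (\<integral>v. S v ^ 4 \<partial>uniform_sphere) \<le> ennreal (a ^ 4)"
    using S_moment by (subst nn_integral_eq_integral[symmetric]) (auto simp: S_nonneg)
  ultimately show "integrable P (\<lambda>\<omega>. S (e \<omega>) ^ 4)" "(\<integral>\<omega>. S (e \<omega>) ^ 4 \<partial>P) \<le> a ^ 4"
    using a_pos by (auto simp: integrable_e integral_e)
qed

text \<open>AM-GM with the weight \<open>a\<^sup>2\<close> takes the place of Jensen's inequality.
  It loses nothing, since the bound \<open>a ^ 4\<close> makes the right side average to
  \<open>a\<^sup>2\<close>. \<open>S1\<close> and \<open>s_int\<close> use the same device.\<close>

lemma S2: "integrable P (\<lambda>\<omega>. (S (e \<omega>))\<^sup>2)" "(\<integral>\<omega>. (S (e \<omega>))\<^sup>2 \<partial>P) \<le> a\<^sup>2"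
proof -
  have le: "x\<^sup>2 \<le> (x ^ 4 / a\<^sup>2 + a\<^sup>2) / 2" for x :: real
  proof -
    have "2 * x\<^sup>2 * a\<^sup>2 \<le> x ^ 4 + a\<^sup>2 * a\<^sup>2"
      using sum_squares_bound[of "x\<^sup>2" "a\<^sup>2"] by (simp add: power2_eq_square power4_eq_xxxx mult_ac)
    then show ?thesis
      using a_pos by (simp add: field_simps)
  qed
  have i: "integrable P (\<lambda>\<omega>. (S (e \<omega>) ^ 4 / a\<^sup>2 + a\<^sup>2) / 2)"
    using S4 by simp
  show int: "integrable P (\<lambda>\<omega>. (S (e \<omega>))\<^sup>2)"
    by (rule Bochner_Integration.integrable_bound[OF i]) (use le in \<open>auto intro: order_trans[OF _ abs_ge_self]\<close>)
  have "(\<integral>\<omega>. (S (e \<omega>))\<^sup>2 \<partial>P) \<le> (\<integral>\<omega>. (S (e \<omega>) ^ 4 / a\<^sup>2 + a\<^sup>2) / 2 \<partial>P)"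
    by (intro integral_mono int i le)
  also have "\<dots> = ((\<integral>\<omega>. S (e \<omega>) ^ 4 \<partial>P) / a\<^sup>2 + a\<^sup>2) / 2"
    using S4 by (simp add: prob_space)
  also have "\<dots> \<le> (a ^ 4 / a\<^sup>2 + a\<^sup>2) / 2"
    using S4 by (intro divide_right_mono add_right_mono) auto
  also have "\<dots> = a\<^sup>2"
    using a_pos by (simp add: power2_eq_square power4_eq_xxxx)
  finally show "(\<integral>\<omega>. (S (e \<omega>))\<^sup>2 \<partial>P) \<le> a\<^sup>2" .
qed

lemma S1: "integrable P (\<lambda>\<omega>. S (e \<omega>))" "(\<integral>\<omega>. S (e \<omega>) \<partial>P) \<le> a"
proof -
  show int: "integrable P (\<lambda>\<omega>. S (e \<omega>))"
    by (rule square_integrable_imp_integrable[OF _ S2(1)]) measurable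
  have le: "x \<le> (x\<^sup>2 / a + a) / 2" for x
    using sum_squares_bound[of x a] a_pos by (simp add: field_simps power2_eq_square)
  have "(\<integral>\<omega>. S (e \<omega>) \<partial>P) \<le> (\<integral>\<omega>. ((S (e \<omega>))\<^sup>2 / a + a) / 2 \<partial>P)"
    using S2 by (intro integral_mono int le) auto
  also have "\<dots> = ((\<integral>\<omega>. (S (e \<omega>))\<^sup>2 \<partial>P) / a + a) / 2"
    using S2 by (simp add: prob_space)
  also have "\<dots> \<le> (a\<^sup>2 / a + a) / 2"
    using S2 a_pos by (intro divide_right_mono add_right_mono) auto
  also have "\<dots> = a"
    using a_pos by (simp add: power2_eq_square)
  finally show "(\<integral>\<omega>. S (e \<omega>) \<partial>P) \<le> a" .
qed

lemma D\<phi>_bound: "norm v = 1 \<Longrightarrow> \<bar>D\<phi> z v\<bar> \<le> 2 * M * \<tau>"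
proof -
  assume v: "norm v = 1"
  have "z + \<tau> *\<^sub>R v - (z - \<tau> *\<^sub>R v) = (2 * \<tau>) *\<^sub>R v"
    by (simp add: scaleR_2[symmetric])
  then show ?thesis
    using lipschitz_bound[OF lip, of "z + \<tau> *\<^sub>R v" "z - \<tau> *\<^sub>R v"] v pos by (simp add: D\<phi>_def mult_ac)
qed

lemma D\<delta>_bound: "\<bar>D\<delta> z v\<bar> \<le> 2 * \<Delta>"
  using \<delta>_bound[of "z + \<tau> *\<^sub>R v"] \<delta>_bound[of "z - \<tau> *\<^sub>R v"] unfolding D\<delta>_def by linarith

lemma D\<phi>4: "integrable P (\<lambda>\<omega>. D\<phi> z (e \<omega>) ^ 4)" "(\<integral>\<omega>. D\<phi> z (e \<omega>) ^ 4 \<partial>P) \<le> 144 * (\<tau> * M) ^ 4 / n\<^sup>2"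
proof -
  have "\<bar>D\<phi> z v\<bar> ^ 4 \<le> (2 * M * \<tau>) ^ 4" if "norm v = 1" for v
    using D\<phi>_bound[OF that] by (intro power_mono) auto
  then have "integrable uniform_sphere (\<lambda>v. D\<phi> z v ^ 4)"
    by (intro integrable_uniform_sphere_bounded[where B = "(2 * M * \<tau>) ^ 4"]) (auto simp: power_abs)
  then show "integrable P (\<lambda>\<omega>. D\<phi> z (e \<omega>) ^ 4)"
    by (simp add: integrable_e)
  define F where "F v = \<phi> (z + \<tau> *\<^sub>R v)" for v
  have "(\<tau> * M)-lipschitz_on UNIV F"
  proof (rule lipschitz_onI)
    fix u v
    have "\<bar>F u - F v\<bar> \<le> M * norm (\<tau> *\<^sub>R (u - v))"
      using lipschitz_bound[OF lip, of "z + \<tau> *\<^sub>R u" "z + \<tau> *\<^sub>R v"] by (simp add: F_def algebra_simps)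
    then show "dist (F u) (F v) \<le> \<tau> * M * dist u v"
      using pos by (simp add: dist_norm mult_ac)
  qed (use pos in auto)
  from sphere_fourth_moment[OF this n3]
  have "(\<integral>v. (F v - F (- v)) ^ 4 \<partial>uniform_sphere) \<le> 144 * (\<tau> * M) ^ 4 / n\<^sup>2"
    by (simp only: n_def)
  moreover have "(\<lambda>v. (F v - F (- v)) ^ 4) = (\<lambda>v. D\<phi> z v ^ 4)"
    by (simp add: F_def D\<phi>_def)
  ultimately show "(\<integral>\<omega>. D\<phi> z (e \<omega>) ^ 4 \<partial>P) \<le> 144 * (\<tau> * M) ^ 4 / n\<^sup>2"
    using integral_e[of "\<lambda>v. D\<phi> z v ^ 4"] by simp
qed

lemma noise_sq: "integrable P (\<lambda>\<omega>. (xp \<omega> - xm \<omega>)\<^sup>2)" "(\<integral>\<omega>. (xp \<omega> - xm \<omega>)\<^sup>2 \<partial>P) \<le> 4 * \<sigma>\<^sup>2"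
proof -
  have le: "(x - y)\<^sup>2 \<le> 2 * x\<^sup>2 + 2 * y\<^sup>2" for x y :: real
    using zero_le_power2[of "x + y"] by (simp add: power2_sum power2_diff)
  have i: "integrable P (\<lambda>\<omega>. 2 * (xp \<omega>)\<^sup>2 + 2 * (xm \<omega>)\<^sup>2)"
    using xp xm by simp
  show int: "integrable P (\<lambda>\<omega>. (xp \<omega> - xm \<omega>)\<^sup>2)"
    by (rule Bochner_Integration.integrable_bound[OF i]) (use le in \<open>auto intro: order_trans[OF _ abs_ge_self]\<close>)
  have "(\<integral>\<omega>. (xp \<omega> - xm \<omega>)\<^sup>2 \<partial>P) \<le> (\<integral>\<omega>. 2 * (xp \<omega>)\<^sup>2 + 2 * (xm \<omega>)\<^sup>2 \<partial>P)"
    by (intro integral_mono int i le)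
  also have "\<dots> \<le> 4 * \<sigma>\<^sup>2"
    using xp xm by simp
  finally show "(\<integral>\<omega>. (xp \<omega> - xm \<omega>)\<^sup>2 \<partial>P) \<le> 4 * \<sigma>\<^sup>2" .
qed

lemma
  fixes f :: "'a \<times> 'b \<Rightarrow> real" and g :: "real \<times> real \<Rightarrow> real"
  assumes [measurable]: "f \<in> borel_measurable borel" "g \<in> borel_measurable borel"
    and "integrable P (\<lambda>\<omega>. f (e \<omega>))" "integrable P (\<lambda>\<omega>. g (xp \<omega>, xm \<omega>))"
  shows indep_integrable: "integrable P (\<lambda>\<omega>. f (e \<omega>) * g (xp \<omega>, xm \<omega>))"
    and indep_integral: "(\<integral>\<omega>. f (e \<omega>) * g (xp \<omega>, xm \<omega>) \<partial>P) = (\<integral>\<omega>. f (e \<omega>) \<partial>P) * (\<integral>\<omega>. g (xp \<omega>, xm \<omega>) \<partial>P)"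
  using indep_var_integrable[OF indep_rv_imp_indep_var[OF ind assms(1,2)] assms(3,4)]
    indep_var_lebesgue_integral[OF indep_rv_imp_indep_var[OF ind assms(1,2)] assms(3,4)] by auto

text \<open>A pointwise bound for the dual norm of the estimator, as \<open>est_inner_bound\<close>
  shows; using the gauge avoids a separate dual norm for \<open>q = \<infinity>\<close>.\<close>

definition s :: "'a \<times> 'b \<Rightarrow> ('a \<times> 'b) \<times> real \<times> real \<Rightarrow> real" where
  "s z w = \<bar>amp \<phi> \<delta> \<tau> z w\<bar> * S (fst w)"

lemma W_meas [measurable]: "W \<in> borel_measurable P"
  unfolding W_def[abs_def] by measurable

lemma amp_meas [measurable]: "amp \<phi> \<delta> \<tau> z \<in> borel_measurable borel"
  unfolding amp_def[abs_def] noisy_value_def by measurable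

lemma s_meas [measurable]: "s z \<in> borel_measurable borel"
  unfolding s_def[abs_def] by measurable

lemma s_nonneg: "0 \<le> s z w"
  by (simp add: s_def S_nonneg)

lemma Mall_pos: "Mall > 0"
  unfolding Mall_def M_all_sq_def n_def[symmetric] a_def[symmetric] using pos a_pos n_pos
  by (auto intro!: mult_pos_pos add_pos_nonneg)

text \<open>The difference of oracle values has three parts, coming from \<open>\<phi>\<close>, the
  noise and \<open>\<delta>\<close>; separating their squares costs the outer factor
  \<open>3\<close> of \<open>M_all_sq\<close>. The \<open>\<phi>\<close>-part shares the direction
  \<open>e\<close> with \<open>S\<close>, so AM-GM reduces it to fourth moments. The noise part
  factors by independence, and the \<open>\<delta>\<close>-part is bounded pointwise.\<close>

lemma s_sq: "integrable P (\<lambda>\<omega>. (s z (W \<omega>))\<^sup>2)" "(\<integral>\<omega>. (s z (W \<omega>))\<^sup>2 \<partial>P) \<le> Mall"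
proof -
  \<comment> \<open>the weight for which \<open>l * D\<phi> ^ 4\<close> and \<open>S ^ 4 / l\<close> get the same bound\<close>
  define l where "l = a\<^sup>2 * n / (12 * \<tau>\<^sup>2 * M\<^sup>2)"
  have l: "l > 0"
    using pos a_pos n_pos by (simp add: l_def)
  define U where "U \<omega> = 3 * (n / (2 * \<tau>))\<^sup>2 * ((l * D\<phi> z (e \<omega>) ^ 4 + S (e \<omega>) ^ 4 / l) / 2
    + (S (e \<omega>))\<^sup>2 * (xp \<omega> - xm \<omega>)\<^sup>2 + 4 * \<Delta>\<^sup>2 * (S (e \<omega>))\<^sup>2)" for \<omega>
  have SN: "integrable P (\<lambda>\<omega>. (S (e \<omega>))\<^sup>2 * (xp \<omega> - xm \<omega>)\<^sup>2)"
    "(\<integral>\<omega>. (S (e \<omega>))\<^sup>2 * (xp \<omega> - xm \<omega>)\<^sup>2 \<partial>P) = (\<integral>\<omega>. (S (e \<omega>))\<^sup>2 \<partial>P) * (\<integral>\<omega>. (xp \<omega> - xm \<omega>)\<^sup>2 \<partial>P)"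
  proof -
    have g: "(\<lambda>x::real \<times> real. (fst x - snd x)\<^sup>2) \<in> borel_measurable borel"
      by measurable
    show "integrable P (\<lambda>\<omega>. (S (e \<omega>))\<^sup>2 * (xp \<omega> - xm \<omega>)\<^sup>2)"
      using indep_integrable[of "\<lambda>v. (S v)\<^sup>2" "\<lambda>x. (fst x - snd x)\<^sup>2", OF _ g] S2 noise_sq by simp
    show "(\<integral>\<omega>. (S (e \<omega>))\<^sup>2 * (xp \<omega> - xm \<omega>)\<^sup>2 \<partial>P) = (\<integral>\<omega>. (S (e \<omega>))\<^sup>2 \<partial>P) * (\<integral>\<omega>. (xp \<omega> - xm \<omega>)\<^sup>2 \<partial>P)"
      using indep_integral[of "\<lambda>v. (S v)\<^sup>2" "\<lambda>x. (fst x - snd x)\<^sup>2", OF _ g] S2 noise_sq by simp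
  qed
  have le: "(s z (W \<omega>))\<^sup>2 \<le> U \<omega>" for \<omega>
  proof -
    let ?x = "D\<phi> z (e \<omega>)" and ?y = "xp \<omega> - xm \<omega>" and ?w = "D\<delta> z (e \<omega>)" and ?S = "S (e \<omega>)"
    have "(?x + ?y + ?w)\<^sup>2 \<le> 3 * (?x\<^sup>2 + ?y\<^sup>2 + ?w\<^sup>2)"
      using zero_le_power2[of "?x - ?y"] zero_le_power2[of "?x - ?w"] zero_le_power2[of "?y - ?w"]
      by (simp add: power2_eq_square algebra_simps)
    moreover have "?w\<^sup>2 \<le> 4 * \<Delta>\<^sup>2"
      using power_mono[OF D\<delta>_bound[of z "e \<omega>"], of 2] by (simp add: power_mult_distrib)
    ultimately have "(?x + ?y + ?w)\<^sup>2 * ?S\<^sup>2 \<le> 3 * (?x\<^sup>2 + ?y\<^sup>2 + 4 * \<Delta>\<^sup>2) * ?S\<^sup>2"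
      by (intro mult_right_mono) auto
    also have "\<dots> = 3 * (?x\<^sup>2 * ?S\<^sup>2 + ?S\<^sup>2 * ?y\<^sup>2 + 4 * \<Delta>\<^sup>2 * ?S\<^sup>2)"
      by (simp add: algebra_simps)
    also have "?x\<^sup>2 * ?S\<^sup>2 \<le> (l * ?x ^ 4 + ?S ^ 4 / l) / 2"
    proof -
      have "2 * (l * ?x\<^sup>2) * ?S\<^sup>2 \<le> (l * ?x\<^sup>2)\<^sup>2 + (?S\<^sup>2)\<^sup>2"
        by (rule sum_squares_bound)
      then show ?thesis
        using l by (simp add: field_simps power2_eq_square power4_eq_xxxx)
    qed
    finally have "(n / (2 * \<tau>))\<^sup>2 * ((?x + ?y + ?w)\<^sup>2 * ?S\<^sup>2)
        \<le> (n / (2 * \<tau>))\<^sup>2 * (3 * ((l * ?x ^ 4 + ?S ^ 4 / l) / 2 + ?S\<^sup>2 * ?y\<^sup>2 + 4 * \<Delta>\<^sup>2 * ?S\<^sup>2))"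
      by (intro mult_left_mono) auto
    moreover have "(s z (W \<omega>))\<^sup>2 = (n / (2 * \<tau>))\<^sup>2 * ((?x + ?y + ?w)\<^sup>2 * ?S\<^sup>2)"
      unfolding s_def power_mult_distrib power2_abs amp_eq by (simp add: W_def)
    ultimately have "(s z (W \<omega>))\<^sup>2
        \<le> (n / (2 * \<tau>))\<^sup>2 * (3 * ((l * ?x ^ 4 + ?S ^ 4 / l) / 2 + ?S\<^sup>2 * ?y\<^sup>2 + 4 * \<Delta>\<^sup>2 * ?S\<^sup>2))"
      by (simp only:)
    also have "\<dots> = U \<omega>"
      unfolding U_def by (simp only: mult_ac)
    finally show ?thesis .
  qed
  have Ui: "integrable P U"
    unfolding U_def[abs_def] using D\<phi>4 S4 S2 SN by simp
  show int: "integrable P (\<lambda>\<omega>. (s z (W \<omega>))\<^sup>2)"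
    by (rule Bochner_Integration.integrable_bound[OF Ui]) (use le in \<open>auto intro: order_trans[OF _ abs_ge_self]\<close>)
  have "(\<integral>\<omega>. (s z (W \<omega>))\<^sup>2 \<partial>P) \<le> (\<integral>\<omega>. U \<omega> \<partial>P)"
    by (intro integral_mono int Ui le)
  also have "\<dots> = 3 * (n / (2 * \<tau>))\<^sup>2 * ((l * (\<integral>\<omega>. D\<phi> z (e \<omega>) ^ 4 \<partial>P) + (\<integral>\<omega>. S (e \<omega>) ^ 4 \<partial>P) / l) / 2
      + (\<integral>\<omega>. (S (e \<omega>))\<^sup>2 \<partial>P) * (\<integral>\<omega>. (xp \<omega> - xm \<omega>)\<^sup>2 \<partial>P) + 4 * \<Delta>\<^sup>2 * (\<integral>\<omega>. (S (e \<omega>))\<^sup>2 \<partial>P))"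
    unfolding U_def[abs_def] using D\<phi>4 S4 S2 SN by simp
  also have "\<dots> \<le> 3 * (n / (2 * \<tau>))\<^sup>2 * ((l * (144 * (\<tau> * M) ^ 4 / n\<^sup>2) + a ^ 4 / l) / 2
      + a\<^sup>2 * (4 * \<sigma>\<^sup>2) + 4 * \<Delta>\<^sup>2 * a\<^sup>2)"
    using D\<phi>4 S4 S2 noise_sq l
    by (intro mult_left_mono add_mono divide_right_mono mult_mono) auto
  also have "\<dots> = Mall"
  proof -
    \<comment> \<open>The common value of the two terms produced by AM-GM. Multiplied by the squared
      prefactor \<open>Q\<close> of the estimator it becomes
      \<open>3 * n * M\<^sup>2 * a\<^sup>2\<close>.\<close>
    define X where "X = 12 * \<tau>\<^sup>2 * M\<^sup>2 * a\<^sup>2 / n"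
    define Q where "Q = (n / (2 * \<tau>))\<^sup>2"
    have X1: "l * (144 * (\<tau> * M) ^ 4 / n\<^sup>2) = X"
      using pos a_pos n_pos by (simp add: l_def X_def field_simps power2_eq_square power4_eq_xxxx)
    have X2: "a ^ 4 / l = X"
      using pos a_pos n_pos by (simp add: l_def X_def field_simps power2_eq_square power4_eq_xxxx)
    have QX: "Q * X = 3 * n * M\<^sup>2 * a\<^sup>2"
      using pos n_pos by (simp add: Q_def X_def field_simps power2_eq_square)
    have Q4: "Q * 4 = n\<^sup>2 / \<tau>\<^sup>2"
      using pos by (simp add: Q_def power_divide power_mult_distrib)
    have "3 * Q * ((X + X) / 2 + a\<^sup>2 * (4 * \<sigma>\<^sup>2) + 4 * \<Delta>\<^sup>2 * a\<^sup>2) = 3 * (Q * X + (Q * 4) * ((\<sigma>\<^sup>2 + \<Delta>\<^sup>2) * a\<^sup>2))"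
      by (simp add: algebra_simps)
    also have "\<dots> = Mall"
      unfolding QX Q4 Mall_def M_all_sq_def n_def[symmetric] a_def[symmetric]
      by (simp add: algebra_simps add_divide_distrib)
    finally show ?thesis
      unfolding X1 X2 Q_def .
  qed
  finally show "(\<integral>\<omega>. (s z (W \<omega>))\<^sup>2 \<partial>P) \<le> Mall" .
qed

lemma s_int: "integrable P (\<lambda>\<omega>. s z (W \<omega>))" "(\<integral>\<omega>. s z (W \<omega>) \<partial>P) \<le> sqrt Mall"
proof -
  define K where "K = sqrt Mall"
  have K: "K > 0" "K * K = Mall"
    using Mall_pos by (auto simp: K_def)
  show int: "integrable P (\<lambda>\<omega>. s z (W \<omega>))"
    by (rule square_integrable_imp_integrable[OF _ s_sq(1)]) measurable
  have le: "x \<le> (x\<^sup>2 / K + K) / 2" for x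
    using sum_squares_bound[of x K] K by (simp add: field_simps power2_eq_square)
  have "(\<integral>\<omega>. s z (W \<omega>) \<partial>P) \<le> (\<integral>\<omega>. ((s z (W \<omega>))\<^sup>2 / K + K) / 2 \<partial>P)"
    using s_sq by (intro integral_mono int le) auto
  also have "\<dots> = ((\<integral>\<omega>. (s z (W \<omega>))\<^sup>2 \<partial>P) / K + K) / 2"
    using s_sq by (simp add: prob_space)
  also have "\<dots> \<le> (Mall / K + K) / 2"
    using s_sq K by (intro divide_right_mono add_right_mono) auto
  also have "\<dots> = K"
    using K by (simp add: field_simps)
  finally show "(\<integral>\<omega>. s z (W \<omega>) \<partial>P) \<le> sqrt Mall"
    by (simp add: K_def)
qed

definition est :: "'a \<times> 'b \<Rightarrow> ('a \<times> 'b) \<times> real \<times> real \<Rightarrow> 'a \<times> 'b" where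
  "est z w = amp \<phi> \<delta> \<tau> z w *\<^sub>R flip_snd (fst w)"

definition Gbar :: "'a \<times> 'b \<Rightarrow> 'a \<times> 'b" where
  "Gbar z = (\<integral>\<omega>. est z (W \<omega>) \<partial>P)"

lemma est_meas [measurable]: "est z \<in> borel_measurable borel"
  unfolding est_def[abs_def] by measurable

lemma est_inner_bound: "\<bar>est z w \<bullet> h\<bar> \<le> s z w * p_norm p h"
proof -
  have "\<bar>est z w \<bullet> h\<bar> = \<bar>amp \<phi> \<delta> \<tau> z w\<bar> * \<bar>fst w \<bullet> flip_snd h\<bar>"
    by (simp add: est_def inner_flip_snd abs_mult)
  also have "\<dots> \<le> \<bar>amp \<phi> \<delta> \<tau> z w\<bar> * (S (fst w) * p_norm p h)"
    using S_dual[of "fst w" "flip_snd h"] by (intro mult_left_mono) auto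
  finally show ?thesis
    by (simp add: s_def mult_ac)
qed

lemma est_int: "integrable P (\<lambda>\<omega>. est z (W \<omega>))"
proof (rule Bochner_Integration.integrable_bound)
  let ?U = "\<lambda>\<omega>. n / (2 * \<tau>) * (2 * M * \<tau> + \<bar>xp \<omega>\<bar> + \<bar>xm \<omega>\<bar> + 2 * \<Delta>)"
  show "integrable P ?U"
    using xp xm by simp
  show "AE \<omega> in P. norm (est z (W \<omega>)) \<le> norm (?U \<omega>)"
  proof (rule AE_I2)
    fix \<omega> assume "\<omega> \<in> space P"
    then have e: "norm (e \<omega>) = 1" by (rule e_sphere)
    have "norm (est z (W \<omega>)) = \<bar>amp \<phi> \<delta> \<tau> z (W \<omega>)\<bar>"
      using e by (simp add: est_def W_def)
    also have "\<dots> = n / (2 * \<tau>) * \<bar>D\<phi> z (e \<omega>) + (xp \<omega> - xm \<omega>) + D\<delta> z (e \<omega>)\<bar>"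
      unfolding amp_eq using pos n_pos by (simp add: abs_mult)
    also have "\<dots> \<le> ?U \<omega>"
      using D\<phi>_bound[OF e, of z] D\<delta>_bound[of z "e \<omega>"] pos n_pos by (intro mult_left_mono) auto
    finally show "norm (est z (W \<omega>)) \<le> norm (?U \<omega>)"
      using abs_ge_self[of "?U \<omega>"] unfolding real_norm_def by linarith
  qed
qed measurable

lemma Gbar_inner: "Gbar z \<bullet> h = (\<integral>\<omega>. est z (W \<omega>) \<bullet> h \<partial>P)"
  unfolding Gbar_def by (rule integral_inner_left[symmetric]) (use est_int in simp)

lemma Gbar_dual: "\<bar>Gbar z \<bullet> h\<bar> \<le> sqrt Mall * p_norm p h"
proof -
  have "\<bar>Gbar z \<bullet> h\<bar> \<le> (\<integral>\<omega>. s z (W \<omega>) * p_norm p h \<partial>P)"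
    unfolding Gbar_inner using est_int s_int est_inner_bound
    by (intro order_trans[OF integral_abs_bound] integral_mono) auto
  also have "\<dots> \<le> sqrt Mall * p_norm p h"
    using s_int by (simp add: mult_right_mono)
  finally show ?thesis .
qed

text \<open>In the mean the \<open>\<phi>\<close>-part is exactly the gradient of the ball average,
  the noise part vanishes by independence from the direction, and the \<open>\<delta>\<close>-part
  is a bias controlled by the mean of \<open>S\<close>. A lower bound suffices, because the regret
  bounds inner products with the mean estimator from above.\<close>

lemma Gbar_lower: "ball_avg_grad \<phi> \<tau> z \<bullet> flip_snd h - \<Delta> * n * a / \<tau> * p_norm p h \<le> Gbar z \<bullet> h"
proof -
  let ?k = "flip_snd h"
  have k_int: "integrable P (\<lambda>\<omega>. f (e \<omega>) * (e \<omega> \<bullet> ?k))"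
    if [measurable]: "f \<in> borel_measurable borel" and B: "\<And>v. norm v = 1 \<Longrightarrow> \<bar>f v\<bar> \<le> B" for f B
  proof -
    have "integrable uniform_sphere (\<lambda>v. f v * (v \<bullet> ?k))"
    proof (rule integrable_uniform_sphere_bounded)
      fix v :: "'a \<times> 'b" assume v: "norm v = 1"
      show "norm (f v * (v \<bullet> ?k)) \<le> B * norm ?k"
        unfolding norm_mult using B[OF v] Cauchy_Schwarz_ineq2[of v ?k] v
        by (intro mult_mono) auto
    qed measurable
    then show ?thesis
      by (simp add: integrable_e)
  qed
  have 1: "integrable P (\<lambda>\<omega>. D\<phi> z (e \<omega>) * (e \<omega> \<bullet> ?k))"
    by (rule k_int[of "D\<phi> z" "2 * M * \<tau>"]) (use D\<phi>_bound in auto)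
  have 3: "integrable P (\<lambda>\<omega>. D\<delta> z (e \<omega>) * (e \<omega> \<bullet> ?k))"
    by (rule k_int[of "D\<delta> z" "2 * \<Delta>"]) (use D\<delta>_bound in auto)
  have g: "(\<lambda>x::real \<times> real. fst x - snd x) \<in> borel_measurable borel"
    by measurable
  have ek: "integrable P (\<lambda>\<omega>. e \<omega> \<bullet> ?k)"
    using k_int[of "\<lambda>_. 1" 1] by simp
  have 2: "integrable P (\<lambda>\<omega>. (e \<omega> \<bullet> ?k) * (xp \<omega> - xm \<omega>))"
    using indep_integrable[of "\<lambda>v. v \<bullet> ?k" "\<lambda>x. fst x - snd x", OF _ g] ek xp xm by simp
  have 20: "(\<integral>\<omega>. (e \<omega> \<bullet> ?k) * (xp \<omega> - xm \<omega>) \<partial>P) = 0"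
    using indep_integral[of "\<lambda>v. v \<bullet> ?k" "\<lambda>x. fst x - snd x", OF _ g] ek xp xm by simp
  have 10: "(\<integral>\<omega>. D\<phi> z (e \<omega>) * (e \<omega> \<bullet> ?k) \<partial>P) = 2 * \<tau> / n * (ball_avg_grad \<phi> \<tau> z \<bullet> ?k)"
  proof -
    let ?f = "\<lambda>v. \<phi> (z + \<tau> *\<^sub>R v) * (v \<bullet> ?k)"
    have fi: "integrable uniform_sphere ?f"
    proof (rule integrable_uniform_sphere_bounded)
      fix v :: "'a \<times> 'b" assume v: "norm v = 1"
      show "norm (?f v) \<le> (\<bar>\<phi> z\<bar> + M * \<bar>\<tau>\<bar>) * norm ?k"
        unfolding norm_mult using lipschitz_shift_bound[OF lip, of v z \<tau>] Cauchy_Schwarz_ineq2[of v ?k] v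
        by (intro mult_mono) auto
    qed measurable
    \<comment> \<open>The sphere is symmetric and \<open>v \<bullet> ?k\<close> is odd, so the
      symmetric difference in \<open>D\<phi>\<close> contributes the one-sided integral
      twice.\<close>
    have sym: "(\<integral>v. ?f v \<partial>uniform_sphere) = (\<integral>v. ?f (- v) \<partial>uniform_sphere)"
      by (subst uniform_sphere_uminus[symmetric], subst integral_distr) auto
    have fi': "integrable uniform_sphere (\<lambda>v. ?f (- v))"
      using fi by (subst (asm) uniform_sphere_uminus[symmetric], subst (asm) integrable_distr_eq) auto
    have "(\<integral>\<omega>. D\<phi> z (e \<omega>) * (e \<omega> \<bullet> ?k) \<partial>P) = (\<integral>v. D\<phi> z v * (v \<bullet> ?k) \<partial>uniform_sphere)"
      by (simp add: integral_e)
    also have "\<dots> = (\<integral>v. ?f v + ?f (- v) \<partial>uniform_sphere)"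
      by (simp add: D\<phi>_def algebra_simps)
    also have "\<dots> = 2 * (\<integral>v. ?f v \<partial>uniform_sphere)"
      using fi fi' sym by (subst Bochner_Integration.integral_add) auto
    also have "\<dots> = 2 * \<tau> / n * (ball_avg_grad \<phi> \<tau> z \<bullet> ?k)"
    proof -
      have "ball_avg_grad \<phi> \<tau> z \<bullet> ?k = n / \<tau> * (\<integral>v. ?f v \<partial>uniform_sphere)"
        unfolding n_def by (rule ball_avg_grad_inner[OF lip])
      then show ?thesis
        using pos n_pos by simp
    qed
    finally show ?thesis .
  qed
  have 30: "- (2 * \<Delta> * a * p_norm p h) \<le> (\<integral>\<omega>. D\<delta> z (e \<omega>) * (e \<omega> \<bullet> ?k) \<partial>P)"
  proof -
    have "(\<integral>\<omega>. S (e \<omega>) * (2 * \<Delta> * p_norm p h) \<partial>P) \<le> a * (2 * \<Delta> * p_norm p h)"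
      using S1 pos by (simp add: mult_right_mono)
    moreover have "\<bar>\<integral>\<omega>. D\<delta> z (e \<omega>) * (e \<omega> \<bullet> ?k) \<partial>P\<bar> \<le> (\<integral>\<omega>. S (e \<omega>) * (2 * \<Delta> * p_norm p h) \<partial>P)"
    proof (rule order_trans[OF integral_abs_bound], rule integral_mono)
      fix \<omega>
      have "\<bar>D\<delta> z (e \<omega>) * (e \<omega> \<bullet> ?k)\<bar> \<le> (2 * \<Delta>) * (S (e \<omega>) * p_norm p ?k)"
        unfolding abs_mult using D\<delta>_bound[of z "e \<omega>"] S_dual[of "e \<omega>" ?k] pos by (intro mult_mono) simp_all
      then show "\<bar>D\<delta> z (e \<omega>) * (e \<omega> \<bullet> ?k)\<bar> \<le> S (e \<omega>) * (2 * \<Delta> * p_norm p h)"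
        by (simp add: mult_ac)
    qed (use 3 S1 in auto)
    ultimately show ?thesis
      by (simp add: mult_ac)
  qed
  have "Gbar z \<bullet> h = (\<integral>\<omega>. n / (2 * \<tau>) * (D\<phi> z (e \<omega>) * (e \<omega> \<bullet> ?k) + (e \<omega> \<bullet> ?k) * (xp \<omega> - xm \<omega>) + D\<delta> z (e \<omega>) * (e \<omega> \<bullet> ?k)) \<partial>P)"
    unfolding Gbar_inner est_def inner_scaleR_left amp_eq by (simp add: W_def inner_flip_snd algebra_simps)
  also have "\<dots> = n / (2 * \<tau>) * ((\<integral>\<omega>. D\<phi> z (e \<omega>) * (e \<omega> \<bullet> ?k) \<partial>P) + (\<integral>\<omega>. (e \<omega> \<bullet> ?k) * (xp \<omega> - xm \<omega>) \<partial>P) + (\<integral>\<omega>. D\<delta> z (e \<omega>) * (e \<omega> \<bullet> ?k) \<partial>P))"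
    using 1 2 3 by simp
  also have "\<dots> \<ge> n / (2 * \<tau>) * (2 * \<tau> / n * (ball_avg_grad \<phi> \<tau> z \<bullet> ?k) + 0 + - (2 * \<Delta> * a * p_norm p h))"
    unfolding 10 20 using 30 pos n_pos by (intro mult_left_mono add_mono) auto
  also have "n / (2 * \<tau>) * (2 * \<tau> / n * (ball_avg_grad \<phi> \<tau> z \<bullet> ?k) + 0 + - (2 * \<Delta> * a * p_norm p h))
      = ball_avg_grad \<phi> \<tau> z \<bullet> ?k - \<Delta> * n * a / \<tau> * p_norm p h"
    using pos n_pos by (simp add: field_simps)
  finally show ?thesis .
qed

end

subsection \<open>Stochastic mirror descent\<close>

text \<open>A state computed from the variables before step \<open>k\<close> is independent of
  \<open>W k\<close>. The product law is the form in which this is used: means given the past become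
  inner integrals.\<close>

lemma (in prob_space) distr_history_pair:
  fixes W :: "nat \<Rightarrow> 'a \<Rightarrow> 'v::second_countable_topology"
    and f :: "(nat \<Rightarrow> 'v) \<Rightarrow> 's::second_countable_topology"
  assumes ind: "indep_vars (\<lambda>_. borel) W {..N}" and k: "k \<le> N"
    and f [measurable]: "f \<in> borel_measurable (PiM {..<k} (\<lambda>_. borel))"
  shows "distr M (borel \<Otimes>\<^sub>M borel) (\<lambda>\<omega>. (f (restrict (\<lambda>i. W i \<omega>) {..<k}), W k \<omega>))
    = distr M borel (\<lambda>\<omega>. f (restrict (\<lambda>i. W i \<omega>) {..<k})) \<Otimes>\<^sub>M distr M borel (W k)"
proof -
  let ?A = "PiM {..<k} (\<lambda>_. borel :: 'v measure)" and ?B = "PiM {k} (\<lambda>_. borel :: 'v measure)"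
  let ?X = "\<lambda>\<omega>. restrict (\<lambda>i. W i \<omega>) {..<k}" and ?Y = "\<lambda>\<omega>. restrict (\<lambda>i. W i \<omega>) {k}"
  have iv: "indep_var ?A ?X ?B ?Y"
    by (rule indep_var_restrict[OF ind]) (use k in auto)
  have [measurable]: "?X \<in> measurable M ?A" "?Y \<in> measurable M ?B"
    using indep_var_rv1[OF iv] indep_var_rv2[OF iv] by auto
  have Wk: "W k = (\<lambda>\<omega>. ?Y \<omega> k)"
    by simp
  have [measurable]: "(\<lambda>y. y k) \<in> borel_measurable ?B"
    by (rule measurable_component_singleton) simp
  have eq: "distr M ?A ?X \<Otimes>\<^sub>M distr M ?B ?Y = distr M (?A \<Otimes>\<^sub>M ?B) (\<lambda>\<omega>. (?X \<omega>, ?Y \<omega>))"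
    using iv unfolding indep_var_distribution_eq by simp
  interpret Y: prob_space "distr M ?B ?Y"
    by (rule prob_space_distr) measurable
  have "distr M borel (\<lambda>\<omega>. f (?X \<omega>)) \<Otimes>\<^sub>M distr M borel (\<lambda>\<omega>. ?Y \<omega> k)
      = distr (distr M ?A ?X) borel f \<Otimes>\<^sub>M distr (distr M ?B ?Y) borel (\<lambda>y. y k)"
    by (subst (1 2) distr_distr) (auto simp: comp_def)
  also have "\<dots> = distr (distr M ?A ?X \<Otimes>\<^sub>M distr M ?B ?Y) (borel \<Otimes>\<^sub>M borel) (\<lambda>(x, y). (f x, y k))"
    by (rule pair_measure_distr) (auto intro!: prob_space_imp_sigma_finite Y.prob_space_distr)
  also have "\<dots> = distr M (borel \<Otimes>\<^sub>M borel) (\<lambda>\<omega>. (f (?X \<omega>), ?Y \<omega> k))"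
    unfolding eq by (subst distr_distr) (auto simp: comp_def)
  finally show ?thesis
    unfolding Wk[symmetric] by simp
qed

text \<open>Abstracts from the saddle point problem: \<open>g\<close> is a stochastic estimator with
  mean \<open>G\<close>, \<open>s\<close> bounds its dual norm, and \<open>K\<close> bounds the mean
  of \<open>s\<close> squared. \<open>G\<close> carries the index \<open>k\<close> because the laws
  of the \<open>W k\<close> may differ.\<close>

locale mirror_descent = prox_setup d Z p + prob_space P
  for d :: "'c::euclidean_space \<Rightarrow> real" and Z :: "'c set" and p :: real and P :: "'w measure" +
  fixes W :: "nat \<Rightarrow> 'w \<Rightarrow> 'v::second_countable_topology"
    and g :: "'c \<Rightarrow> 'v \<Rightarrow> 'c" and s :: "'c \<Rightarrow> 'v \<Rightarrow> real" and G :: "nat \<Rightarrow> 'c \<Rightarrow> 'c"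
    and K \<gamma> :: real and N :: nat and z0 :: 'c
  assumes g_meas [measurable]: "(\<lambda>q. g (fst q) (snd q)) \<in> borel_measurable borel"
    and s_meas [measurable]: "(\<lambda>q. s (fst q) (snd q)) \<in> borel_measurable borel"
    and ind: "indep_vars (\<lambda>_. borel) W {..N}"
    and g_int: "\<And>k z. k \<le> N \<Longrightarrow> integrable P (\<lambda>\<omega>. g z (W k \<omega>))"
    and G_eq: "\<And>k z. k \<le> N \<Longrightarrow> G k z = (\<integral>\<omega>. g z (W k \<omega>) \<partial>P)"
    and s_nonneg: "\<And>z w. 0 \<le> s z w"
    and s_sq: "\<And>k z. k \<le> N \<Longrightarrow> (\<integral>\<^sup>+\<omega>. ennreal ((s z (W k \<omega>))\<^sup>2) \<partial>P) \<le> ennreal K"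
    and g_dual: "\<And>z w h. \<bar>g z w \<bullet> h\<bar> \<le> s z w * p_norm p h"
    and G_dual: "\<And>k z h. k \<le> N \<Longrightarrow> \<bar>G k z \<bullet> h\<bar> \<le> sqrt K * p_norm p h"
    and pos: "K > 0" "\<gamma> > 0" and z0: "z0 \<in> Z"
begin

text \<open>The second component is a shadow sequence driven by the martingale differences; it makes the
  regret bound uniform in the comparison point. Its step size \<open>\<gamma> / 2\<close> balances the two error terms.\<close>

primrec hist :: "nat \<Rightarrow> (nat \<Rightarrow> 'v) \<Rightarrow> 'c \<times> 'c" where
  "hist 0 x = (z0, z0)"
| "hist (Suc k) x =
    (prox' (fst (hist k x), \<gamma> *\<^sub>R g (fst (hist k x)) (x k)),
     prox' (snd (hist k x), (\<gamma> / 2) *\<^sub>R (G k (fst (hist k x)) - g (fst (hist k x)) (x k))))"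

lemma hist_cong: "(\<And>i. i < k \<Longrightarrow> x i = y i) \<Longrightarrow> hist k x = hist k y"
  by (induction k) auto

lemma hist_in: "fst (hist k x) \<in> Z" "snd (hist k x) \<in> Z"
  by (induction k) (auto simp: z0 prox'_in)

lemma W_meas [measurable]: "k \<le> N \<Longrightarrow> W k \<in> borel_measurable P"
  using ind by (auto simp: indep_vars_def)

lemma prob_space_law: "k \<le> N \<Longrightarrow> prob_space (distr P borel (W k))"
  by (intro prob_space_distr W_meas)

lemma g_meas2: "(\<lambda>(z, w). g z w) \<in> borel_measurable (borel \<Otimes>\<^sub>M borel)"
  using g_meas by (simp add: borel_prod case_prod_unfold)

lemma g_meas_w [measurable]: "g z \<in> borel_measurable borel"
  using measurable_compose[OF _ g_meas, of "\<lambda>w. (z, w)" borel] by simp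

lemma G_meas:
  assumes k: "k \<le> N"
  shows "G k \<in> borel_measurable borel"
proof -
  interpret L: prob_space "distr P borel (W k)"
    by (rule prob_space_law[OF k])
  have "G k = (\<lambda>z. \<integral>w. g z w \<partial>distr P borel (W k))"
    using k by (auto simp: G_eq fun_eq_iff integral_distr)
  moreover have "(\<lambda>z. \<integral>w. g z w \<partial>distr P borel (W k)) \<in> borel_measurable borel"
    by (rule L.borel_measurable_lebesgue_integral) (use g_meas2 in simp)
  ultimately show ?thesis by simp
qed

text \<open>The index set \<open>I\<close> is arbitrary because the induction step uses
  \<open>hist k\<close> on a product that also contains the coordinate \<open>k\<close>.\<close>

lemma hist_meas:
  assumes "k \<le> Suc N" "{..<k} \<subseteq> I"
  shows "hist k \<in> borel_measurable (PiM I (\<lambda>_. borel))"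
  using assms
proof (induction k)
  case (Suc k)
  have "{..<k} \<subseteq> I"
    using Suc.prems(2) by force
  with Suc have [measurable]: "hist k \<in> borel_measurable (PiM I (\<lambda>_. borel))" "G k \<in> borel_measurable borel"
    by (auto intro: G_meas)
  have [measurable]: "(\<lambda>x. x k) \<in> borel_measurable (PiM I (\<lambda>_. borel))"
    using Suc by (intro measurable_component_singleton) auto
  have [measurable]: "(\<lambda>x. g (fst (hist k x)) (x k)) \<in> borel_measurable (PiM I (\<lambda>_. borel))"
    using measurable_compose[OF _ g_meas, of "\<lambda>x. (fst (hist k x), x k)" "PiM I (\<lambda>_. borel)"] by simp
  show ?case
    by simp
next
  case 0
  have "hist 0 = (\<lambda>_. (z0, z0))"
    by auto
  then show ?case
    by simp
qed

definition st :: "nat \<Rightarrow> 'w \<Rightarrow> 'c \<times> 'c" where "st k \<omega> = hist k (\<lambda>i. W i \<omega>)"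

abbreviation zz :: "nat \<Rightarrow> 'w \<Rightarrow> 'c" where "zz k \<omega> \<equiv> fst (st k \<omega>)"
abbreviation vv :: "nat \<Rightarrow> 'w \<Rightarrow> 'c" where "vv k \<omega> \<equiv> snd (st k \<omega>)"

lemma st_in: "zz k \<omega> \<in> Z" "vv k \<omega> \<in> Z"
  by (auto simp: st_def hist_in)

lemma st_eq_restrict: "st k \<omega> = hist k (restrict (\<lambda>i. W i \<omega>) {..<k})"
  unfolding st_def by (rule hist_cong) simp

lemma st_meas:
  assumes "k \<le> Suc N"
  shows "st k \<in> borel_measurable P"
proof -
  have "(\<lambda>\<omega>. restrict (\<lambda>i. W i \<omega>) {..<k}) \<in> measurable P (PiM {..<k} (\<lambda>_. borel))"
    using assms by (intro measurable_restrict W_meas) auto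
  from measurable_compose[OF this hist_meas[of k "{..<k}"]] assms show ?thesis
    by (simp add: st_eq_restrict[abs_def])
qed

lemma joint_law:
  assumes k: "k \<le> N"
  shows "distr P (borel \<Otimes>\<^sub>M borel) (\<lambda>\<omega>. (st k \<omega>, W k \<omega>)) = distr P borel (st k) \<Otimes>\<^sub>M distr P borel (W k)"
  unfolding st_eq_restrict[abs_def]
  by (rule distr_history_pair[OF ind k]) (use k in \<open>auto intro: hist_meas\<close>)

abbreviation sk :: "nat \<Rightarrow> 'w \<Rightarrow> real" where "sk k \<omega> \<equiv> s (zz k \<omega>) (W k \<omega>)"
abbreviation \<eta>k :: "nat \<Rightarrow> 'w \<Rightarrow> 'c" where "\<eta>k k \<omega> \<equiv> G k (zz k \<omega>) - g (zz k \<omega>) (W k \<omega>)"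

text \<open>The hypothesis bounds the second moment at each fixed query point. The product law
  allows the random query point to be frozen while integrating over \<open>W k\<close>.\<close>

lemma sk_sq:
  assumes k: "k \<le> N"
  shows "integrable P (\<lambda>\<omega>. (sk k \<omega>)\<^sup>2)" "(\<integral>\<omega>. (sk k \<omega>)\<^sup>2 \<partial>P) \<le> K"
proof -
  interpret L: prob_space "distr P borel (W k)"
    by (rule prob_space_law[OF k])
  interpret ST: prob_space "distr P borel (st k)"
    by (intro prob_space_distr st_meas) (use k in simp)
  have [measurable]: "st k \<in> borel_measurable P" "W k \<in> borel_measurable P"
    using k by (auto intro: st_meas)
  have s2: "(\<lambda>q. s (fst (fst q)) (snd q)) \<in> borel_measurable (borel \<Otimes>\<^sub>M borel :: (('c \<times> 'c) \<times> 'v) measure)"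
    using measurable_compose[OF _ s_meas, of "\<lambda>q. (fst (fst q), snd q)" "borel :: (('c \<times> 'c) \<times> 'v) measure"]
    by (simp add: borel_prod)
  have [measurable]: "sk k \<in> borel_measurable P"
    using measurable_compose[OF _ s_meas, of "\<lambda>\<omega>. (zz k \<omega>, W k \<omega>)" P] by simp
  have [measurable]: "s z \<in> borel_measurable borel" for z
    using measurable_compose[OF _ s_meas, of "\<lambda>w. (z, w)" borel] by simp
  have "(\<integral>\<^sup>+\<omega>. ennreal ((sk k \<omega>)\<^sup>2) \<partial>P)
      = (\<integral>\<^sup>+q. ennreal ((s (fst (fst q)) (snd q))\<^sup>2) \<partial>distr P (borel \<Otimes>\<^sub>M borel) (\<lambda>\<omega>. (st k \<omega>, W k \<omega>)))"
    using s2 by (subst nn_integral_distr) auto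
  also have "\<dots> = (\<integral>\<^sup>+x. \<integral>\<^sup>+w. ennreal ((s (fst x) w)\<^sup>2) \<partial>distr P borel (W k) \<partial>distr P borel (st k))"
  proof -
    have se: "sets (distr P borel (st k) \<Otimes>\<^sub>M distr P borel (W k)) = sets (borel \<Otimes>\<^sub>M borel :: (('c \<times> 'c) \<times> 'v) measure)"
      by (rule sets_pair_measure_cong) auto
    have "(\<lambda>q. ennreal ((s (fst (fst q)) (snd q))\<^sup>2)) \<in> borel_measurable (borel \<Otimes>\<^sub>M borel :: (('c \<times> 'c) \<times> 'v) measure)"
      using s2 by measurable
    then have m: "(\<lambda>q. ennreal ((s (fst (fst q)) (snd q))\<^sup>2)) \<in> borel_measurable (distr P borel (st k) \<Otimes>\<^sub>M distr P borel (W k))"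
      by (simp only: measurable_cong_sets[OF se refl])
    show ?thesis
      unfolding joint_law[OF k] using L.nn_integral_fst[OF m] by (simp only: fst_conv snd_conv)
  qed
  also have "\<dots> \<le> (\<integral>\<^sup>+x. ennreal K \<partial>distr P borel (st k))"
    using s_sq[OF k] by (intro nn_integral_mono) (simp add: nn_integral_distr)
  also have "\<dots> = ennreal K"
    using ST.emeasure_space_1 by simp
  finally have le: "(\<integral>\<^sup>+\<omega>. ennreal ((sk k \<omega>)\<^sup>2) \<partial>P) \<le> ennreal K" .
  then show int: "integrable P (\<lambda>\<omega>. (sk k \<omega>)\<^sup>2)"
    by (intro integrableI_bounded) (auto intro: le_less_trans)
  show "(\<integral>\<omega>. (sk k \<omega>)\<^sup>2 \<partial>P) \<le> K"
    using le pos int by (subst (asm) nn_integral_eq_integral) auto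
qed

lemma \<eta>_bound:
  assumes k: "k \<le> N"
  shows "\<bar>(G k z - g z w) \<bullet> h\<bar> \<le> (sqrt K + s z w) * p_norm p h"
proof -
  have "\<bar>(G k z - g z w) \<bullet> h\<bar> \<le> \<bar>G k z \<bullet> h\<bar> + \<bar>g z w \<bullet> h\<bar>"
    unfolding inner_diff_left by linarith
  also have "\<dots> \<le> (sqrt K + s z w) * p_norm p h"
    using G_dual[OF k, of z h] g_dual[of z w h] by (simp add: algebra_simps)
  finally show ?thesis .
qed

text \<open>Both \<open>zz k\<close> and the shadow point \<open>vv k\<close> are determined before
  \<open>W k\<close>. With the state frozen, the estimator error has mean zero and is tested against
  a constant vector.\<close>

lemma \<eta>_mean_zero:
  assumes k: "k \<le> N"
  shows "integrable P (\<lambda>\<omega>. \<eta>k k \<omega> \<bullet> (zz k \<omega> - vv k \<omega>))" "(\<integral>\<omega>. \<eta>k k \<omega> \<bullet> (zz k \<omega> - vv k \<omega>) \<partial>P) = 0"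
proof -
  interpret L: prob_space "distr P borel (W k)"
    by (rule prob_space_law[OF k])
  interpret ST: prob_space "distr P borel (st k)"
    by (intro prob_space_distr st_meas) (use k in simp)
  interpret pair_sigma_finite "distr P borel (st k)" "distr P borel (W k)" ..
  have [measurable]: "st k \<in> borel_measurable P" "W k \<in> borel_measurable P" "G k \<in> borel_measurable borel"
    using k by (auto intro: st_meas G_meas)
  define \<zeta> where "\<zeta> q = (G k (fst (fst q)) - g (fst (fst q)) (snd q)) \<bullet> (fst (fst q) - snd (fst q))"
    for q :: "('c \<times> 'c) \<times> 'v"
  have [measurable]: "(\<lambda>q. g (fst (fst q)) (snd q)) \<in> borel_measurable (borel :: (('c \<times> 'c) \<times> 'v) measure)"
    using measurable_compose[OF _ g_meas, of "\<lambda>q. (fst (fst q), snd q)" "borel :: (('c \<times> 'c) \<times> 'v) measure"] by simp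
  have "\<zeta> \<in> borel_measurable borel"
    unfolding \<zeta>_def[abs_def] by measurable
  then have z_meas [measurable]: "\<zeta> \<in> borel_measurable (borel \<Otimes>\<^sub>M borel)"
    by (simp add: borel_prod)
  have z_eq: "\<eta>k k \<omega> \<bullet> (zz k \<omega> - vv k \<omega>) = \<zeta> (st k \<omega>, W k \<omega>)" for \<omega>
    by (simp add: \<zeta>_def)
  show int: "integrable P (\<lambda>\<omega>. \<eta>k k \<omega> \<bullet> (zz k \<omega> - vv k \<omega>))"
  proof (rule Bochner_Integration.integrable_bound)
    show "integrable P (\<lambda>\<omega>. (sqrt K + (1 + (sk k \<omega>)\<^sup>2)) * \<Omega>)"
      using sk_sq[OF k] by simp
    show "(\<lambda>\<omega>. \<eta>k k \<omega> \<bullet> (zz k \<omega> - vv k \<omega>)) \<in> borel_measurable P"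
      unfolding z_eq by measurable
    show "AE \<omega> in P. norm (\<eta>k k \<omega> \<bullet> (zz k \<omega> - vv k \<omega>)) \<le> norm ((sqrt K + (1 + (sk k \<omega>)\<^sup>2)) * \<Omega>)"
    proof (rule AE_I2)
      fix \<omega>
      have "\<bar>\<eta>k k \<omega> \<bullet> (zz k \<omega> - vv k \<omega>)\<bar> \<le> (sqrt K + sk k \<omega>) * p_norm p (zz k \<omega> - vv k \<omega>)"
        by (rule \<eta>_bound[OF k])
      also have "\<dots> \<le> (sqrt K + (1 + (sk k \<omega>)\<^sup>2)) * \<Omega>"
      proof (intro mult_mono)
        \<comment> \<open>Yields \<open>x \<le> 1 + x\<^sup>2\<close> for
          \<open>x = sk k \<omega>\<close>, so that the known integrability of the square gives the
          majorant.\<close>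
        have "0 \<le> (sk k \<omega> - 1)\<^sup>2 + (sk k \<omega>)\<^sup>2 + 1"
          by simp
        then show "sqrt K + sk k \<omega> \<le> sqrt K + (1 + (sk k \<omega>)\<^sup>2)"
          by (simp add: power2_diff)
      qed (use st_in p_norm_le_\<Omega> pos in auto)
      finally show "norm (\<eta>k k \<omega> \<bullet> (zz k \<omega> - vv k \<omega>)) \<le> norm ((sqrt K + (1 + (sk k \<omega>)\<^sup>2)) * \<Omega>)"
        using abs_ge_self[of "(sqrt K + (1 + (sk k \<omega>)\<^sup>2)) * \<Omega>"] unfolding real_norm_def by linarith
    qed
  qed
  have "integrable (distr P (borel \<Otimes>\<^sub>M borel) (\<lambda>\<omega>. (st k \<omega>, W k \<omega>))) \<zeta>"
    using int unfolding z_eq by (subst integrable_distr_eq) auto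
  then have z_int: "integrable (distr P borel (st k) \<Otimes>\<^sub>M distr P borel (W k)) \<zeta>"
    by (simp add: joint_law[OF k])
  have "(\<integral>\<omega>. \<eta>k k \<omega> \<bullet> (zz k \<omega> - vv k \<omega>) \<partial>P) = (\<integral>q. \<zeta> q \<partial>distr P (borel \<Otimes>\<^sub>M borel) (\<lambda>\<omega>. (st k \<omega>, W k \<omega>)))"
    unfolding z_eq by (subst integral_distr) auto
  also have "\<dots> = (\<integral>x. (\<integral>w. \<zeta> (x, w) \<partial>distr P borel (W k)) \<partial>distr P borel (st k))"
    unfolding joint_law[OF k] by (rule integral_fst'[OF z_int, symmetric])
  also have "(\<lambda>x. \<integral>w. \<zeta> (x, w) \<partial>distr P borel (W k)) = (\<lambda>_. 0)"
  proof
    fix x :: "'c \<times> 'c"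
    have "(\<integral>w. \<zeta> (x, w) \<partial>distr P borel (W k)) = (\<integral>\<omega>. (G k (fst x) - g (fst x) (W k \<omega>)) \<bullet> (fst x - snd x) \<partial>P)"
      unfolding \<zeta>_def by (subst integral_distr) auto
    also have "\<dots> = (\<integral>\<omega>. (G k (fst x) - g (fst x) (W k \<omega>)) \<partial>P) \<bullet> (fst x - snd x)"
      by (rule integral_inner_left) (use g_int[OF k] in simp)
    also have "(\<integral>\<omega>. (G k (fst x) - g (fst x) (W k \<omega>)) \<partial>P) = 0"
      using g_int[OF k] by (simp add: G_eq[OF k] prob_space)
    finally show "(\<integral>w. \<zeta> (x, w) \<partial>distr P borel (W k)) = 0"
      by simp
  qed
  finally show "(\<integral>\<omega>. \<eta>k k \<omega> \<bullet> (zz k \<omega> - vv k \<omega>) \<partial>P) = 0"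
    by simp
qed

text \<open>The regret bound before taking means. It does not mention the comparison point, so the
  supremum over comparison points can be taken for each \<open>\<omega>\<close> before
  integrating.\<close>

definition R :: "'w \<Rightarrow> real" where
  "R \<omega> = 3 * \<Omega>\<^sup>2 / (2 * \<gamma>) + (\<Sum>k<Suc N. \<gamma> * (sk k \<omega>)\<^sup>2 + \<gamma> * K / 2 + \<eta>k k \<omega> \<bullet> (zz k \<omega> - vv k \<omega>))"

lemma R_integrable: "integrable P R"
  unfolding R_def[abs_def] using sk_sq \<eta>_mean_zero by (intro Bochner_Integration.integrable_add Bochner_Integration.integrable_sum) auto

lemma R_integral: "(\<integral>\<omega>. R \<omega> \<partial>P) \<le> 3 * \<Omega>\<^sup>2 / (2 * \<gamma>) + real (Suc N) * (3 * \<gamma> * K / 2)"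
proof -
  have "(\<integral>\<omega>. R \<omega> \<partial>P) = 3 * \<Omega>\<^sup>2 / (2 * \<gamma>) + (\<Sum>k<Suc N. \<integral>\<omega>. \<gamma> * (sk k \<omega>)\<^sup>2 + \<gamma> * K / 2 + \<eta>k k \<omega> \<bullet> (zz k \<omega> - vv k \<omega>) \<partial>P)"
  proof -
    have i: "integrable P (\<lambda>\<omega>. \<gamma> * (sk k \<omega>)\<^sup>2 + \<gamma> * K / 2 + \<eta>k k \<omega> \<bullet> (zz k \<omega> - vv k \<omega>))" if "k \<in> {..<Suc N}" for k
      using that sk_sq[of k] \<eta>_mean_zero[of k] by simp
    have "(\<integral>\<omega>. R \<omega> \<partial>P) = 3 * \<Omega>\<^sup>2 / (2 * \<gamma>)
        + (\<integral>\<omega>. (\<Sum>k<Suc N. \<gamma> * (sk k \<omega>)\<^sup>2 + \<gamma> * K / 2 + \<eta>k k \<omega> \<bullet> (zz k \<omega> - vv k \<omega>)) \<partial>P)"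
      unfolding R_def
      by (subst Bochner_Integration.integral_add) (auto simp del: sum.lessThan_Suc simp: prob_space intro!: Bochner_Integration.integrable_sum i)
    also have "(\<integral>\<omega>. (\<Sum>k<Suc N. \<gamma> * (sk k \<omega>)\<^sup>2 + \<gamma> * K / 2 + \<eta>k k \<omega> \<bullet> (zz k \<omega> - vv k \<omega>)) \<partial>P)
        = (\<Sum>k<Suc N. \<integral>\<omega>. \<gamma> * (sk k \<omega>)\<^sup>2 + \<gamma> * K / 2 + \<eta>k k \<omega> \<bullet> (zz k \<omega> - vv k \<omega>) \<partial>P)"
      by (rule Bochner_Integration.integral_sum) (rule i)
    finally show ?thesis .
  qed
  also have "\<dots> \<le> 3 * \<Omega>\<^sup>2 / (2 * \<gamma>) + (\<Sum>k<Suc N. 3 * \<gamma> * K / 2)"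
  proof (intro add_left_mono sum_mono)
    fix k assume "k \<in> {..<Suc N}"
    then have k: "k \<le> N" by simp
    have "(\<integral>\<omega>. \<gamma> * (sk k \<omega>)\<^sup>2 + \<gamma> * K / 2 + \<eta>k k \<omega> \<bullet> (zz k \<omega> - vv k \<omega>) \<partial>P) = \<gamma> * (\<integral>\<omega>. (sk k \<omega>)\<^sup>2 \<partial>P) + \<gamma> * K / 2"
      using sk_sq[OF k] \<eta>_mean_zero[OF k] by (simp add: prob_space)
    also have "\<dots> \<le> \<gamma> * K + \<gamma> * K / 2"
      using sk_sq[OF k] pos by simp
    finally show "(\<integral>\<omega>. \<gamma> * (sk k \<omega>)\<^sup>2 + \<gamma> * K / 2 + \<eta>k k \<omega> \<bullet> (zz k \<omega> - vv k \<omega>) \<partial>P) \<le> 3 * \<gamma> * K / 2"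
      by (simp add: mult_ac)
  qed
  finally show ?thesis by simp
qed

text \<open>Split the mean estimator as \<open>g + \<eta>k\<close>, and the error term as
  \<open>\<eta>k \<bullet> (zz - vv) + \<eta>k \<bullet> (vv - u)\<close>. The prox steps of
  \<open>zz\<close> and \<open>vv\<close> bound the parts that contain \<open>u\<close>; the
  remaining term has mean zero and is kept in \<open>R\<close>.\<close>

lemma regret:
  assumes u: "u \<in> Z"
  shows "(\<Sum>k<Suc N. G k (zz k \<omega>) \<bullet> (zz k \<omega> - u)) \<le> R \<omega>"
proof -
  have step: "G k (zz k \<omega>) \<bullet> (zz k \<omega> - u)
      \<le> (V (zz k \<omega>) u - V (zz (Suc k) \<omega>) u) / \<gamma> + 2 * (V (vv k \<omega>) u - V (vv (Suc k) \<omega>) u) / \<gamma>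
        + (\<gamma> * (sk k \<omega>)\<^sup>2 + \<gamma> * K / 2 + \<eta>k k \<omega> \<bullet> (zz k \<omega> - vv k \<omega>))" if k: "k \<le> N" for k
  proof -
    let ?z = "zz k \<omega>" and ?v = "vv k \<omega>" and ?g = "g (zz k \<omega>) (W k \<omega>)" and ?s = "sk k \<omega>"
    have z': "zz (Suc k) \<omega> = prox d Z ?z (\<gamma> *\<^sub>R ?g)"
      using st_in[of k \<omega>] by (simp add: st_def prox'_eq)
    have v': "vv (Suc k) \<omega> = prox d Z ?v ((\<gamma> / 2) *\<^sub>R \<eta>k k \<omega>)"
      using st_in[of k \<omega>] by (simp add: st_def prox'_eq)
    have 1: "(\<gamma> *\<^sub>R ?g) \<bullet> (?z - u) \<le> V ?z u - V (zz (Suc k) \<omega>) u + (\<gamma> * ?s)\<^sup>2 / 2"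
      unfolding z'
    proof (rule prox_step[OF st_in(1) u])
      fix h
      show "\<bar>(\<gamma> *\<^sub>R ?g) \<bullet> h\<bar> \<le> \<gamma> * ?s * p_norm p h"
        using mult_left_mono[OF g_dual[of ?z "W k \<omega>" h], of \<gamma>] pos by (simp add: abs_mult mult_ac)
    qed
    have 2: "((\<gamma> / 2) *\<^sub>R \<eta>k k \<omega>) \<bullet> (?v - u) \<le> V ?v u - V (vv (Suc k) \<omega>) u + (\<gamma> / 2 * (sqrt K + ?s))\<^sup>2 / 2"
      unfolding v'
    proof (rule prox_step[OF st_in(2) u])
      fix h
      show "\<bar>((\<gamma> / 2) *\<^sub>R \<eta>k k \<omega>) \<bullet> h\<bar> \<le> \<gamma> / 2 * (sqrt K + ?s) * p_norm p h"
        using mult_left_mono[OF \<eta>_bound[OF k, of ?z "W k \<omega>" h], of "\<gamma> / 2"] pos by (simp add: abs_mult mult_ac)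
    qed
    have 3: "(sqrt K + ?s)\<^sup>2 \<le> 2 * K + 2 * ?s\<^sup>2"
      using zero_le_power2[of "sqrt K - ?s"] pos by (simp add: power2_sum power2_diff)
    have "?g \<bullet> (?z - u) \<le> (V ?z u - V (zz (Suc k) \<omega>) u) / \<gamma> + \<gamma> * ?s\<^sup>2 / 2"
      using 1[unfolded inner_scaleR_left] pos by (simp add: field_simps power2_eq_square)
    moreover have "\<eta>k k \<omega> \<bullet> (?v - u) \<le> 2 * (V ?v u - V (vv (Suc k) \<omega>) u) / \<gamma> + \<gamma> / 4 * (2 * K + 2 * ?s\<^sup>2)"
    proof -
      have "\<eta>k k \<omega> \<bullet> (?v - u) \<le> 2 * (V ?v u - V (vv (Suc k) \<omega>) u) / \<gamma> + \<gamma> / 4 * (sqrt K + ?s)\<^sup>2"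
        using 2[unfolded inner_scaleR_left] pos by (simp add: field_simps power2_eq_square)
      also have "\<gamma> / 4 * (sqrt K + ?s)\<^sup>2 \<le> \<gamma> / 4 * (2 * K + 2 * ?s\<^sup>2)"
        using 3 pos by (intro mult_left_mono) auto
      finally show ?thesis by simp
    qed
    moreover have "G k ?z \<bullet> (?z - u) = ?g \<bullet> (?z - u) + \<eta>k k \<omega> \<bullet> (?z - ?v) + \<eta>k k \<omega> \<bullet> (?v - u)"
      by (simp add: inner_diff_left inner_diff_right)
    \<comment> \<open>The error terms of the two sequences together. Since \<open>?s\<^sup>2\<close>
      has mean at most \<open>K\<close>, their mean is at most \<open>3 * \<gamma> * K / 2\<close>,
      the second term of the theorem.\<close>
    moreover have "\<gamma> * ?s\<^sup>2 / 2 + \<gamma> / 4 * (2 * K + 2 * ?s\<^sup>2) = \<gamma> * ?s\<^sup>2 + \<gamma> * K / 2"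
      by (simp add: algebra_simps)
    ultimately show ?thesis
      by linarith
  qed
  have "(\<Sum>k<Suc N. G k (zz k \<omega>) \<bullet> (zz k \<omega> - u))
      \<le> (\<Sum>k<Suc N. (V (zz k \<omega>) u - V (zz (Suc k) \<omega>) u) / \<gamma> + 2 * (V (vv k \<omega>) u - V (vv (Suc k) \<omega>) u) / \<gamma>
        + (\<gamma> * (sk k \<omega>)\<^sup>2 + \<gamma> * K / 2 + \<eta>k k \<omega> \<bullet> (zz k \<omega> - vv k \<omega>)))"
    by (intro sum_mono step) auto
  also have "\<dots> = (V (zz 0 \<omega>) u - V (zz (Suc N) \<omega>) u) / \<gamma> + 2 * (V (vv 0 \<omega>) u - V (vv (Suc N) \<omega>) u) / \<gamma>
      + (\<Sum>k<Suc N. \<gamma> * (sk k \<omega>)\<^sup>2 + \<gamma> * K / 2 + \<eta>k k \<omega> \<bullet> (zz k \<omega> - vv k \<omega>))"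
  proof -
    have "(\<Sum>k<Suc N. V (zz k \<omega>) u - V (zz (Suc k) \<omega>) u) = V (zz 0 \<omega>) u - V (zz (Suc N) \<omega>) u"
      "(\<Sum>k<Suc N. V (vv k \<omega>) u - V (vv (Suc k) \<omega>) u) = V (vv 0 \<omega>) u - V (vv (Suc N) \<omega>) u"
      by (rule sum_lessThan_telescope')+
    then show ?thesis
      by (simp only: sum.distrib sum_divide_distrib[symmetric] sum_distrib_left[symmetric])
  qed
  \<comment> \<open>After telescoping, the initial divergences are at most
    \<open>\<Omega>\<^sup>2 / 2\<close> and the final ones are dropped. The shadow sequence counts
    twice because its step size is \<open>\<gamma> / 2\<close>; this is the origin of the factor
    \<open>3\<close>.\<close>
  also have "\<dots> \<le> (\<Omega>\<^sup>2 / 2) / \<gamma> + 2 * (\<Omega>\<^sup>2 / 2) / \<gamma>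
      + (\<Sum>k<Suc N. \<gamma> * (sk k \<omega>)\<^sup>2 + \<gamma> * K / 2 + \<eta>k k \<omega> \<bullet> (zz k \<omega> - vv k \<omega>))"
  proof -
    have "V (zz 0 \<omega>) u - V (zz (Suc N) \<omega>) u \<le> \<Omega>\<^sup>2 / 2" "V (vv 0 \<omega>) u - V (vv (Suc N) \<omega>) u \<le> \<Omega>\<^sup>2 / 2"
      using V_le[OF st_in(1) u] V_nonneg[OF st_in(1) u] V_le[OF st_in(2) u] V_nonneg[OF st_in(2) u]
      by (smt (verit))+
    then show ?thesis
      using pos by (intro add_right_mono add_mono divide_right_mono mult_left_mono) auto
  qed
  also have "\<dots> = R \<omega>"
    unfolding R_def by (simp add: field_simps)
  finally show ?thesis .
qed

end

subsection \<open>The duality gap\<close>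

text \<open>Convexity is asked along a single segment only: the smoothed function is differentiable
  everywhere, but its convexity is available only over \<open>X \<times> Y\<close>.\<close>

lemma convex_gradient_ineq:
  fixes f :: "'a::real_normed_vector \<Rightarrow> real"
  assumes d: "(f has_derivative f') (at z)"
    and c: "\<And>t. 0 < t \<Longrightarrow> t < 1 \<Longrightarrow> f (z + t *\<^sub>R (w - z)) \<le> (1 - t) * f z + t * f w"
  shows "f z + f' (w - z) \<le> f w"
proof -
  have "((\<lambda>t. (f (z + t *\<^sub>R (w - z)) - f z) / t) \<longlongrightarrow> f' (w - z)) (at_right 0)"
    by (rule directional_derivative_within[where Z = UNIV]) (use d in auto)
  then have "f' (w - z) \<le> f w - f z"
  proof (rule tendsto_upperbound)
    show "\<forall>\<^sub>F t in at_right 0. (f (z + t *\<^sub>R (w - z)) - f z) / t \<le> f w - f z"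
      using eventually_at_right_0_less_1
    proof eventually_elim
      fix t :: real assume t: "0 < t \<and> t < 1"
      then have "f (z + t *\<^sub>R (w - z)) - f z \<le> t * (f w - f z)"
        using c[of t] by (simp add: algebra_simps)
      then show "(f (z + t *\<^sub>R (w - z)) - f z) / t \<le> f w - f z"
        using t by (simp add: divide_le_eq mult.commute)
    qed
  qed simp
  then show ?thesis by simp
qed

text \<open>Convexity and concavity are stated at points displaced by the same vector
  \<open>\<tau> *\<^sub>R r\<close>, the form that survives averaging over the ball. The case
  \<open>r = 0\<close> gives the properties of \<open>\<phi>\<close> itself.\<close>

locale convex_concave =
  fixes \<phi> :: "'a::euclidean_space \<times> 'b::euclidean_space \<Rightarrow> real" and M \<tau> :: real and X :: "'a set" and Y :: "'b set"
  assumes lip: "M-lipschitz_on UNIV \<phi>" and \<tau>: "\<tau> > 0"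
    and X: "X \<noteq> {}" "compact X" "convex X" and Y: "Y \<noteq> {}" "compact Y" "convex Y"
    and cx: "\<And>r x1 x2 y t. norm r \<le> 1 \<Longrightarrow> x1 \<in> X \<Longrightarrow> x2 \<in> X \<Longrightarrow> y \<in> Y \<Longrightarrow> 0 < t \<Longrightarrow> t < 1 \<Longrightarrow>
      \<phi> (((1 - t) *\<^sub>R x1 + t *\<^sub>R x2, y) + \<tau> *\<^sub>R r) \<le> (1 - t) * \<phi> ((x1, y) + \<tau> *\<^sub>R r) + t * \<phi> ((x2, y) + \<tau> *\<^sub>R r)"
    and cy: "\<And>r x y1 y2 t. norm r \<le> 1 \<Longrightarrow> x \<in> X \<Longrightarrow> y1 \<in> Y \<Longrightarrow> y2 \<in> Y \<Longrightarrow> 0 < t \<Longrightarrow> t < 1 \<Longrightarrow>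
      (1 - t) * \<phi> ((x, y1) + \<tau> *\<^sub>R r) + t * \<phi> ((x, y2) + \<tau> *\<^sub>R r) \<le> \<phi> ((x, (1 - t) *\<^sub>R y1 + t *\<^sub>R y2) + \<tau> *\<^sub>R r)"
begin

abbreviation \<Phi> :: "'a \<times> 'b \<Rightarrow> real" where "\<Phi> \<equiv> ball_avg \<phi> \<tau>"

lemma ball_avg_convex_x:
  assumes "x1 \<in> X" "x2 \<in> X" "y \<in> Y" "0 < t" "t < 1"
  shows "\<Phi> ((1 - t) *\<^sub>R x1 + t *\<^sub>R x2, y) \<le> (1 - t) * \<Phi> (x1, y) + t * \<Phi> (x2, y)"
proof -
  have "\<Phi> ((1 - t) *\<^sub>R x1 + t *\<^sub>R x2, y)
      \<le> (\<integral>r. (1 - t) * \<phi> ((x1, y) + \<tau> *\<^sub>R r) + t * \<phi> ((x2, y) + \<tau> *\<^sub>R r) \<partial>uniform_ball)"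
    unfolding ball_avg_def
  proof (rule integral_mono_AE)
    show "AE r in uniform_ball. \<phi> (((1 - t) *\<^sub>R x1 + t *\<^sub>R x2, y) + \<tau> *\<^sub>R r)
        \<le> (1 - t) * \<phi> ((x1, y) + \<tau> *\<^sub>R r) + t * \<phi> ((x2, y) + \<tau> *\<^sub>R r)"
      using AE_uniform_ball by eventually_elim (rule cx, use assms in auto)
  qed (intro ball_avg_integrable[OF lip] Bochner_Integration.integrable_add integrable_mult_right)+
  also have "\<dots> = (1 - t) * \<Phi> (x1, y) + t * \<Phi> (x2, y)"
    unfolding ball_avg_def using ball_avg_integrable[OF lip]
    by (subst Bochner_Integration.integral_add) auto
  finally show ?thesis .
qed

lemma ball_avg_concave_y:
  assumes "x \<in> X" "y1 \<in> Y" "y2 \<in> Y" "0 < t" "t < 1"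
  shows "(1 - t) * \<Phi> (x, y1) + t * \<Phi> (x, y2) \<le> \<Phi> (x, (1 - t) *\<^sub>R y1 + t *\<^sub>R y2)"
proof -
  have "(1 - t) * \<Phi> (x, y1) + t * \<Phi> (x, y2)
      = (\<integral>r. (1 - t) * \<phi> ((x, y1) + \<tau> *\<^sub>R r) + t * \<phi> ((x, y2) + \<tau> *\<^sub>R r) \<partial>uniform_ball)"
    unfolding ball_avg_def using ball_avg_integrable[OF lip]
    by (subst Bochner_Integration.integral_add) auto
  also have "\<dots> \<le> \<Phi> (x, (1 - t) *\<^sub>R y1 + t *\<^sub>R y2)"
    unfolding ball_avg_def
  proof (rule integral_mono_AE)
    show "AE r in uniform_ball. (1 - t) * \<phi> ((x, y1) + \<tau> *\<^sub>R r) + t * \<phi> ((x, y2) + \<tau> *\<^sub>R r)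
        \<le> \<phi> ((x, (1 - t) *\<^sub>R y1 + t *\<^sub>R y2) + \<tau> *\<^sub>R r)"
      using AE_uniform_ball by eventually_elim (rule cy, use assms in auto)
  qed (intro ball_avg_integrable[OF lip] Bochner_Integration.integrable_add integrable_mult_right)+
  finally show ?thesis .
qed

text \<open>The gradient inequalities at \<open>z\<close>, in \<open>x\<close> for the convex block
  and in \<open>y\<close> for the concave one; \<open>\<Phi> z\<close> cancels in their sum, and the
  two partial directions combine to the flipped vector.\<close>

lemma smoothed_gap_le:
  assumes z: "z \<in> X \<times> Y" and u: "u \<in> X \<times> Y"
  shows "\<Phi> (fst z, snd u) - \<Phi> (fst u, snd z) \<le> ball_avg_grad \<phi> \<tau> z \<bullet> flip_snd (z - u)"
proof -
  let ?D = "ball_avg_grad \<phi> \<tau> z"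
  have d: "(\<Phi> has_derivative (\<lambda>v. ?D \<bullet> v)) (at z)"
    by (rule ball_avg_has_derivative[OF lip \<tau>])
  have "\<Phi> z + ?D \<bullet> ((fst u, snd z) - z) \<le> \<Phi> (fst u, snd z)"
  proof (rule convex_gradient_ineq[OF d])
    fix t :: real assume t: "0 < t" "t < 1"
    have "z + t *\<^sub>R ((fst u, snd z) - z) = ((1 - t) *\<^sub>R fst z + t *\<^sub>R fst u, snd z)"
      by (simp add: prod_eq_iff algebra_simps)
    then show "\<Phi> (z + t *\<^sub>R ((fst u, snd z) - z)) \<le> (1 - t) * \<Phi> z + t * \<Phi> (fst u, snd z)"
      using ball_avg_convex_x[of "fst z" "fst u" "snd z" t] z u t by auto
  qed
  moreover have "- \<Phi> z + - (?D \<bullet> ((fst z, snd u) - z)) \<le> - \<Phi> (fst z, snd u)"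
  proof (rule convex_gradient_ineq[OF has_derivative_minus[OF d]])
    fix t :: real assume t: "0 < t" "t < 1"
    have "z + t *\<^sub>R ((fst z, snd u) - z) = (fst z, (1 - t) *\<^sub>R snd z + t *\<^sub>R snd u)"
      by (simp add: prod_eq_iff algebra_simps)
    then show "- \<Phi> (z + t *\<^sub>R ((fst z, snd u) - z)) \<le> (1 - t) * - \<Phi> z + t * - \<Phi> (fst z, snd u)"
      using ball_avg_concave_y[of "fst z" "snd z" "snd u" t] z u t by auto
  qed
  moreover have "?D \<bullet> flip_snd (z - u) = ?D \<bullet> ((fst z, snd u) - z) - ?D \<bullet> ((fst u, snd z) - z)"
    unfolding inner_diff_right[symmetric] by (rule arg_cong[of _ _ "(\<bullet>) ?D"]) (simp add: flip_snd_def prod_eq_iff)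
  ultimately show ?thesis by linarith
qed

text \<open>Jensen's inequality is applied to \<open>\<phi>\<close> itself and passes from the mean
  to the single iterates. Only then is each of the two values of \<open>\<phi>\<close> replaced by
  its smoothed value at the cost \<open>\<tau> * M\<close>, whence \<open>2 * \<tau> * M\<close>.
  \<open>C\<close> is the bias per step.\<close>

lemma saddle_gap_mean_le:
  fixes z g :: "nat \<Rightarrow> 'a \<times> 'b"
  assumes m: "m > 0" and z: "\<And>k. k < m \<Longrightarrow> z k \<in> X \<times> Y"
    and R: "\<And>u. u \<in> X \<times> Y \<Longrightarrow> (\<Sum>k<m. g k \<bullet> (z k - u)) \<le> R"
    and g: "\<And>k u. k < m \<Longrightarrow> u \<in> X \<times> Y \<Longrightarrow> ball_avg_grad \<phi> \<tau> (z k) \<bullet> flip_snd (z k - u) \<le> g k \<bullet> (z k - u) + C"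
  shows "saddle_gap \<phi> X Y ((1 / real m) *\<^sub>R (\<Sum>k<m. z k)) \<le> R / real m + C + 2 * \<tau> * M"
proof -
  let ?zb = "(1 / real m) *\<^sub>R (\<Sum>k<m. z k)"
  let ?B = "R / real m + C + 2 * \<tau> * M"
  have main: "\<phi> (fst ?zb, y) - \<phi> (x, snd ?zb) \<le> ?B" if x: "x \<in> X" and y: "y \<in> Y" for x y
  proof -
    have zk: "fst (z k) \<in> X" "snd (z k) \<in> Y" if "k < m" for k
      using z[OF that] by (auto simp: mem_Times_iff)
    have "convex_on X (\<lambda>x. \<phi> (x, y))"
      using cx[of 0 _ _ y] y X by (intro convex_onI) auto
    then have "\<phi> (\<Sum>k<m. (1 / real m) *\<^sub>R fst (z k), y) \<le> (\<Sum>k<m. (1 / real m) * \<phi> (fst (z k), y))"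
      by (rule convex_on_sum[rotated 2]) (use m zk in auto)
    moreover have "convex_on Y (\<lambda>y. - \<phi> (x, y))"
      using cy[of 0 x] x Y by (intro convex_onI) (auto simp: algebra_simps)
    then have "- \<phi> (x, \<Sum>k<m. (1 / real m) *\<^sub>R snd (z k)) \<le> (\<Sum>k<m. (1 / real m) * - \<phi> (x, snd (z k)))"
      by (rule convex_on_sum[rotated 2]) (use m zk in auto)
    moreover have "fst ?zb = (\<Sum>k<m. (1 / real m) *\<^sub>R fst (z k))" "snd ?zb = (\<Sum>k<m. (1 / real m) *\<^sub>R snd (z k))"
      by (simp_all add: fst_sum snd_sum scaleR_sum_right)
    ultimately have "\<phi> (fst ?zb, y) - \<phi> (x, snd ?zb)
        \<le> (\<Sum>k<m. (1 / real m) * \<phi> (fst (z k), y)) + (\<Sum>k<m. (1 / real m) * - \<phi> (x, snd (z k)))"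
      by simp
    also have "\<dots> = (\<Sum>k<m. \<phi> (fst (z k), y) - \<phi> (x, snd (z k))) / real m"
      by (simp add: sum.distrib[symmetric] sum_divide_distrib diff_divide_distrib sum_subtractf sum_negf)
    also have "\<dots> \<le> (\<Sum>k<m. g k \<bullet> (z k - (x, y)) + (C + 2 * \<tau> * M)) / real m"
    proof (intro divide_right_mono sum_mono)
      fix k assume "k \<in> {..<m}"
      then have k: "k < m" by simp
      have "\<Phi> (fst (z k), y) - \<Phi> (x, snd (z k)) \<le> g k \<bullet> (z k - (x, y)) + C"
        using smoothed_gap_le[OF z[OF k], of "(x, y)"] g[OF k, of "(x, y)"] x y by auto
      then show "\<phi> (fst (z k), y) - \<phi> (x, snd (z k)) \<le> g k \<bullet> (z k - (x, y)) + (C + 2 * \<tau> * M)"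
        using ball_avg_approx[OF lip, of \<tau> "(fst (z k), y)"] ball_avg_approx[OF lip, of \<tau> "(x, snd (z k))"] \<tau>
        by (simp add: abs_of_pos mult.commute abs_le_iff)
    qed simp
    also have "\<dots> = (\<Sum>k<m. g k \<bullet> (z k - (x, y))) / real m + (C + 2 * \<tau> * M)"
      using m by (simp add: sum.distrib add_divide_distrib)
    also have "\<dots> \<le> R / real m + (C + 2 * \<tau> * M)"
      using R[of "(x, y)"] x y by (intro add_right_mono divide_right_mono) auto
    finally show ?thesis by simp
  qed
  have "(SUP y\<in>Y. \<phi> (fst ?zb, y)) \<le> ?B + (INF x\<in>X. \<phi> (x, snd ?zb))"
  proof (rule cSUP_least[OF Y(1)])
    fix y assume y: "y \<in> Y"
    have "\<phi> (fst ?zb, y) - ?B \<le> (INF x\<in>X. \<phi> (x, snd ?zb))"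
    proof (rule cINF_greatest[OF X(1)])
      fix x assume "x \<in> X"
      from main[OF this y] show "\<phi> (fst ?zb, y) - ?B \<le> \<phi> (x, snd ?zb)"
        by linarith
    qed
    then show "\<phi> (fst ?zb, y) \<le> ?B + (INF x\<in>X. \<phi> (x, snd ?zb))"
      by linarith
  qed
  then show ?thesis
    unfolding saddle_gap_def by linarith
qed

text \<open>Makes the gap measurable and, on the compact set \<open>Z\<close>, bounded, hence
  integrable along the averaged iterates. The supremum and the infimum are each Lipschitz with
  constant \<open>M\<close>.\<close>

lemma saddle_gap_lipschitz: "(2 * M)-lipschitz_on UNIV (saddle_gap \<phi> X Y)"
proof (rule lipschitz_onI)
  have cont: "continuous_on S \<phi>" for S
    using lipschitz_on_continuous_on[OF lip] continuous_on_subset by blast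
  have M: "M \<ge> 0"
    by (rule lipschitz_on_nonneg[OF lip])
  have ba: "bdd_above ((\<lambda>y. \<phi> (x, y)) ` Y)" for x
    by (intro bounded_imp_bdd_above compact_imp_bounded compact_continuous_image Y
      continuous_on_compose2[OF cont[of UNIV]]) (auto intro!: continuous_intros)
  have bb: "bdd_below ((\<lambda>x. \<phi> (x, y)) ` X)" for y
    by (intro bounded_imp_bdd_below compact_imp_bounded compact_continuous_image X
      continuous_on_compose2[OF cont[of UNIV]]) (auto intro!: continuous_intros)
  have sup: "(SUP y\<in>Y. \<phi> (fst z, y)) \<le> (SUP y\<in>Y. \<phi> (fst w, y)) + M * dist z w" for z w :: "'a \<times> 'b"
  proof (rule cSUP_least[OF Y(1)])
    fix y assume y: "y \<in> Y"
    have "\<phi> (fst z, y) \<le> \<phi> (fst w, y) + M * norm ((fst z, y) - (fst w, y))"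
      using lipschitz_bound[OF lip, of "(fst z, y)" "(fst w, y)"] by linarith
    also have "norm ((fst z, y) - (fst w, y)) \<le> dist z w"
      using dist_fst_le[of z w] by (simp add: norm_Pair dist_norm)
    also have "\<phi> (fst w, y) \<le> (SUP y\<in>Y. \<phi> (fst w, y))"
      by (rule cSUP_upper[OF y ba])
    finally show "\<phi> (fst z, y) \<le> (SUP y\<in>Y. \<phi> (fst w, y)) + M * dist z w"
      using M by (simp add: mult_left_mono)
  qed
  have inf: "(INF x\<in>X. \<phi> (x, snd w)) - M * dist z w \<le> (INF x\<in>X. \<phi> (x, snd z))" for z w :: "'a \<times> 'b"
  proof (rule cINF_greatest[OF X(1)])
    fix x assume x: "x \<in> X"
    have "(INF x\<in>X. \<phi> (x, snd w)) \<le> \<phi> (x, snd w)"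
      by (rule cINF_lower[OF bb x])
    also have "\<dots> \<le> \<phi> (x, snd z) + M * norm ((x, snd w) - (x, snd z))"
      using lipschitz_bound[OF lip, of "(x, snd w)" "(x, snd z)"] by linarith
    also have "M * norm ((x, snd w) - (x, snd z)) \<le> M * dist z w"
      using dist_snd_le[of w z] M by (intro mult_left_mono) (auto simp: norm_Pair dist_norm dist_commute norm_minus_commute)
    finally show "(INF x\<in>X. \<phi> (x, snd w)) - M * dist z w \<le> \<phi> (x, snd z)"
      by simp
  qed
  fix z w :: "'a \<times> 'b"
  show "dist (saddle_gap \<phi> X Y z) (saddle_gap \<phi> X Y w) \<le> 2 * M * dist z w"
    using sup[of z w] sup[of w z] inf[of w z] inf[of z w]
    unfolding saddle_gap_def dist_real_def dist_commute[of w z] abs_le_iff by linarith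
  show "0 \<le> 2 * M" using M by simp
qed

end

section \<open>The bound on the expected duality gap\<close>

theorem theorem1:
  fixes X UX :: "(real ^ 'nx) set" and Y UY :: "(real ^ 'ny) set"
    and Z U :: "((real ^ 'nx) \<times> (real ^ 'ny)) set"
    and \<phi> \<delta> d :: "(real ^ 'nx) \<times> (real ^ 'ny) \<Rightarrow> real"
    and M \<tau> \<gamma> \<Delta> \<sigma> p :: real and q :: ereal and n N :: nat
    and P :: "'w measure"
    and e :: "nat \<Rightarrow> 'w \<Rightarrow> (real ^ 'nx) \<times> (real ^ 'ny)"
    and \<xi>p \<xi>m :: "nat \<Rightarrow> 'w \<Rightarrow> real"
    and z0 :: "(real ^ 'nx) \<times> (real ^ 'ny)"
    and z :: "nat \<Rightarrow> 'w \<Rightarrow> (real ^ 'nx) \<times> (real ^ 'ny)"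
    and zbar :: "'w \<Rightarrow> (real ^ 'nx) \<times> (real ^ 'ny)"
  assumes n: "n = CARD('nx) + CARD('ny)" "n \<ge> 3"
    and X: "X \<noteq> {}" "compact X" "convex X"
    and Y: "Y \<noteq> {}" "compact Y" "convex Y"
    and Z: "Z = X \<times> Y"
    and UX: "open UX" "convex UX" and UY: "open UY" "convex UY"
    and U: "U = UX \<times> UY"
    and params: "M > 0" "\<tau> > 0" "\<gamma> > 0" "\<Delta> > 0" "\<sigma> > 0" "N \<ge> 1"
    and nbhd: "\<And>w v. w \<in> Z \<Longrightarrow> norm v \<le> 1 \<Longrightarrow> w + \<tau> *\<^sub>R v \<in> U"
    and convex_x: "\<And>y. y \<in> UY \<Longrightarrow> convex_on UX (\<lambda>x. \<phi> (x, y))"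
    and concave_y: "\<And>x. x \<in> UX \<Longrightarrow> concave_on UY (\<lambda>y. \<phi> (x, y))"
    and lipschitz: "M-lipschitz_on U \<phi>"
    and pq: "1 \<le> p" "p \<le> 2" "2 \<le> q" "1 / ereal p + 1 / q = 1"
    and prox_fun: "d differentiable_on Z" "strongly_convex_on (p_norm p) 1 Z d"
    and diameter: "bdd_above (bregman_distances d Z)"
    and delta: "\<delta> \<in> borel_measurable (restrict_space borel U)"
      "\<And>w. w \<in> U \<Longrightarrow> \<bar>\<delta> w\<bar> \<le> \<Delta>"
    and P: "prob_space P"
    and e_sphere: "\<And>k \<omega>. k \<le> N \<Longrightarrow> \<omega> \<in> space P \<Longrightarrow> norm (e k \<omega>) = 1"
    and e_uniform: "\<And>k. k \<le> N \<Longrightarrow> distr P borel (e k) = uniform_sphere"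
    and noise_plus: "\<And>k. k \<le> N \<Longrightarrow> integrable P (\<xi>p k) \<and> (\<integral>\<omega>. \<xi>p k \<omega> \<partial>P) = 0"
      "\<And>k. k \<le> N \<Longrightarrow> integrable P (\<lambda>\<omega>. (\<xi>p k \<omega>)\<^sup>2) \<and> (\<integral>\<omega>. (\<xi>p k \<omega>)\<^sup>2 \<partial>P) \<le> \<sigma>\<^sup>2"
    and noise_minus: "\<And>k. k \<le> N \<Longrightarrow> integrable P (\<xi>m k) \<and> (\<integral>\<omega>. \<xi>m k \<omega> \<partial>P) = 0"
      "\<And>k. k \<le> N \<Longrightarrow> integrable P (\<lambda>\<omega>. (\<xi>m k \<omega>)\<^sup>2) \<and> (\<integral>\<omega>. (\<xi>m k \<omega>)\<^sup>2 \<partial>P) \<le> \<sigma>\<^sup>2"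
    and indep_iterations:
      "prob_space.indep_vars P (\<lambda>_. borel) (\<lambda>k \<omega>. (e k \<omega>, \<xi>p k \<omega>, \<xi>m k \<omega>)) {..N}"
    and indep_direction_noise:
      "\<And>k. k \<le> N \<Longrightarrow> indep_rv P (e k) (\<lambda>\<omega>. (\<xi>p k \<omega>, \<xi>m k \<omega>))"
    and indep_noises:
      "\<And>k. k \<le> N \<Longrightarrow> indep_rv P (\<xi>p k) (\<xi>m k)"
    and z0: "z0 \<in> Z"
    and z_init: "\<And>\<omega>. \<omega> \<in> space P \<Longrightarrow> z 0 \<omega> = z0"
    and z_step: "\<And>k \<omega>. k \<le> N \<Longrightarrow> \<omega> \<in> space P \<Longrightarrow>
      z (Suc k) \<omega>
        = prox d Z (z k \<omega>) (\<gamma> *\<^sub>R grad_est \<phi> \<delta> (z k \<omega>) (e k \<omega>) \<tau> (\<xi>p k \<omega>) (\<xi>m k \<omega>))"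
    and zbar: "\<And>\<omega>. \<omega> \<in> space P \<Longrightarrow> zbar \<omega> = (1 / real (N + 1)) *\<^sub>R (\<Sum>k=0..N. z k \<omega>)"
  shows "integrable P (\<lambda>\<omega>. saddle_gap \<phi> X Y (zbar \<omega>)) \<and>
    (\<integral>\<omega>. saddle_gap \<phi> X Y (zbar \<omega>) \<partial>P)
      \<le> 3 * (bregman_diameter d Z)\<^sup>2 / (2 * \<gamma> * real (N + 1))
        + 3 * \<gamma> * M_all_sq n M \<sigma> \<Delta> \<tau> q / 2
        + \<Delta> * bregman_diameter d Z * real n * a_const n q / \<tau>
        + 2 * \<tau> * M"
proof -
  note ZXY = Z
  interpret prob_space P by (rule P)
  have DIM: "DIM((real ^ 'nx) \<times> (real ^ 'ny)) = n"
    by (simp add: n(1))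
  have Zc: "compact Z" "convex Z" "Z \<noteq> {}"
    unfolding Z using X Y by (auto intro: compact_Times convex_Times)
  \<comment> \<open>The closed \<open>\<tau>\<close>-neighbourhood of \<open>Z\<close>. It contains
    every query point, lies in \<open>U\<close>, and is compact and convex, so the projection onto
    it exists and does not increase distances.\<close>
  define C where "C = (\<Union>w\<in>Z. \<Union>v\<in>cball 0 \<tau>. {w + v})"
  have "convex C" "compact C"
    unfolding C_def using Zc(1,2) by (auto intro!: convex_sums compact_sums')
  have inC: "w + \<tau> *\<^sub>R v \<in> C" if "w \<in> Z" "norm v \<le> 1" for w v
    unfolding C_def using that params(2)
    by (intro UN_I[of w] UN_I[of "\<tau> *\<^sub>R v"]) (auto simp: mult_left_le)
  have C: "convex C" "compact C" "C \<noteq> {}"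
    using \<open>convex C\<close> \<open>compact C\<close> inC[of _ 0] Zc(3) by auto
  have inC': "w - \<tau> *\<^sub>R v \<in> C" if "w \<in> Z" "norm v \<le> 1" for w v
    using inC[of w "- v"] that by simp
  have CU: "C \<subseteq> U"
  proof
    fix c assume "c \<in> C"
    then obtain w v where wv: "w \<in> Z" "norm v \<le> \<tau>" "c = w + v"
      by (auto simp: C_def)
    have "w + \<tau> *\<^sub>R (v /\<^sub>R \<tau>) \<in> U"
      using wv params(2) by (intro nbhd) (auto simp: field_simps)
    then show "c \<in> U"
      using wv params(2) by simp
  qed
  have ZC: "Z \<subseteq> C"
    using inC[of _ 0] by auto

  \<comment> \<open>precomposing with the projection onto \<open>C\<close> gives a globally Lipschitz function\<close>
  define \<phi>' where "\<phi>' = \<phi> \<circ> closest_point C"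
  have \<phi>'_eq: "\<phi>' w = \<phi> w" if "w \<in> C" for w
    using that by (simp add: \<phi>'_def closest_point_self)
  have lip': "M-lipschitz_on UNIV \<phi>'"
  proof (rule lipschitz_onI)
    fix u v
    have c: "closest_point C w \<in> U" for w
      using closest_point_in_set[of C w] C CU by (auto simp: compact_imp_closed)
    have "dist (\<phi>' u) (\<phi>' v) \<le> M * dist (closest_point C u) (closest_point C v)"
      unfolding \<phi>'_def comp_def by (rule lipschitz_onD[OF lipschitz c c])
    also have "\<dots> \<le> M * dist u v"
      using C params(1) by (intro mult_left_mono closest_point_lipschitz) (auto simp: compact_imp_closed)
    finally show "dist (\<phi>' u) (\<phi>' v) \<le> M * dist u v" .
  qed (use params in simp)
  \<comment> \<open>Extension by zero: measurable because \<open>U\<close> is open, and within the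
    same bound \<open>\<Delta>\<close>.\<close>
  define \<delta>' where "\<delta>' w = indicator U w *\<^sub>R \<delta> w" for w
  have "open U"
    unfolding U using UX UY by (intro open_Times)
  then have \<delta>'_meas: "\<delta>' \<in> borel_measurable borel"
    using delta(1) unfolding \<delta>'_def[abs_def] by (subst (asm) borel_measurable_restrict_space_iff) auto
  have \<delta>'_bound: "\<bar>\<delta>' w\<bar> \<le> \<Delta>" for w
    using delta(2)[of w] params by (auto simp: \<delta>'_def indicator_def)
  have noisy: "noisy_value \<phi> \<delta> w x = noisy_value \<phi>' \<delta>' w x" if "w \<in> C" for w x
    using that CU by (auto simp: noisy_value_def \<phi>'_eq \<delta>'_def)

  \<comment> \<open>All displaced points lie in \<open>C\<close>, where \<open>\<phi>'\<close>
    agrees with \<open>\<phi>\<close>, and their components lie in the convex sets \<open>UX\<close>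
    and \<open>UY\<close>, so the assumptions on \<open>\<phi>\<close> apply there.\<close>
  interpret cc: convex_concave \<phi>' M \<tau> X Y
  proof
    fix r :: "(real ^ 'nx) \<times> (real ^ 'ny)" and x1 x2 y and t :: real
    assume r: "norm r \<le> 1" and x: "x1 \<in> X" "x2 \<in> X" and y: "y \<in> Y" and t: "0 < t" "t < 1"
    have x12: "(1 - t) *\<^sub>R x1 + t *\<^sub>R x2 \<in> X"
      using x t X(3) by (intro convexD) auto
    have in1: "(x1, y) + \<tau> *\<^sub>R r \<in> C" "(x2, y) + \<tau> *\<^sub>R r \<in> C" "((1 - t) *\<^sub>R x1 + t *\<^sub>R x2, y) + \<tau> *\<^sub>R r \<in> C"
      using x x12 y r by (auto intro!: inC simp: Z)
    then have "(x1, y) + \<tau> *\<^sub>R r \<in> U" "(x2, y) + \<tau> *\<^sub>R r \<in> U"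
      using CU by auto
    then have UX': "x1 + \<tau> *\<^sub>R fst r \<in> UX" "x2 + \<tau> *\<^sub>R fst r \<in> UX" and UY': "y + \<tau> *\<^sub>R snd r \<in> UY"
      unfolding U by (auto simp: mem_Times_iff)
    have "((1 - t) *\<^sub>R x1 + t *\<^sub>R x2, y) + \<tau> *\<^sub>R r
        = ((1 - t) *\<^sub>R (x1 + \<tau> *\<^sub>R fst r) + t *\<^sub>R (x2 + \<tau> *\<^sub>R fst r), y + \<tau> *\<^sub>R snd r)"
      by (simp add: prod_eq_iff algebra_simps)
    moreover have "\<phi> ((1 - t) *\<^sub>R (x1 + \<tau> *\<^sub>R fst r) + t *\<^sub>R (x2 + \<tau> *\<^sub>R fst r), y + \<tau> *\<^sub>R snd r)
        \<le> (1 - t) * \<phi> (x1 + \<tau> *\<^sub>R fst r, y + \<tau> *\<^sub>R snd r) + t * \<phi> (x2 + \<tau> *\<^sub>R fst r, y + \<tau> *\<^sub>R snd r)"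
      using convex_onD[OF convex_x[OF UY'], of t] UX' t by simp
    moreover have "(x + \<tau> *\<^sub>R fst r, y + \<tau> *\<^sub>R snd r) = (x, y) + \<tau> *\<^sub>R r" for x
      by (simp add: prod_eq_iff)
    ultimately show "\<phi>' (((1 - t) *\<^sub>R x1 + t *\<^sub>R x2, y) + \<tau> *\<^sub>R r)
        \<le> (1 - t) * \<phi>' ((x1, y) + \<tau> *\<^sub>R r) + t * \<phi>' ((x2, y) + \<tau> *\<^sub>R r)"
      unfolding \<phi>'_eq[OF in1(1)] \<phi>'_eq[OF in1(2)] \<phi>'_eq[OF in1(3)] by (simp only:)
  next
    fix r :: "(real ^ 'nx) \<times> (real ^ 'ny)" and x y1 y2 and t :: real
    assume r: "norm r \<le> 1" and x: "x \<in> X" and y: "y1 \<in> Y" "y2 \<in> Y" and t: "0 < t" "t < 1"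
    have y12: "(1 - t) *\<^sub>R y1 + t *\<^sub>R y2 \<in> Y"
      using y t Y(3) by (intro convexD) auto
    have in1: "(x, y1) + \<tau> *\<^sub>R r \<in> C" "(x, y2) + \<tau> *\<^sub>R r \<in> C" "(x, (1 - t) *\<^sub>R y1 + t *\<^sub>R y2) + \<tau> *\<^sub>R r \<in> C"
      using x y12 y r by (auto intro!: inC simp: Z)
    then have "(x, y1) + \<tau> *\<^sub>R r \<in> U" "(x, y2) + \<tau> *\<^sub>R r \<in> U"
      using CU by auto
    then have UY': "y1 + \<tau> *\<^sub>R snd r \<in> UY" "y2 + \<tau> *\<^sub>R snd r \<in> UY" and UX': "x + \<tau> *\<^sub>R fst r \<in> UX"
      unfolding U by (auto simp: mem_Times_iff)
    have "(x, (1 - t) *\<^sub>R y1 + t *\<^sub>R y2) + \<tau> *\<^sub>R r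
        = (x + \<tau> *\<^sub>R fst r, (1 - t) *\<^sub>R (y1 + \<tau> *\<^sub>R snd r) + t *\<^sub>R (y2 + \<tau> *\<^sub>R snd r))"
      by (simp add: prod_eq_iff algebra_simps)
    moreover have "(1 - t) * \<phi> (x + \<tau> *\<^sub>R fst r, y1 + \<tau> *\<^sub>R snd r) + t * \<phi> (x + \<tau> *\<^sub>R fst r, y2 + \<tau> *\<^sub>R snd r)
        \<le> \<phi> (x + \<tau> *\<^sub>R fst r, (1 - t) *\<^sub>R (y1 + \<tau> *\<^sub>R snd r) + t *\<^sub>R (y2 + \<tau> *\<^sub>R snd r))"
      using convex_onD[OF concave_y[OF UX', unfolded concave_on_def] _ _ UY'(1) UY'(2), of t] t by simp
    moreover have "(x + \<tau> *\<^sub>R fst r, y + \<tau> *\<^sub>R snd r) = (x, y) + \<tau> *\<^sub>R r" for y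
      by (simp add: prod_eq_iff)
    ultimately show "(1 - t) * \<phi>' ((x, y1) + \<tau> *\<^sub>R r) + t * \<phi>' ((x, y2) + \<tau> *\<^sub>R r)
        \<le> \<phi>' ((x, (1 - t) *\<^sub>R y1 + t *\<^sub>R y2) + \<tau> *\<^sub>R r)"
      unfolding \<phi>'_eq[OF in1(1)] \<phi>'_eq[OF in1(2)] \<phi>'_eq[OF in1(3)] by (simp only:)
  qed (use lip' params X Y in auto)

  have "DIM((real ^ 'nx) \<times> (real ^ 'ny)) \<ge> 3"
    using n(2) by (simp only: DIM)
  then obtain S :: "(real ^ 'nx) \<times> (real ^ 'ny) \<Rightarrow> real" where S: "S \<in> borel_measurable borel" "\<And>v. 0 \<le> S v"
    "\<And>v u. \<bar>v \<bullet> u\<bar> \<le> S v * p_norm p u"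
    "(\<integral>\<^sup>+e. ennreal (S e ^ 4) \<partial>uniform_sphere) \<le> ennreal ((a_const DIM((real ^ 'nx) \<times> (real ^ 'ny)) q) ^ 4)"
    by (rule dual_gauge_exists[OF pq(1,3,4)]) blast

  define a where "a = a_const n q"
  define K where "K = M_all_sq n M \<sigma> \<Delta> \<tau> q"
  have OS: "one_step P \<phi>' \<delta>' M \<tau> \<Delta> \<sigma> p (real n) a K q S (e k) (\<xi>p k) (\<xi>m k)" if k: "k \<le> N" for k
  proof
    show "real n = real DIM((real ^ 'nx) \<times> (real ^ 'ny))" "a = a_const DIM((real ^ 'nx) \<times> (real ^ 'ny)) q" "K = M_all_sq DIM((real ^ 'nx) \<times> (real ^ 'ny)) M \<sigma> \<Delta> \<tau> q" "DIM((real ^ 'nx) \<times> (real ^ 'ny)) \<ge> 3"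
      using n(2) by (simp_all only: DIM a_def K_def)
    show "(\<integral>\<^sup>+e. ennreal (S e ^ 4) \<partial>uniform_sphere) \<le> ennreal (a ^ 4)"
      using S(4) by (simp only: DIM a_def)
  qed (use lip' \<delta>'_meas \<delta>'_bound params pq S(1-3) e_sphere[OF k] e_uniform[OF k] noise_plus[OF k] noise_minus[OF k]
        indep_direction_noise[OF k] in auto)

  interpret prox_setup d Z p
    by standard (use Zc prox_fun diameter pq in auto)

  define W where "W k \<omega> = (e k \<omega>, \<xi>p k \<omega>, \<xi>m k \<omega>)" for k \<omega>
  have W: "one_step.W (e k) (\<xi>p k) (\<xi>m k) = W k" if "k \<le> N" for k
    using one_step.W_def[OF OS[OF that]] by (auto simp: W_def fun_eq_iff)
  define g where "g z w = amp \<phi>' \<delta>' \<tau> z w *\<^sub>R flip_snd (fst w)" for z w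
  define s where "s z w = \<bar>amp \<phi>' \<delta>' \<tau> z w\<bar> * S (fst w)" for z w
  define G where "G k z = (\<integral>\<omega>. g z (W k \<omega>) \<partial>P)" for k z
  \<comment> \<open>Neither \<open>est\<close> nor the bound \<open>s\<close> involves the random
    variables of a particular iteration, so the instance for iteration \<open>0\<close> identifies
    them for every \<open>k\<close>.\<close>
  have est: "one_step.est \<phi>' \<delta>' \<tau> = g"
    using one_step.est_def[OF OS[of 0]] by (auto simp: g_def fun_eq_iff)
  have s: "one_step.s \<phi>' \<delta>' \<tau> S = s"
    using one_step.s_def[OF OS[of 0]] by (auto simp: s_def fun_eq_iff)
  have Gbar: "one_step.Gbar P \<phi>' \<delta>' \<tau> (e k) (\<xi>p k) (\<xi>m k) = G k" if "k \<le> N" for k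
    using one_step.Gbar_def[OF OS[OF that]] by (auto simp: G_def fun_eq_iff est W[OF that])

  have [measurable]: "\<phi>' \<in> borel_measurable borel" "\<delta>' \<in> borel_measurable borel" "S \<in> borel_measurable borel"
    using lipschitz_measurable[OF lip'] \<delta>'_meas S(1) by auto
  have amp_meas [measurable]: "(\<lambda>x. amp \<phi>' \<delta>' \<tau> (fst x) (snd x)) \<in> borel_measurable borel"
    unfolding amp_def noisy_value_def by measurable

  interpret md: mirror_descent d Z p P W g s G K \<gamma> N z0
  proof
    show "(\<lambda>x. g (fst x) (snd x)) \<in> borel_measurable borel"
      unfolding g_def by measurable
    show "(\<lambda>x. s (fst x) (snd x)) \<in> borel_measurable borel"
      unfolding s_def by measurable
    show "indep_vars (\<lambda>_. borel) W {..N}"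
      using indep_iterations by (simp only: W_def[abs_def])
    show "K > 0"
      using one_step.Mall_pos[OF OS[of 0]] by simp
    show "0 \<le> s z w" for z w
      using S(2) by (simp add: s_def)
    show "\<bar>g z w \<bullet> h\<bar> \<le> s z w * p_norm p h" for z w h
      using one_step.est_inner_bound[OF OS[of 0]] by (simp add: est s)
    fix k z assume k: "k \<le> N"
    show "integrable P (\<lambda>\<omega>. g z (W k \<omega>))"
      using one_step.est_int[OF OS[OF k]] by (simp add: est W[OF k])
    have "integrable P (\<lambda>\<omega>. (s z (W k \<omega>))\<^sup>2)" "(\<integral>\<omega>. (s z (W k \<omega>))\<^sup>2 \<partial>P) \<le> K"
      using one_step.s_sq[OF OS[OF k]] by (simp_all add: s W[OF k])
    then show "(\<integral>\<^sup>+\<omega>. ennreal ((s z (W k \<omega>))\<^sup>2) \<partial>P) \<le> ennreal K"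
      by (simp add: nn_integral_eq_integral ennreal_leI)
    show "\<bar>G k z \<bullet> h\<bar> \<le> sqrt K * p_norm p h" for h
      using one_step.Gbar_dual[OF OS[OF k]] by (simp add: Gbar[OF k])
  qed (use params z0 G_def in auto)

  \<comment> \<open>The given iterates use \<open>\<phi>\<close>, \<open>\<delta>\<close> and
    \<open>prox\<close>, those of \<open>md\<close> the extensions and \<open>prox'\<close>. They
    agree because every iterate stays in \<open>Z\<close>, so that all queries fall into
    \<open>C\<close>.\<close>
  have z_eq: "z k \<omega> = md.zz k \<omega>" if "\<omega> \<in> space P" "k \<le> Suc N" for k \<omega>
    using that(2)
  proof (induction k)
    case 0
    then show ?case
      using z_init[OF that(1)] by (simp add: md.st_def)
  next
    case (Suc k)
    then have k: "k \<le> N" and IH: "z k \<omega> = md.zz k \<omega>" by auto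
    have zk: "z k \<omega> \<in> Z"
      unfolding IH by (rule md.st_in)
    have "grad_est \<phi> \<delta> (z k \<omega>) (e k \<omega>) \<tau> (\<xi>p k \<omega>) (\<xi>m k \<omega>) = grad_est \<phi>' \<delta>' (z k \<omega>) (e k \<omega>) \<tau> (\<xi>p k \<omega>) (\<xi>m k \<omega>)"
      unfolding grad_est_def using inC[OF zk, of "e k \<omega>"] inC'[OF zk, of "e k \<omega>"] e_sphere[OF k that(1)]
      by (simp add: noisy)
    also have "\<dots> = g (z k \<omega>) (W k \<omega>)"
      by (simp add: grad_est_amp g_def W_def)
    finally show ?case
      using z_step[OF k that(1)] zk by (simp add: md.st_def IH prox'_eq)
  qed

  define zb where "zb \<omega> = (1 / real (Suc N)) *\<^sub>R (\<Sum>k<Suc N. md.zz k \<omega>)" for \<omega>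
  have zb_in: "zb \<omega> \<in> Z" for \<omega>
  proof -
    have "(\<Sum>k<Suc N. (1 / real (Suc N)) *\<^sub>R md.zz k \<omega>) \<in> Z"
      by (rule convex_sum) (use Zc md.st_in in auto)
    then show ?thesis
      by (simp only: zb_def scaleR_sum_right)
  qed
  have zbar_eq: "zbar \<omega> = zb \<omega>" if w: "\<omega> \<in> space P" for \<omega>
  proof -
    have "{0..N} = {..<Suc N}" by auto
    then show ?thesis
      unfolding zbar[OF w] zb_def using z_eq[OF w] by (auto intro!: arg_cong2[of _ _ _ _ "scaleR"] sum.cong)
  qed
  have gap_eq: "saddle_gap \<phi> X Y w = saddle_gap \<phi>' X Y w" if "w \<in> Z" for w
  proof -
    have "\<phi> (fst w, y) = \<phi>' (fst w, y)" if "y \<in> Y" for y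
    proof -
      have "(fst w, y) \<in> Z"
        using that \<open>w \<in> Z\<close> by (auto simp: ZXY mem_Times_iff)
      then show ?thesis
        using ZC by (simp add: \<phi>'_eq subset_iff del: split_paired_All)
    qed
    moreover have "\<phi> (x, snd w) = \<phi>' (x, snd w)" if "x \<in> X" for x
    proof -
      have "(x, snd w) \<in> Z"
        using that \<open>w \<in> Z\<close> by (auto simp: ZXY mem_Times_iff)
      then show ?thesis
        using ZC by (simp add: \<phi>'_eq subset_iff del: split_paired_All)
    qed
    ultimately show ?thesis
      unfolding saddle_gap_def by (intro arg_cong2[of _ _ _ _ "(-)"] SUP_cong INF_cong) auto
  qed
  have gap_zb: "saddle_gap \<phi> X Y (zbar \<omega>) = saddle_gap \<phi>' X Y (zb \<omega>)" if "\<omega> \<in> space P" for \<omega>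
    using zbar_eq[OF that] gap_eq[OF zb_in] by simp

  have zz_meas: "md.zz k \<in> borel_measurable P" if "k \<le> Suc N" for k
    using md.st_meas[OF that] by measurable
  then have [measurable]: "zb \<in> borel_measurable P"
    unfolding zb_def[abs_def] by (intro borel_measurable_scaleR borel_measurable_sum) auto
  have [measurable]: "saddle_gap \<phi>' X Y \<in> borel_measurable borel"
    by (rule lipschitz_measurable[OF cc.saddle_gap_lipschitz])
  have "bounded (saddle_gap \<phi>' X Y ` Z)"
    by (intro compact_imp_bounded compact_continuous_image Zc
      continuous_on_subset[OF lipschitz_on_continuous_on[OF cc.saddle_gap_lipschitz]]) auto
  then obtain B where B: "\<And>w. w \<in> Z \<Longrightarrow> \<bar>saddle_gap \<phi>' X Y w\<bar> \<le> B"
    unfolding bounded_iff by auto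
  have gap_int: "integrable P (\<lambda>\<omega>. saddle_gap \<phi>' X Y (zb \<omega>))"
    by (rule integrable_const_bound[where B = B]) (use B zb_in in auto)

  \<comment> \<open>The bias of \<open>Gbar_lower\<close> after bounding \<open>p_norm p\<close> of
    a difference of two points of \<open>Z\<close> by the Bregman diameter.\<close>
  define c where "c = \<Delta> * \<Omega> * real n * a / \<tau>"
  have gap_le: "saddle_gap \<phi>' X Y (zb \<omega>) \<le> md.R \<omega> / real (Suc N) + c + 2 * \<tau> * M" for \<omega>
    unfolding zb_def
  proof (rule cc.saddle_gap_mean_le)
    show "md.zz k \<omega> \<in> X \<times> Y" for k
      using md.st_in(1) by (simp add: ZXY[symmetric])
    show "(\<Sum>k<Suc N. G k (md.zz k \<omega>) \<bullet> (md.zz k \<omega> - u)) \<le> md.R \<omega>" if "u \<in> X \<times> Y" for u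
      using that by (intro md.regret) (simp add: ZXY)
    fix k u assume k: "k < Suc N" and u: "u \<in> X \<times> Y"
    let ?h = "md.zz k \<omega> - u"
    have "ball_avg_grad \<phi>' \<tau> (md.zz k \<omega>) \<bullet> flip_snd ?h - \<Delta> * real n * a / \<tau> * p_norm p ?h \<le> G k (md.zz k \<omega>) \<bullet> ?h"
      using one_step.Gbar_lower[OF OS[of k], of "md.zz k \<omega>" ?h] k by (simp add: Gbar)
    moreover have "\<Delta> * real n * a / \<tau> * p_norm p ?h \<le> \<Delta> * real n * a / \<tau> * \<Omega>"
      using u params one_step.a_pos[OF OS[of 0]] n(2) md.st_in(1)
      by (intro mult_left_mono p_norm_le_\<Omega>) (auto simp: ZXY[symmetric])
    ultimately show "ball_avg_grad \<phi>' \<tau> (md.zz k \<omega>) \<bullet> flip_snd ?h \<le> G k (md.zz k \<omega>) \<bullet> ?h + c"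
      by (simp add: c_def mult_ac)
  qed simp
  have "(\<integral>\<omega>. saddle_gap \<phi>' X Y (zb \<omega>) \<partial>P) \<le> (\<integral>\<omega>. md.R \<omega> / real (Suc N) + c + 2 * \<tau> * M \<partial>P)"
    using md.R_integrable by (intro integral_mono gap_int gap_le) auto
  also have "\<dots> = (\<integral>\<omega>. md.R \<omega> \<partial>P) / real (Suc N) + c + 2 * \<tau> * M"
    using md.R_integrable by (simp add: prob_space)
  also have "\<dots> \<le> (3 * \<Omega>\<^sup>2 / (2 * \<gamma>) + real (Suc N) * (3 * \<gamma> * K / 2)) / real (Suc N) + c + 2 * \<tau> * M"
    by (intro add_right_mono divide_right_mono md.R_integral) simp
  also have "\<dots> = 3 * \<Omega>\<^sup>2 / (2 * \<gamma> * real (N + 1)) + 3 * \<gamma> * K / 2 + c + 2 * \<tau> * M"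
  proof -
    have "(b / (2 * \<gamma>) + m * b') / m = b / (2 * \<gamma> * m) + b'" if "m > 0" for b b' m :: real
      using that by (simp add: add_divide_distrib)
    from this[of "real (Suc N)" "3 * \<Omega>\<^sup>2" "3 * \<gamma> * K / 2"] show ?thesis
      by simp
  qed
  finally have "(\<integral>\<omega>. saddle_gap \<phi>' X Y (zb \<omega>) \<partial>P)
      \<le> 3 * \<Omega>\<^sup>2 / (2 * \<gamma> * real (N + 1)) + 3 * \<gamma> * K / 2 + c + 2 * \<tau> * M" .
  moreover have "integrable P (\<lambda>\<omega>. saddle_gap \<phi> X Y (zbar \<omega>))"
    using gap_int by (subst Bochner_Integration.integrable_cong[OF refl gap_zb])
  moreover have "(\<integral>\<omega>. saddle_gap \<phi> X Y (zbar \<omega>) \<partial>P) = (\<integral>\<omega>. saddle_gap \<phi>' X Y (zb \<omega>) \<partial>P)"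
    by (intro Bochner_Integration.integral_cong refl gap_zb)
  ultimately show ?thesis
    by (simp only: c_def a_def K_def)
qed

end
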